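(* Let $p\ge2$ be an integer and let $(F_n)_{n\ge0}$, $(V_i)_{i\ge1}$ be the generating functions of $p$-constellations defined in the context. For every $n\ge 0$, $F_n$ equals the sum of the weights of all $p$-excursions of length $np$, where the weight of a $p$-path is the product, over its falls, of $V_i$ with $i$ the starting height of the fall.
   Context: Fix an integer $p\ge 2$. A planar map is a proper embedding of a connected graph in the sphere, considered up to orientation-preserving homeomorphism; degrees count incident edges with multiplicity. A $p$-constellation is a planar map whose faces are colored black or white so that adjacent faces have opposite colors, every black face has degree $p$, and every white face has degree a multiple of $p$. Each edge is oriented so that its incident white face lies on its right. A constellation is rooted if one edge (root edge) is distinguished; the white root face is the white face incident to it, and the root degree is its degree. A constellation is pointed if a vertex (pointed vertex, not necessarily incident to the root edge) is distinguished. Let $(x_k)_{k\ge1}$ be formal variables; a white face of degree $kp$ has weight $x_k$. For $n\ge1$, $F_n$ is the generating function of rooted $p$-constellations with root degree $np$, the weight being the product of the weights of the white faces other than the white root face; $F_0=1$. In a pointed constellation, a vertex $v$ has type $j$ if $j$ is the minimal length of an oriented path from $v$ to the pointed vertex; an edge has type $j\to j'$ if its origin and endpoint have types $j,j'$. For $i\ge1$, $V_i$ is $1$ plus the generating function (weight = product of weights of all white faces) of pointed rooted $p$-constellations whose root edge has type $j\to j-1$ with $j\le i$. A $p$-path is a lattice path in $\mathbb Z\times\mathbb N$ with steps rises $(1,p-1)$ and falls $(1,-1)$; a fall starting at $(a,i)$ has starting height $i$. A $p$-excursion of length $np$ is a $p$-path from $(0,0)$ to $(np,0)$. *)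

theory Defs
  imports Main "HOL-Library.Multiset"
begin

section \<open>Formal power series in the variables x_1, x_2, ...\<close>

text \<open>A series is given by its coefficients: a monomial x_{k1} x_{k2} ... is the
  multiset {#k1, k2, ...#}.\<close>

type_synonym ser = "nat multiset \<Rightarrow> nat"

definition ser_one :: ser where
  "ser_one m = (if m = {#} then 1 else 0)"

definition ser_add :: "ser \<Rightarrow> ser \<Rightarrow> ser" where
  "ser_add f g = (\<lambda>m. f m + g m)"

definition ser_mult :: "ser \<Rightarrow> ser \<Rightarrow> ser" where
  "ser_mult f g = (\<lambda>m. \<Sum>a\<in>{a. a \<subseteq># m}. f a * g (m - a))"

definition ser_prod_list :: "ser list \<Rightarrow> ser" where
  "ser_prod_list xs = foldr ser_mult xs ser_one"

definition ser_sum :: "('a \<Rightarrow> ser) \<Rightarrow> 'a set \<Rightarrow> ser" where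
  "ser_sum f A = (\<lambda>m. \<Sum>x\<in>A. f x m)"

section \<open>Combinatorial maps (rotation systems) on darts 0..<N\<close>

text \<open>Darts are half-edges. sg h = next dart counterclockwise around the vertex of h,
  al h = other half of the edge of h. Vertices are sg-orbits; the face of h (the face to
  the left of h, directed away from its vertex) is the orbit of h under al o sg.\<close>

definition perm_on :: "nat \<Rightarrow> (nat \<Rightarrow> nat) \<Rightarrow> bool" where
  "perm_on N f \<longleftrightarrow> bij_betw f {..<N} {..<N} \<and> (\<forall>x\<ge>N. f x = x)"

definition orbit_of :: "(nat \<Rightarrow> nat) \<Rightarrow> nat \<Rightarrow> nat set" where
  "orbit_of f x = {(f ^^ k) x | k. True}"

record rcons =
  nd :: nat
  sg :: "nat \<Rightarrow> nat"
  al :: "nat \<Rightarrow> nat"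
  wh :: "nat \<Rightarrow> bool"
  rt :: nat

definition vert :: "rcons \<Rightarrow> nat \<Rightarrow> nat set" where
  "vert M h = orbit_of (sg M) h"

definition face :: "rcons \<Rightarrow> nat \<Rightarrow> nat set" where
  "face M h = orbit_of (al M \<circ> sg M) h"

definition vertices :: "rcons \<Rightarrow> nat set set" where
  "vertices M = vert M ` {..<nd M}"

definition faces :: "rcons \<Rightarrow> nat set set" where
  "faces M = face M ` {..<nd M}"

text \<open>Planar map: a connected rotation system with Euler characteristic 2.\<close>
definition is_planar_map :: "rcons \<Rightarrow> bool" where
  "is_planar_map M \<longleftrightarrow>
     perm_on (nd M) (sg M) \<and> perm_on (nd M) (al M) \<and>
     (\<forall>h<nd M. al M h \<noteq> h \<and> al M (al M h) = h) \<and>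
     (\<forall>x<nd M. \<forall>y<nd M. (x, y) \<in> ({(a, sg M a) | a. a < nd M} \<union> {(a, al M a) | a. a < nd M})\<^sup>*) \<and>
     card (vertices M) + card (faces M) = nd M div 2 + 2"

text \<open>p-constellation with face colouring (wh h = the face of h is white) and a root:
  rt is the dart of the root edge lying in the white root face.\<close>
definition rooted_constellation :: "nat \<Rightarrow> rcons \<Rightarrow> bool" where
  "rooted_constellation p M \<longleftrightarrow>
     is_planar_map M \<and>
     (\<forall>x\<ge>nd M. \<not> wh M x) \<and>
     (\<forall>h<nd M. wh M (al M (sg M h)) = wh M h) \<and>
     (\<forall>h<nd M. wh M (al M h) \<longleftrightarrow> \<not> wh M h) \<and>
     (\<forall>h<nd M. \<not> wh M h \<longrightarrow> card (face M h) = p) \<and>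
     (\<forall>h<nd M. wh M h \<longrightarrow> p dvd card (face M h)) \<and>
     rt M < nd M \<and> wh M (rt M)"

definition root_degree :: "rcons \<Rightarrow> nat" where
  "root_degree M = card (face M (rt M))"

definition white_faces :: "rcons \<Rightarrow> nat set set" where
  "white_faces M = {face M h | h. h < nd M \<and> wh M h}"

text \<open>Weight monomials: a white face of degree k p contributes x_k.\<close>
definition weight_all :: "nat \<Rightarrow> rcons \<Rightarrow> nat multiset" where
  "weight_all p M = image_mset (\<lambda>F. card F div p) (mset_set (white_faces M))"

definition weight_nonroot :: "nat \<Rightarrow> rcons \<Rightarrow> nat multiset" where
  "weight_nonroot p M = image_mset (\<lambda>F. card F div p) (mset_set (white_faces M - {face M (rt M)}))"

text \<open>Isomorphism (relabelling of darts), preserving colours and root.\<close>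
definition iso_r :: "rcons \<Rightarrow> rcons \<Rightarrow> (nat \<Rightarrow> nat) \<Rightarrow> bool" where
  "iso_r M M' \<pi> \<longleftrightarrow> nd M = nd M' \<and> bij_betw \<pi> {..<nd M} {..<nd M'} \<and>
     (\<forall>h<nd M. \<pi> (sg M h) = sg M' (\<pi> h) \<and> \<pi> (al M h) = al M' (\<pi> h) \<and> wh M' (\<pi> h) = wh M h) \<and>
     \<pi> (rt M) = rt M'"

definition iso_rooted :: "(rcons \<times> rcons) set" where
  "iso_rooted = {(M, M'). \<exists>\<pi>. iso_r M M' \<pi>}"

definition iso_pointed :: "((rcons \<times> nat set) \<times> (rcons \<times> nat set)) set" where
  "iso_pointed = {((M, v), (M', v')). \<exists>\<pi>. iso_r M M' \<pi> \<and> \<pi> ` v = v'}"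

text \<open>Oriented edges (white face on the right): for a dart h in a white face the edge
  goes from vert (al h) to vert h.\<close>
definition oedges :: "rcons \<Rightarrow> (nat set \<times> nat set) set" where
  "oedges M = {(vert M (al M h), vert M h) | h. h < nd M \<and> wh M h}"

definition vtype :: "rcons \<Rightarrow> nat set \<Rightarrow> nat set \<Rightarrow> nat" where
  "vtype M v u = (LEAST k. (u, v) \<in> oedges M ^^ k)"

section \<open>Generating functions\<close>

definition Fgf :: "nat \<Rightarrow> nat \<Rightarrow> ser" where
  "Fgf p n = (if n = 0 then ser_one else
     (\<lambda>m. card ({M. rooted_constellation p M \<and> root_degree M = n * p \<and>
                     weight_nonroot p M = m} // iso_rooted)))"

definition Vgf :: "nat \<Rightarrow> nat \<Rightarrow> ser" where
  "Vgf p i = ser_add ser_one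
     (\<lambda>m. card ({(M, v). rooted_constellation p M \<and> v \<in> vertices M \<and>
                     vtype M v (vert M (rt M)) + 1 = vtype M v (vert M (al M (rt M))) \<and>
                     vtype M v (vert M (al M (rt M))) \<le> i \<and>
                     weight_all p M = m} // iso_pointed))"

section \<open>p-paths\<close>

text \<open>A p-path is a list of steps: True = rise (1,p-1), False = fall (1,-1).\<close>
definition height :: "nat \<Rightarrow> bool list \<Rightarrow> int" where
  "height p s = int (p - 1) * int (length (filter id s)) - int (length (filter Not s))"

definition p_excursion :: "nat \<Rightarrow> nat \<Rightarrow> bool list \<Rightarrow> bool" where
  "p_excursion p n s \<longleftrightarrow> length s = n * p \<and>
     (\<forall>j\<le>length s. height p (take j s) \<ge> 0) \<and> height p s = 0"

definition path_weight :: "nat \<Rightarrow> (nat \<Rightarrow> ser) \<Rightarrow> bool list \<Rightarrow> ser" where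
  "path_weight p V s = ser_prod_list
     (map (\<lambda>j. V (nat (height p (take j s)))) (filter (\<lambda>j. \<not> s ! j) [0..<length s]))"

end

theory Submission
  imports Defs "HOL-Combinatorics.Cycles"
begin

text \<open>Distances to the pointed vertex make a constellation a labelled map in which every edge is
  either a fall \<open>j \<rightarrow> j - 1\<close> or a rise \<open>j \<rightarrow> j + (p - 1)\<close> (this uses planarity) and in which the
  pointed vertex is the only vertex without an outgoing fall; conversely a label function with
  these properties is the distance up to a constant. So one counts labelled maps with a prescribed
  word of labels around the root face, and shows that their generating function is the product of
  the \<open>V\<close>'s over the falls of the word, by peeling one edge at a time. A rise of the
  word may be deleted: this opens the black face behind it and replaces the rise by \<open>p - 1\<close>
  black steps upwards. If no rise is left, a maximal label is reached by a black step and left by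
  a fall. The edge of the black step either is a leaf, or is deleted and opens the white face
  behind it; in both cases the distances are unchanged, since the fall on the boundary provides
  another geodesic from the top vertex. The two cases are the two summands of
  \<open>V i = 1 + \<dots>\<close>. Labelled structures on \<open>N\<close> darts are counted throughout; rooted
  maps are rigid, so dividing by \<open>N!\<close> gives isomorphism classes.\<close>

section \<open>Cycles and orbits of permutations\<close>

text \<open>Planarity enters through a cocycle: each dart carries the label difference across its
  edge, plus 1 if white and minus 1 if black. Around a face the differences cancel, so the sum is
  plus or minus the degree, a multiple of \<open>p\<close>; on the sphere this forces divisibility
  by \<open>p\<close> dart by dart. Connectedness is never maintained as such. In its place stands
  the single vertex without outgoing fall, to which every vertex descends; an Euler inequality with
  local minima instead of components then shows that an edge whose removal leaves only one minimum
  separates two faces. Labels are natural numbers, and this bounds the types: a root fall from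
  \<open>j\<close> can be shifted to a fall from \<open>i\<close> exactly if
  \<open>j \<le> i\<close>, the condition in \<open>V i\<close>. For \<open>F n\<close> the origin
  of the root edge is taken as pointed vertex; it has label 0, and the labels around the root face
  form an excursion. The identity looks circular, since the \<open>V i\<close> on its right-hand
  side count maps themselves. One induction on the number of darts resolves this, because the
  coefficients of \<open>V i\<close> that are needed involve only maps with fewer darts.\<close>

definition cycl :: "(nat \<Rightarrow> nat) \<Rightarrow> nat list \<Rightarrow> bool" where
  "cycl f xs \<longleftrightarrow> xs \<noteq> [] \<and> distinct xs \<and> map f xs = rotate1 xs"

lemma cycl_rotate1: "cycl f xs \<Longrightarrow> cycl f (rotate1 xs)"
  by (auto simp: cycl_def rotate1_map[symmetric])

lemma cycl_rotate: "cycl f xs \<Longrightarrow> cycl f (rotate n xs)"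
  by (induction n) (auto simp: cycl_rotate1)

lemma cycl_append_commute: "cycl f (xs @ ys) \<Longrightarrow> cycl f (ys @ xs)"
  using cycl_rotate[of f "xs @ ys" "length xs"] by (simp add: rotate_append)

lemma cycl_Cons_iff: "cycl f (x # xs) \<longleftrightarrow> distinct (x # xs) \<and> f x # map f xs = xs @ [x]"
  by (simp add: cycl_def)

lemma cycl_image: "cycl f xs \<Longrightarrow> x \<in> set xs \<Longrightarrow> f x \<in> set xs"
  by (metis cycl_def imageI list.set_map set_rotate1)

lemma cycl_funpow:
  assumes "cycl f xs"
  shows "(f ^^ k) (xs ! 0) = xs ! (k mod length xs)"
proof (induction k)
  case 0 then show ?case using assms by (simp add: cycl_def)
next
  case (Suc k)
  have n: "xs \<noteq> []" "map f xs = rotate1 xs" using assms by (auto simp: cycl_def)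
  have "f (xs ! (k mod length xs)) = map f xs ! (k mod length xs)" using n(1) by simp
  also have "\<dots> = xs ! (Suc (k mod length xs) mod length xs)"
    unfolding n(2) using n(1) by (subst nth_rotate1) auto
  finally show ?case using Suc by (simp add: mod_Suc_eq)
qed

lemma cycl_orbit_hd:
  assumes "cycl f xs" shows "orbit_of f (xs ! 0) = set xs"
proof -
  have n: "xs \<noteq> []" using assms by (auto simp: cycl_def)
  have "set xs = {xs ! k | k. k < length xs}" by (auto simp: in_set_conv_nth)
  also have "\<dots> = {xs ! (k mod length xs) | k. True}" using n by (auto intro: exI[of _ "_ mod _"]) (metis mod_less)
  finally show ?thesis unfolding orbit_of_def cycl_funpow[OF assms] by simp
qed

lemma cycl_orbit:
  assumes "cycl f xs" "x \<in> set xs" shows "orbit_of f x = set xs"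
proof -
  obtain ys zs where "xs = ys @ x # zs" using assms(2) by (meson split_list)
  then have "cycl f (x # zs @ ys)" using assms(1) cycl_append_commute[of f ys "x # zs"] by simp
  from cycl_orbit_hd[OF this] show ?thesis using \<open>xs = _\<close> by auto
qed

lemma cycl_to_front:
  assumes "cycl f xs" "x \<in> set xs"
  obtains ys where "cycl f (x # ys)" "set (x # ys) = set xs" "length (x # ys) = length xs"
proof -
  obtain ys zs where *: "xs = ys @ x # zs" using assms(2) by (meson split_list)
  then have "cycl f (x # zs @ ys)" using assms(1) cycl_append_commute[of f ys "x # zs"] by simp
  then show ?thesis using * by (intro that[of "zs @ ys"]) auto
qed

lemma cycl_unique:
  assumes "cycl f (x # xs)" "cycl f (x # ys)" shows "xs = ys"
proof -
  have "set (x # xs) = set (x # ys)" using cycl_orbit_hd[OF assms(1)] cycl_orbit_hd[OF assms(2)] by simp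
  then have len: "length (x # xs) = length (x # ys)" using assms by (metis cycl_def distinct_card)
  have "(x # xs) ! k = (x # ys) ! k" if "k < length (x # xs)" for k
    using cycl_funpow[OF assms(1), of k] cycl_funpow[OF assms(2), of k] that len by simp
  with len have "x # xs = x # ys" by (rule nth_equalityI)
  then show ?thesis by simp
qed

text \<open>The list runs through one least period of \<open>x\<close>; by injectivity, a repetition
  inside it would give a shorter period.\<close>

lemma cycl_exists:
  assumes "f permutes D" "finite D"
  obtains xs where "cycl f (x # xs)"
proof -
  have fp: "permutation f" using assms by (auto simp: permutation_permutes)
  then have "\<exists>n>0. (f ^^ n) x = x"
    using permutation_is_nilpotent by (metis id_apply)
  define n where "n = (LEAST n. n > 0 \<and> (f ^^ n) x = x)"
  have n: "n > 0" "(f ^^ n) x = x"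
    using LeastI_ex[OF \<open>\<exists>n>0. _\<close>] unfolding n_def by auto
  have least: "(f ^^ k) x \<noteq> x" if "0 < k" "k < n" for k
    using not_less_Least[of k "\<lambda>n. n > 0 \<and> (f ^^ n) x = x"] that unfolding n_def by auto
  have bij: "inj f" using assms(1) by (simp add: permutes_inj)
  have ne: "(f ^^ i) x \<noteq> (f ^^ j) x" if "i < j" "j < n" for i j
  proof
    assume "(f ^^ i) x = (f ^^ j) x"
    also have "(f ^^ j) x = (f ^^ i) ((f ^^ (j - i)) x)" using that by (simp flip: funpow_add comp_apply[of "f ^^ i"] add: o_def[symmetric])
    finally have "x = (f ^^ (j - i)) x" using bij by (metis inj_fn injD)
    then show False using least[of "j - i"] that by (metis less_imp_diff_less zero_less_diff)
  qed
  let ?xs = "map (\<lambda>k. (f ^^ k) x) [0..<n]"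
  have "distinct ?xs" unfolding distinct_map inj_on_def
    using ne by (auto) (metis linorder_neqE_nat)
  moreover have "map f ?xs = rotate1 ?xs"
  proof (rule nth_equalityI)
    fix i assume "i < length (map f ?xs)"
    then have i: "i < n" by simp
    then show "map f ?xs ! i = rotate1 ?xs ! i"
      using n by (cases "Suc i = n") (auto simp: nth_rotate1)
  qed simp
  moreover have "?xs = x # map (\<lambda>k. (f ^^ k) x) [1..<n]" using n by (simp add: upt_conv_Cons)
  ultimately show ?thesis by (metis cycl_def list.distinct(1) that)
qed

section \<open>Orbits of a permutation of a finite set\<close>

context
  fixes f :: "nat \<Rightarrow> nat" and D :: "nat set"
  assumes f: "f permutes D" and fin: "finite D"
begin

lemma orbit_refl: "x \<in> orbit_of f x"
  unfolding orbit_of_def by (auto intro: exI[of _ 0])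

lemma orbit_eq: "y \<in> orbit_of f x \<Longrightarrow> orbit_of f y = orbit_of f x"
  by (metis cycl_exists[OF f fin, of x] cycl_orbit list.set_intros(1))

lemma orbit_step: "f y \<in> orbit_of f x \<longleftrightarrow> y \<in> orbit_of f x"
proof -
  have "f y \<in> orbit_of f y" unfolding orbit_of_def by (auto intro: exI[of _ 1])
  then show ?thesis using orbit_eq by (metis orbit_refl)
qed

lemma orbit_subset: "x \<in> D \<Longrightarrow> orbit_of f x \<subseteq> D"
proof -
  assume "x \<in> D"
  then have "(f ^^ k) x \<in> D" for k by (induction k) (auto simp: permutes_in_image[OF f])
  then show ?thesis unfolding orbit_of_def by auto
qed

lemma orbit_finite: "x \<in> D \<Longrightarrow> finite (orbit_of f x)"
  using orbit_subset fin by (auto intro: finite_subset)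

lemma orbit_eq_iff: "orbit_of f x = orbit_of f y \<longleftrightarrow> y \<in> orbit_of f x"
  using orbit_eq orbit_refl by metis

lemma orbit_sym: "y \<in> orbit_of f x \<longleftrightarrow> x \<in> orbit_of f y"
  using orbit_eq orbit_refl by metis

lemma orbit_induct:
  assumes "y \<in> orbit_of f x" "P x" "\<And>z. z \<in> orbit_of f x \<Longrightarrow> P z \<Longrightarrow> P (f z)"
  shows "P y"
proof -
  have "(f ^^ k) x \<in> orbit_of f x \<and> P ((f ^^ k) x)" for k
    by (induction k) (use assms orbit_step orbit_refl in auto)
  then show ?thesis using assms(1) unfolding orbit_of_def by auto
qed

lemma orbit_fixed: "f x = x \<Longrightarrow> orbit_of f x = {x}"
  using orbit_induct[of _ x "\<lambda>y. y = x"] orbit_refl by auto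

end

definition norb :: "(nat \<Rightarrow> nat) \<Rightarrow> nat set \<Rightarrow> nat" where
  "norb f D = card (orbit_of f ` D)"

lemma norb_split:
  assumes f: "f permutes D" and fin: "finite D" and S: "S \<subseteq> D" "\<And>x. x \<in> S \<Longrightarrow> orbit_of f x \<subseteq> S"
  shows "norb f D = norb f S + norb f (D - S)"
proof -
  have "orbit_of f ` D = orbit_of f ` S \<union> orbit_of f ` (D - S)" using S(1) by auto
  moreover have "orbit_of f ` S \<inter> orbit_of f ` (D - S) = {}"
    using S(2) orbit_refl[OF f fin] by fastforce
  ultimately show ?thesis unfolding norb_def using fin S(1)
    by (simp add: card_Un_disjoint finite_subset)
qed

lemma norb_cong: "(\<And>x. x \<in> D \<Longrightarrow> orbit_of f x = orbit_of g x) \<Longrightarrow> norb f D = norb g D"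
  unfolding norb_def by (metis (no_types, lifting) image_cong)

lemma norb_cycl: "cycl f xs \<Longrightarrow> norb f (set xs) = 1"
proof -
  assume a: "cycl f xs"
  then have "xs \<noteq> []" by (simp add: cycl_def)
  then have "orbit_of f ` set xs = {set xs}" using cycl_orbit[OF a] by (simp add: image_constant_conv cong: image_cong)
  then show ?thesis by (simp add: norb_def)
qed

lemma norb_cycl2:
  assumes "cycl f xs" "cycl f ys" "set xs \<inter> set ys = {}"
  shows "norb f (set xs \<union> set ys) = 2"
proof -
  have "xs \<noteq> []" "ys \<noteq> []" using assms by (auto simp: cycl_def)
  then have "orbit_of f ` (set xs \<union> set ys) = {set xs, set ys}"
    using cycl_orbit[OF assms(1)] cycl_orbit[OF assms(2)]
    by (simp add: image_Un image_constant_conv insert_commute cong: image_cong)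
  moreover have "set xs \<noteq> set ys" using assms(3) \<open>xs \<noteq> []\<close> by auto
  ultimately show ?thesis by (simp add: norb_def)
qed

text \<open>Bypasses \<open>a\<close> in its cycle and leaves it as a fixed point, so the cyclic
  order of the remaining points is kept.\<close>

definition rem :: "nat \<Rightarrow> (nat \<Rightarrow> nat) \<Rightarrow> nat \<Rightarrow> nat" where
  "rem a f = (\<lambda>x. if x = a then a else if f x = a then f a else f x)"

lemma rem_conv_transpose: "inj f \<Longrightarrow> rem a f = transpose a (f a) \<circ> f"
  by (auto simp: rem_def transpose_def fun_eq_iff dest: injD)

lemma rem_permutes:
  assumes "f permutes D" shows "rem a f permutes D - {a}"
proof (cases "a \<in> D")
  case True
  then have "transpose a (f a) \<circ> f permutes D"
    using assms by (intro permutes_compose permutes_swap_id) (auto simp: permutes_in_image)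
  then have "rem a f permutes D" using assms by (simp add: rem_conv_transpose permutes_inj)
  then show ?thesis by (rule permutes_superset) (auto simp: rem_def)
next
  case False
  then have "f a = a" using assms by (simp add: permutes_def)
  then have "rem a f = f" by (auto simp: rem_def fun_eq_iff)
  then show ?thesis using False assms by simp
qed

lemma cycl_cong: "(\<And>x. x \<in> set xs \<Longrightarrow> f x = g x) \<Longrightarrow> cycl f xs = cycl g xs"
  unfolding cycl_def by (metis map_cong)

lemma cycl_rem_other: 
  assumes "cycl f xs" "a \<notin> set xs" shows "cycl (rem a f) xs"
proof -
  have "f x \<noteq> a \<and> x \<noteq> a" if "x \<in> set xs" for x
  proof -
    have "f x \<in> set xs" using assms(1) that by (rule cycl_image)
    then show ?thesis using assms that by metis
  qed
  then show ?thesis using assms(1) cycl_cong[of xs f "rem a f"] by (simp add: rem_def)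
qed

lemma cycl_rem:
  assumes "cycl f (a # xs)" "xs \<noteq> []" shows "cycl (rem a f) xs"
proof -
  have c: "distinct (a # xs)" "f a # map f xs = xs @ [a]" using assms by (auto simp: cycl_Cons_iff)
  obtain y ys where xs: "xs = y # ys" using assms(2) by (cases xs) auto
  have 1: "f a = y" "map f xs = ys @ [a]" using c xs by auto
  have "map (rem a f) xs = map (\<lambda>x. if f x = a then y else f x) xs"
    using c 1 by (auto simp: rem_def)
  also have "\<dots> = map (\<lambda>z. if z = a then y else z) (map f xs)" by simp
  also have "\<dots> = ys @ [y]" unfolding 1 using c xs by (auto intro: map_idI)
  finally show ?thesis using c xs by (simp add: cycl_def)
qed

lemma orbit_rem:
  assumes f: "f permutes D" "finite D" and x: "x \<noteq> a"
  shows "orbit_of (rem a f) x = orbit_of f x - {a}"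
proof -
  obtain xs where xs: "cycl f (x # xs)" using cycl_exists[OF f] by blast
  show ?thesis
  proof (cases "a \<in> set (x # xs)")
    case True
    obtain ys where ys: "cycl f (a # ys)" "set (a # ys) = set (x # xs)"
      using cycl_to_front[OF xs True] by metis
    have "x \<in> set ys" using ys(2) x by auto
    moreover from this have "cycl (rem a f) ys" by (intro cycl_rem ys(1)) auto
    ultimately have "orbit_of (rem a f) x = set ys" by (rule cycl_orbit[rotated])
    moreover have "set ys = set (x # xs) - {a}" using ys by (auto simp: cycl_def)
    ultimately show ?thesis using cycl_orbit[OF xs, of x] by simp
  next
    case False
    then show ?thesis using cycl_orbit[OF xs, of x] cycl_orbit[OF cycl_rem_other[OF xs False], of x] by simp
  qed
qed

text \<open>Since \<open>a\<close> is not fixed, every orbit has a point besides \<open>a\<close>;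
  hence removing \<open>a\<close> from each orbit is a bijection between the orbits before and
  after.\<close>

lemma norb_rem:
  assumes f: "f permutes D" "finite D" and a: "a \<in> D" "f a \<noteq> a"
  shows "norb (rem a f) (D - {a}) = norb f D"
proof -
  have "orbit_of (rem a f) ` (D - {a}) = (\<lambda>X. X - {a}) ` orbit_of f ` D"
  proof -
    have "(\<lambda>X. X - {a}) ` orbit_of f ` D = (\<lambda>X. X - {a}) ` orbit_of f ` (D - {a})"
    proof -
      have "orbit_of f a = orbit_of f (f a)" using orbit_eq_iff[OF f] orbit_step[OF f] orbit_refl[OF f] by metis
      moreover have "f a \<in> D - {a}" using a permutes_in_image[OF f(1)] by auto
      ultimately have "orbit_of f x \<in> orbit_of f ` (D - {a})" if "x \<in> D" for x
        using that by (cases "x = a") auto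
      then have "orbit_of f ` D = orbit_of f ` (D - {a})" by blast
      then show ?thesis by simp
    qed
    also have "\<dots> = orbit_of (rem a f) ` (D - {a})"
      using orbit_rem[OF f, of _ a] by (auto simp: image_image intro!: image_eqI)
    finally show ?thesis by simp
  qed
  moreover have "inj_on (\<lambda>X. X - {a}) (orbit_of f ` D)"
  proof (rule inj_onI)
    fix X Y assume X: "X \<in> orbit_of f ` D" and Y: "Y \<in> orbit_of f ` D" and e: "X - {a} = Y - {a}"
    obtain z where z: "z \<in> X" "z \<noteq> a"
    proof -
      obtain x where "X = orbit_of f x" using X by auto
      then show ?thesis using that[of x] that[of "f a"] a orbit_refl[OF f, of x] orbit_step[OF f, of a] by blast
    qed
    then have "z \<in> Y" using e by auto
    then show "X = Y" using z X Y orbit_eq[OF f] by blast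
  qed
  ultimately show ?thesis unfolding norb_def by (simp add: card_image)
qed

lemma norb_rem_fixed:
  assumes f: "f permutes D" "finite D" and a: "a \<in> D" "f a = a"
  shows "norb (rem a f) (D - {a}) + 1 = norb f D"
proof -
  have e: "rem a f = f" using a by (auto simp: rem_def fun_eq_iff)
  have "norb f D = norb f {a} + norb f (D - {a})"
    using a orbit_fixed[OF f, of a] by (intro norb_split[OF f]) auto
  then show ?thesis unfolding e by (simp add: norb_def)
qed

text \<open>The composite differs from \<open>f\<close> only at two predecessors: the arrow into
  \<open>b\<close> is redirected to \<open>a\<close> and closes \<open>a # q\<close>, the arrow into
  \<open>a\<close> is redirected to \<open>b\<close> and closes \<open>b # w\<close>. With cycles
  kept as lists, cutting is splitting and gluing is concatenation.\<close>

lemma cycl_transpose_split: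
  assumes "cycl f (a # q @ b # w)"
  shows "cycl (transpose a b \<circ> f) (a # q)" "cycl (transpose a b \<circ> f) (b # w)"
proof -
  have d: "distinct (a # q @ b # w)" and "f a # map f (q @ b # w) = (q @ b # w) @ [a]"
    using assms unfolding cycl_Cons_iff by auto
  then have "(f a # map f q) @ (f b # map f w) = (q @ [b]) @ (w @ [a])" by simp
  then have 1: "f a # map f q = q @ [b]" "f b # map f w = w @ [a]"
    by (subst (asm) append_eq_append_conv; simp)+
  have t: "map (transpose a b) q = q" "map (transpose a b) w = w"
    using d by (auto intro!: map_idI simp: transpose_def)
  have "map (transpose a b) (f a # map f q) = q @ [a]" "map (transpose a b) (f b # map f w) = w @ [b]"
    unfolding 1 by (simp_all add: t)
  then show "cycl (transpose a b \<circ> f) (a # q)" "cycl (transpose a b \<circ> f) (b # w)"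
    unfolding cycl_Cons_iff using d by auto
qed

lemma cycl_transpose_merge:
  assumes "cycl f (a # w)" "cycl f (b # q)" "set (a # w) \<inter> set (b # q) = {}"
  shows "cycl (transpose a b \<circ> f) (a # w @ b # q)"
proof -
  have d: "distinct (a # w @ b # q)" using assms by (auto simp: cycl_def)
  have 1: "f a # map f w = w @ [a]" "f b # map f q = q @ [b]" using assms by (auto simp: cycl_Cons_iff)
  have t: "map (transpose a b) q = q" "map (transpose a b) w = w"
    using d by (auto intro!: map_idI simp: transpose_def)
  have "map (transpose a b) ((f a # map f w) @ (f b # map f q)) = w @ b # q @ [a]"
    unfolding 1 by (simp add: t)
  then show ?thesis unfolding cycl_Cons_iff using d by simp
qed

lemma cycl_transpose_other:
  assumes "cycl f xs" "a \<notin> set xs" "b \<notin> set xs" shows "cycl (transpose a b \<circ> f) xs"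
proof -
  have "transpose a b (f x) = f x" if "x \<in> set xs" for x
  proof -
    have "f x \<in> set xs" using assms(1) that by (rule cycl_image)
    then show ?thesis using assms by (auto simp: transpose_def)
  qed
  then show ?thesis using assms(1) cycl_cong[of xs f "transpose a b \<circ> f"] by simp
qed

lemma orbit_transpose_other:
  assumes f: "f permutes D" "finite D" and "a \<notin> orbit_of f x" "b \<notin> orbit_of f x"
  shows "orbit_of (transpose a b \<circ> f) x = orbit_of f x"
proof -
  obtain xs where xs: "cycl f (x # xs)" using cycl_exists[OF f] by blast
  then have "orbit_of f x = set (x # xs)" by (rule cycl_orbit) simp
  then show ?thesis using assms xs cycl_transpose_other[OF xs, of a b] cycl_orbit[of _ "x # xs" x] by auto
qed

lemma two_cycles:
  assumes f: "f permutes D" "finite D" and "b \<notin> orbit_of f a"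
  obtains w q where "cycl f (a # w)" "cycl f (b # q)" "set (a # w) \<inter> set (b # q) = {}"
proof -
  obtain w where w: "cycl f (a # w)" using cycl_exists[OF f] by blast
  obtain q where q: "cycl f (b # q)" using cycl_exists[OF f] by blast
  have "orbit_of f a = set (a # w)" "orbit_of f b = set (b # q)" using cycl_orbit[OF w] cycl_orbit[OF q] by auto
  moreover have "orbit_of f a \<inter> orbit_of f b = {}"
    using assms(3) orbit_eq[OF f] orbit_refl[OF f] by blast
  ultimately show ?thesis using that w q by simp
qed

lemma norb_transpose_merge:
  assumes f: "f permutes D" "finite D" and ab: "a \<in> D" "b \<in> D" "b \<notin> orbit_of f a"
  shows "norb (transpose a b \<circ> f) D + 1 = norb f D"
proof -
  obtain w q where c: "cycl f (a # w)" "cycl f (b # q)" "set (a # w) \<inter> set (b # q) = {}"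
    using two_cycles[OF f ab(3)] .
  let ?g = "transpose a b \<circ> f"
  have g: "?g permutes D" using f ab by (intro permutes_compose permutes_swap_id)
  have m: "cycl ?g (a # w @ b # q)" using cycl_transpose_merge[OF c] .
  let ?S = "set (a # w) \<union> set (b # q)"
  have S: "?S = set (a # w @ b # q)" by auto
  have O: "orbit_of f a = set (a # w)" "orbit_of f b = set (b # q)" using cycl_orbit[OF c(1)] cycl_orbit[OF c(2)] by auto
  have SD: "?S \<subseteq> D" using O orbit_subset[OF f] ab by blast
  have "norb f D = norb f ?S + norb f (D - ?S)"
    using SD cycl_orbit[OF c(1)] cycl_orbit[OF c(2)] by (intro norb_split[OF f]) blast+
  moreover have "norb ?g D = norb ?g ?S + norb ?g (D - ?S)"
    using SD S cycl_orbit[OF m] by (intro norb_split[OF g f(2)]) auto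
  moreover have "norb ?g (D - ?S) = norb f (D - ?S)"
  proof (rule norb_cong)
    fix x assume x: "x \<in> D - ?S"
    then have "a \<notin> orbit_of f x" "b \<notin> orbit_of f x" using O orbit_sym[OF f] by blast+
    then show "orbit_of ?g x = orbit_of f x" by (rule orbit_transpose_other[OF f])
  qed
  ultimately show ?thesis using norb_cycl2[OF c] norb_cycl[OF m] S by simp
qed

lemma norb_transpose_split:
  assumes f: "f permutes D" "finite D" and ab: "a \<in> D" "b \<in> D" "a \<noteq> b" "b \<in> orbit_of f a"
  shows "norb (transpose a b \<circ> f) D = norb f D + 1" "b \<notin> orbit_of (transpose a b \<circ> f) a"
proof -
  let ?g = "transpose a b \<circ> f"
  have g: "?g permutes D" using f ab by (intro permutes_compose permutes_swap_id)
  obtain xs where xs: "cycl f (a # xs)" using cycl_exists[OF f] by blast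
  then have "b \<in> set xs" using ab cycl_orbit[OF xs, of a] by auto
  then obtain q w where "xs = q @ b # w" by (meson split_list)
  then have c: "cycl f (a # q @ b # w)" using xs by simp
  then have d: "distinct (a # q @ b # w)" by (simp add: cycl_def)
  show nb: "b \<notin> orbit_of ?g a" using cycl_orbit[OF cycl_transpose_split(1)[OF c], of a] d by auto
  \<comment> \<open>The transposition is an involution, so the count for a split is the count for a
    merge read backwards.\<close>
  have "transpose a b \<circ> ?g = f" by (auto simp: fun_eq_iff)
  then show "norb ?g D = norb f D + 1"
    using norb_transpose_merge[OF g f(2) ab(1,2) nb] by simp
qed

section \<open>Euler characteristic and labels\<close>

definition locmin :: "(nat \<Rightarrow> nat) \<Rightarrow> (nat \<Rightarrow> nat) \<Rightarrow> (nat \<Rightarrow> nat) \<Rightarrow> nat \<Rightarrow> bool" where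
  "locmin s e l h \<longleftrightarrow> (\<forall>g\<in>orbit_of s h. \<not> l (e g) < l g)"

text \<open>An edge is deleted by turning its two darts into fixed points of \<open>e\<close>, so that no vertex
  disappears.\<close>

definition cut :: "nat \<Rightarrow> (nat \<Rightarrow> nat) \<Rightarrow> nat \<Rightarrow> nat" where
  "cut x e = e(x := x, e x := e x)"

text \<open>A fixed point is one orbit on one dart, a moved pair one orbit on two darts. So the
  number of orbits is the number of darts minus the number of edges that are not deleted.\<close>

lemma norb_invol:
  assumes "finite D" and a: "e permutes D" and inv: "\<And>h. e (e h) = h"
  shows "norb e D + card {h \<in> D. e h \<noteq> h} div 2 = card D" "even (card {h \<in> D. e h \<noteq> h})"
proof -
  have o: "orbit_of e h = {h, e h}" for h
  proof -
    have "(e ^^ k) h \<in> {h, e h}" for k by (induction k) (auto simp: inv)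
    moreover have "h = (e ^^ 0) h" "e h = (e ^^ 1) h" by auto
    ultimately show ?thesis unfolding orbit_of_def by blast
  qed
  \<comment> \<open>Stated for all \<open>e\<close>-closed subsets, because the induction removes
    \<open>h\<close> together with \<open>e h\<close>.\<close>
  have card: "card {h \<in> S. e h \<noteq> h} div 2 + norb e S = card S \<and> even (card {h \<in> S. e h \<noteq> h})"
    if "finite S" "\<And>h. h \<in> S \<Longrightarrow> e h \<in> S" for S
    using that
  proof (induction "card S" arbitrary: S rule: less_induct)
    case less
    show ?case
    proof (cases "S = {}")
      case True then show ?thesis by (simp add: norb_def)
    next
      case False
      then obtain h where h: "h \<in> S" by auto
      let ?T = "S - {h, e h}"
      have c: "card ?T < card S" using h less.prems by (auto intro!: psubset_card_mono)
      have T: "e g \<in> ?T" if "g \<in> ?T" for g using that less.prems(2) inv by (metis Diff_iff insert_iff singletonD)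
      note IH = less.hyps[OF c finite_Diff[OF less.prems(1)] T]
      have S: "S = insert h (insert (e h) ?T)" using h less.prems by auto
      have "orbit_of e ` S = insert {h, e h} (orbit_of e ` ?T)"
        by (subst S) (use o inv in \<open>auto simp: insert_commute\<close>)
      moreover have "{h, e h} \<notin> orbit_of e ` ?T" using o by auto
      ultimately have n: "norb e S = norb e ?T + 1" using less.prems by (simp add: norb_def)
      show ?thesis
      proof (cases "e h = h")
        case True
        then have "{h \<in> S. e h \<noteq> h} = {h \<in> ?T. e h \<noteq> h}" by auto
        moreover have "card S = card ?T + 1" using True h less.prems by (simp add: card_Diff_singleton) (metis card_gt_0_iff Suc_pred empty_iff)
        ultimately show ?thesis using IH n by simp
      next
        case False
        then have "{h \<in> S. e h \<noteq> h} = insert h (insert (e h) {h \<in> ?T. e h \<noteq> h})" using h less.prems inv by auto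
        then have "card {h \<in> S. e h \<noteq> h} = card {h \<in> ?T. e h \<noteq> h} + 2" using False less.prems by simp
        moreover have "card S = card ?T + 2" using False h less.prems by (subst S) simp
        ultimately show ?thesis using IH n by simp
      qed
    qed
  qed
  show "norb e D + card {h \<in> D. e h \<noteq> h} div 2 = card D" "even (card {h \<in> D. e h \<noteq> h})"
    using card[OF assms(1)] a by (auto simp: permutes_in_image)
qed

text \<open>In contrast to a map, \<open>e\<close> may fix darts: these are the halves of deleted
  edges, and they keep their vertices alive.\<close>

locale rotsys =
  fixes D :: "nat set" and s e :: "nat \<Rightarrow> nat"
  assumes fin: "finite D" and s: "s permutes D" and e: "e permutes D" and inv: "e (e h) = h"
begin

lemma phi: "e \<circ> s permutes D" using s e by (rule permutes_compose)

lemma cut_apply: "cut x e g = (if g = x \<or> g = e x then g else e g)"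
  by (simp add: cut_def)

lemma locmin_cut: "locmin s (cut x e) l h \<longleftrightarrow> (\<forall>g\<in>orbit_of s h. g \<noteq> x \<and> g \<noteq> e x \<longrightarrow> \<not> l (e g) < l g)"
  unfolding locmin_def cut_apply by auto

lemma locmin_uncut:
  assumes "locmin s (cut x e) l h" "x \<in> orbit_of s h \<Longrightarrow> \<not> l (e x) < l x" "\<not> l (e (e x)) < l (e x)"
  shows "locmin s e l h"
  unfolding locmin_def
proof
  fix g assume "g \<in> orbit_of s h"
  then show "\<not> l (e g) < l g"
    using assms unfolding locmin_cut by (cases "g = x"; cases "g = e x") auto
qed

lemma cut_eq: "x \<in> D \<Longrightarrow> cut x e = transpose x (e x) \<circ> e"
  using inv by (auto simp: cut_def fun_eq_iff transpose_def) (metis inv)+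

lemma cut_rotsys: assumes "x \<in> D" shows "rotsys D s (cut x e)"
proof
  have "e x \<in> D" using assms e by (simp add: permutes_in_image)
  then show "cut x e permutes D" unfolding cut_eq[OF assms] using assms e by (intro permutes_compose permutes_swap_id)
  show "cut x e (cut x e h) = h" for h using inv by (auto simp: cut_def) (metis inv)+
qed (use fin s in auto)

lemma cut_phi: "x \<in> D \<Longrightarrow> cut x e \<circ> s = transpose x (e x) \<circ> (e \<circ> s)"
  by (simp add: cut_eq o_assoc)

lemma norb_cut: assumes "x \<in> D" "e x \<noteq> x" shows "norb (cut x e) D = norb e D + 1"
proof -
  have "e x \<in> orbit_of e x" using orbit_step[OF e fin] orbit_refl[OF e fin] by blast
  then show ?thesis unfolding cut_eq[OF assms(1)]
    using assms e by (intro norb_transpose_split[OF e fin]) (auto simp: permutes_in_image)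
qed

text \<open>\<open>cut\<close> multiplies the face permutation by the transposition of the two
  darts: an edge with the same face on both sides splits that face, an edge between two faces merges
  them.\<close>

lemma norb_phi_cut:
  assumes "x \<in> D" "e x \<noteq> x"
  shows "e x \<in> orbit_of (e \<circ> s) x \<Longrightarrow> norb (cut x e \<circ> s) D = norb (e \<circ> s) D + 1"
    "e x \<notin> orbit_of (e \<circ> s) x \<Longrightarrow> norb (cut x e \<circ> s) D + 1 = norb (e \<circ> s) D"
  using norb_transpose_split(1)[OF phi fin assms(1) _ assms(2)[symmetric]]
    norb_transpose_merge[OF phi fin assms(1)] assms e
  unfolding cut_phi[OF assms(1)] by (simp_all add: permutes_in_image)

lemma nonfixed_cut:
  assumes "x \<in> D" "e x \<noteq> x"
  shows "card {h \<in> D. cut x e h \<noteq> h} < card {h \<in> D. e h \<noteq> h}"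
  using assms fin by (intro psubset_card_mono) (auto simp: cut_def)

text \<open>Every other dart at the vertex of \<open>x\<close> is fixed by \<open>e\<close>, so the
  face permutation merely turns around the vertex until it would return to \<open>x\<close>, and
  there it leaves through \<open>e x\<close>.\<close>

lemma leaf_same_face:
  assumes x: "x \<in> D" and only: "\<And>g. g \<in> orbit_of s x \<Longrightarrow> g \<noteq> x \<Longrightarrow> e g = g"
  shows "e x \<in> orbit_of (e \<circ> s) x"
proof -
  obtain zs where zs: "cycl s (x # zs)" using cycl_exists[OF s fin] by blast
  have set: "orbit_of s x = set (x # zs)" using cycl_orbit[OF zs] by simp
  have iter: "(s ^^ k) x = (x # zs) ! (k mod length (x # zs))" for k
    using cycl_funpow[OF zs, of k] by simp
  have d: "distinct (x # zs)" using zs by (simp add: cycl_def)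
  have z: "e (zs ! k) = zs ! k" if "k < length zs" for k
  proof -
    have "zs ! k \<in> set zs" using that by simp
    then show ?thesis using only[of "zs ! k"] set d by auto
  qed
  have *: "((e \<circ> s) ^^ k) x = (s ^^ k) x" if "k \<le> length zs" for k
    using that
  proof (induction k)
    case (Suc k)
    then have "((e \<circ> s) ^^ Suc k) x = e ((s ^^ Suc k) x)" by (simp del: o_apply) simp
    also have "(s ^^ Suc k) x = zs ! k" using iter[of "Suc k"] Suc.prems by simp
    also have "e (zs ! k) = zs ! k" using z Suc.prems by simp
    finally show ?case using iter[of "Suc k"] Suc.prems by simp
  qed simp
  have "((e \<circ> s) ^^ Suc (length zs)) x = e ((s ^^ Suc (length zs)) x)" using *[of "length zs"] by (simp del: o_apply) simp
  also have "(s ^^ Suc (length zs)) x = x" using iter[of "Suc (length zs)"] by simp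
  finally show ?thesis unfolding orbit_of_def by (metis (mono_tags, lifting) mem_Collect_eq)
qed

end

text \<open>The number of vertices that are local minima of \<open>l\<close> stands in for the number of components.\<close>

lemma euler_le:
  fixes l :: "nat \<Rightarrow> nat"
  assumes "rotsys D s e" and lab: "l \<circ> s = l"
  shows "norb s D + norb e D + norb (e \<circ> s) D \<le> card D + 2 * card (orbit_of s ` {h \<in> D. locmin s e l h})"
  using assms(1)
proof (induction "card {h \<in> D. e h \<noteq> h}" arbitrary: e rule: less_induct)
  case less
  interpret rotsys D s e by fact
  have labo: "l g = l h" if "g \<in> orbit_of s h" for g h
    using that by (rule orbit_induct[OF s fin]) (use lab in \<open>auto simp: fun_eq_iff\<close>)
  let ?K = "\<lambda>e. card (orbit_of s ` {h \<in> D. locmin s e l h})"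
  \<comment> \<open>A cut adds an orbit of \<open>e\<close> and changes the number of faces by one,
    so it never lowers the left-hand side; only the local minima have to be controlled.\<close>
  have same: ?case if x: "x \<in> D" "e x \<noteq> x" and lm: "\<And>h. h \<in> D \<Longrightarrow> locmin s (cut x e) l h \<Longrightarrow> locmin s e l h" for x
  proof -
    have "{h \<in> D. locmin s (cut x e) l h} \<subseteq> {h \<in> D. locmin s e l h}" using lm by auto
    then have "?K (cut x e) \<le> ?K e" using fin by (intro card_mono) auto
    then show ?thesis
      using less.hyps[OF nonfixed_cut[OF x] cut_rotsys[OF x(1)]] norb_cut[OF x] norb_phi_cut[OF x] by linarith
  qed
  show ?case
  proof (cases "\<exists>x\<in>D. e x \<noteq> x")
    \<comment> \<open>Without edges every vertex is a local minimum and also a face, and equality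
      holds.\<close>
    case False
    then have id: "e = id" using e by (auto simp: fun_eq_iff permutes_def)
    have "norb id D = card D" using orbit_fixed[of id D] permutes_id fin by (auto simp: norb_def card_image inj_on_def)
    moreover have "{h \<in> D. locmin s id l h} = D" by (auto simp: locmin_def)
    ultimately show ?thesis unfolding id by (simp add: norb_def)
  next
    case True
    show ?thesis
    proof (cases "\<exists>x\<in>D. e x \<noteq> x \<and> l (e x) = l x")
      case True
      then obtain x where x: "x \<in> D" "e x \<noteq> x" "l (e x) = l x" by auto
      have "\<not> l (e x) < l x" "\<not> l (e (e x)) < l (e x)" using x inv by auto
      then have "locmin s (cut x e) l h \<Longrightarrow> locmin s e l h" for h
        using locmin_uncut by blast
      then show ?thesis by (rule same[OF x(1,2)])
    next
      case False
      \<comment> \<open>No edge is level now, so at the maximal label among undeleted darts every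
        edge descends; the edge to be cut is taken from there.\<close>
      let ?N = "{x \<in> D. e x \<noteq> x}"
      have "finite ?N" "?N \<noteq> {}" using fin True by auto
      then have "Max (l ` ?N) \<in> l ` ?N" by (intro Max_in) auto
      then obtain x where x: "x \<in> ?N" "Max (l ` ?N) = l x" by blast
      have mx: "l y \<le> l x" if "y \<in> ?N" for y
        using that \<open>finite ?N\<close> unfolding x(2)[symmetric] by (intro Max_ge) auto
      have down: "l (e y) < l y" if "y \<in> ?N" "l y = l x" for y
      proof -
        have "e y \<in> ?N" using that(1) inv e by (auto simp: permutes_in_image)
        then show ?thesis using mx[of "e y"] that False by (metis (mono_tags, lifting) mem_Collect_eq nless_le)
      qed
      have low: "\<not> l (e (e x)) < l (e x)" using down[OF x(1) refl] inv by simp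
      show ?thesis
      proof (cases "\<exists>y\<in>orbit_of s x. y \<noteq> x \<and> e y \<noteq> y")
        \<comment> \<open>A second edge \<open>y\<close> at the same vertex descends as well, so the
          cut does not turn this vertex into a local minimum.\<close>
        case True
        then obtain y where y: "y \<in> orbit_of s x" "y \<noteq> x" "e y \<noteq> y" by auto
        then have "y \<in> ?N" using orbit_subset[OF s fin] x by auto
        then have ly: "l (e y) < l y" using down labo[OF y(1)] by auto
        then have "y \<noteq> e x" using low by auto
        show ?thesis
        proof (rule same)
          fix h assume h: "h \<in> D" "locmin s (cut x e) l h"
          have "x \<notin> orbit_of s h"
          proof
            assume "x \<in> orbit_of s h"
            then have "y \<in> orbit_of s h" using y orbit_eq[OF s fin] by metis
            then show False using h(2) ly y \<open>y \<noteq> e x\<close> unfolding locmin_cut by blast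
          qed
          then show "locmin s e l h" using locmin_uncut[OF h(2) _ low] by blast
        qed (use x in auto)
      next
        \<comment> \<open>The cut isolates the top vertex, which may become a new local minimum and
          costs 2 on the right; but both an orbit of \<open>e\<close> and a face are gained on the
          left.\<close>
        case False
        have x': "x \<in> D" "e x \<noteq> x" using x by auto
        have sf: "e x \<in> orbit_of (e \<circ> s) x" using False by (intro leaf_same_face x') auto
        have "orbit_of s ` {h \<in> D. locmin s (cut x e) l h} \<subseteq> insert (orbit_of s x) (orbit_of s ` {h \<in> D. locmin s e l h})"
        proof
          fix Y assume "Y \<in> orbit_of s ` {h \<in> D. locmin s (cut x e) l h}"
          then obtain h where h: "Y = orbit_of s h" "h \<in> D" "locmin s (cut x e) l h" by auto
          show "Y \<in> insert (orbit_of s x) (orbit_of s ` {h \<in> D. locmin s e l h})"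
          proof (cases "x \<in> orbit_of s h")
            case True
            then have "Y = orbit_of s x" using h(1) orbit_eq[OF s fin True] by simp
            then show ?thesis by simp
          next
            case False
            then have "locmin s e l h" using locmin_uncut[OF h(3) _ low] by blast
            then show ?thesis using h by auto
          qed
        qed
        then have "?K (cut x e) \<le> card (insert (orbit_of s x) (orbit_of s ` {h \<in> D. locmin s e l h}))"
          using fin by (intro card_mono) auto
        also have "\<dots> \<le> ?K e + 1" using fin by (simp add: card_insert_if)
        finally show ?thesis
          using less.hyps[OF nonfixed_cut[OF x'] cut_rotsys[OF x'(1)]] norb_cut[OF x'] norb_phi_cut(1)[OF x' sf] by linarith
      qed
    qed
  qed
qed

text \<open>With the same face on both sides, cutting the edge would raise the Euler count to
  \<open>card D + 4\<close>, while \<open>euler_le\<close> with at most one local minimum allows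
  only \<open>card D + 2\<close>. The hypothesis \<open>uni\<close> takes the place of saying that
  the edge is not a bridge.\<close>

lemma planar_distinct_faces:
  fixes l :: "nat \<Rightarrow> nat"
  assumes "rotsys D s e" and lab: "l \<circ> s = l"
    and planar: "norb s D + norb e D + norb (e \<circ> s) D = card D + 2"
    and x: "x \<in> D" "e x \<noteq> x"
    and uni: "\<And>h h'. h \<in> D \<Longrightarrow> h' \<in> D \<Longrightarrow> locmin s (cut x e) l h \<Longrightarrow> locmin s (cut x e) l h' \<Longrightarrow> h' \<in> orbit_of s h"
  shows "e x \<notin> orbit_of (e \<circ> s) x"
proof
  assume sf: "e x \<in> orbit_of (e \<circ> s) x"
  interpret rotsys D s e by fact
  let ?S = "{h \<in> D. locmin s (cut x e) l h}"
  have "card (orbit_of s ` ?S) \<le> 1"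
  proof (cases "?S = {}")
    case False
    then obtain h where h: "h \<in> ?S" by blast
    then have "orbit_of s ` ?S \<subseteq> {orbit_of s h}" using uni orbit_eq[OF s fin] by blast
    then show ?thesis using card_mono[of "{orbit_of s h}"] by simp
  next
    case True
    then show ?thesis by (simp only: image_empty card.empty)
  qed
  then show False
    using euler_le[OF cut_rotsys[OF x(1)] lab] norb_cut[OF x] norb_phi_cut(1)[OF x sf] planar by linarith
qed

text \<open>The edges on which the cocycle is nonzero can be deleted one by one; by planarity each
  deletion merges two distinct faces, so the face sums stay zero.\<close>

lemma cocycle_trivial:
  fixes kap :: "nat \<Rightarrow> int" and l :: "nat \<Rightarrow> nat"
  assumes "rotsys D s e" and lab: "l \<circ> s = l"
    and planar: "norb s D + norb e D + norb (e \<circ> s) D = card D + 2"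
    and anti: "\<And>h. h \<in> D \<Longrightarrow> kap (e h) = - kap h"
    and uni: "\<And>h h'. h \<in> D \<Longrightarrow> h' \<in> D \<Longrightarrow> 
       (\<forall>g\<in>orbit_of s h. \<not> (p dvd kap g \<and> l (e g) < l g)) \<Longrightarrow>
       (\<forall>g\<in>orbit_of s h'. \<not> (p dvd kap g \<and> l (e g) < l g)) \<Longrightarrow> h' \<in> orbit_of s h"
    and sums: "\<And>h. h \<in> D \<Longrightarrow> p dvd (\<Sum>g\<in>orbit_of (e \<circ> s) h. kap g)"
    and fixed: "\<And>h. h \<in> D \<Longrightarrow> e h = h \<Longrightarrow> kap h = 0"
    and x: "x \<in> D"
  shows "p dvd kap x"
  using assms(1) planar anti uni sums fixed x
proof (induction "card {h \<in> D. \<not> p dvd kap h}" arbitrary: e kap x rule: less_induct)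
  case less
  interpret rotsys D s e by fact
  show ?case
  proof (rule ccontr)
    assume bad: "\<not> p dvd kap x"
    have x: "x \<in> D" "e x \<noteq> x" using less.prems(6,7) bad by auto
    have y: "e x \<in> D" using x e by (simp add: permutes_in_image)
    have bad': "\<not> p dvd kap (e x)" using bad less.prems(3) x by simp
    \<comment> \<open>The values on the two halves are reset to 0, as the hypothesis
      \<open>fixed\<close> demands of fixed darts.\<close>
    let ?e = "cut x e" and ?kap = "kap(x := 0, e x := 0)"
    interpret c: rotsys D s ?e by (rule cut_rotsys[OF x(1)])
    \<comment> \<open>The deleted edge was not divisible and hence never counted as a descent in
      \<open>uni\<close>. So a local minimum after the cut is still a vertex of the kind that
      \<open>uni\<close> makes unique.\<close>
    have lm: "\<forall>g\<in>orbit_of s h. \<not> (p dvd kap g \<and> l (e g) < l g)" if "locmin s ?e l h" for h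
    proof
      fix g assume "g \<in> orbit_of s h"
      then show "\<not> (p dvd kap g \<and> l (e g) < l g)"
        using that bad bad' unfolding locmin_cut by (cases "g = x"; cases "g = e x") auto
    qed
    have df: "e x \<notin> orbit_of (e \<circ> s) x"
      using less.prems(4) lm by (intro planar_distinct_faces[OF less.prems(1) lab less.prems(2) x]) auto
    have others: "p dvd ?kap h" if h: "h \<in> D" for h
    proof (rule less.hyps[OF _ c.rotsys_axioms])
      show "card {h \<in> D. \<not> p dvd ?kap h} < card {h \<in> D. \<not> p dvd kap h}"
        using bad x fin by (intro psubset_card_mono) auto
      show "norb s D + norb ?e D + norb (?e \<circ> s) D = card D + 2"
        using norb_cut[OF x] norb_phi_cut(2)[OF x df] less.prems(2) by simp
      show "?kap (?e h) = - ?kap h" if "h \<in> D" for h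
      proof (cases "h = x \<or> h = e x")
        case True
        then show ?thesis by (auto simp: cut_apply)
      next
        case False
        then have "e h \<noteq> x" "e h \<noteq> e x" using inv by metis+
        then show ?thesis using False less.prems(3)[OF that] by (simp add: cut_apply)
      qed
      show "h' \<in> orbit_of s h" if "h \<in> D" "h' \<in> D" 
       "\<forall>g\<in>orbit_of s h. \<not> (p dvd ?kap g \<and> l (?e g) < l g)"
       "\<forall>g\<in>orbit_of s h'. \<not> (p dvd ?kap g \<and> l (?e g) < l g)" for h h'
      proof (rule less.prems(4)[OF that(1,2)])
        have "\<not> (p dvd kap g \<and> l (e g) < l g)" if "\<not> (p dvd ?kap g \<and> l (?e g) < l g)" for g
          using that bad bad' by (cases "g = x"; cases "g = e x") (auto simp: cut_apply)
        then show "\<forall>g\<in>orbit_of s h. \<not> (p dvd kap g \<and> l (e g) < l g)"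
          "\<forall>g\<in>orbit_of s h'. \<not> (p dvd kap g \<and> l (e g) < l g)" using that by blast+
      qed
      show "?kap h = 0" if "h \<in> D" "?e h = h" for h
        using that less.prems(6)[of h] by (cases "h = x \<or> h = e x") (auto simp: cut_apply)
      show "p dvd (\<Sum>g\<in>orbit_of (?e \<circ> s) h. ?kap g)" if h: "h \<in> D" for h
      proof -
        obtain w q where cy: "cycl (e \<circ> s) (x # w)" "cycl (e \<circ> s) (e x # q)" "set (x # w) \<inter> set (e x # q) = {}"
          using two_cycles[OF phi fin df] .
        have m: "cycl (?e \<circ> s) (x # w @ e x # q)" unfolding cut_phi[OF x(1)] by (rule cycl_transpose_merge[OF cy])
        have O: "orbit_of (e \<circ> s) x = set (x # w)" "orbit_of (e \<circ> s) (e x) = set (e x # q)"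
          using cycl_orbit[OF cy(1)] cycl_orbit[OF cy(2)] by auto
        show ?thesis
        proof (cases "h \<in> set (x # w) \<union> set (e x # q)")
          \<comment> \<open>The merged face loses the values of \<open>x\<close> and
            \<open>e x\<close>, which cancel by antisymmetry; its sum is therefore the sum of the
            two old face sums.\<close>
          case True
          then have "orbit_of (?e \<circ> s) h = set (x # w) \<union> set (e x # q)" using cycl_orbit[OF m, of h] by auto
          moreover have "(\<Sum>g\<in>set (x # w) \<union> set (e x # q). ?kap g) = (\<Sum>g\<in>set (x # w). ?kap g) + (\<Sum>g\<in>set (e x # q). ?kap g)"
            using cy(3) by (intro sum.union_disjoint) auto
          moreover have "(\<Sum>g\<in>set (x # w). ?kap g) = (\<Sum>g\<in>set (x # w). kap g) - kap x"
          proof -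
            have n: "x \<notin> set w" "e x \<notin> set w" using cy by (auto simp: cycl_def)
            then have "(\<Sum>g\<in>set w. ?kap g) = (\<Sum>g\<in>set w. kap g)" by (intro sum.cong) auto
            then show ?thesis using n by (simp only: list.set sum.insert finite_set not_False_eq_True) simp
          qed
          moreover have "(\<Sum>g\<in>set (e x # q). ?kap g) = (\<Sum>g\<in>set (e x # q). kap g) - kap (e x)"
          proof -
            have n: "x \<notin> set q" "e x \<notin> set q" using cy by (auto simp: cycl_def)
            then have "(\<Sum>g\<in>set q. ?kap g) = (\<Sum>g\<in>set q. kap g)" by (intro sum.cong) auto
            then show ?thesis using n by (simp only: list.set sum.insert finite_set not_False_eq_True) simp
          qed
          moreover have "kap (e x) = - kap x" using less.prems(3) x by blast
          ultimately have "(\<Sum>g\<in>orbit_of (?e \<circ> s) h. ?kap g) = (\<Sum>g\<in>set (x # w). kap g) + (\<Sum>g\<in>set (e x # q). kap g)"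
            by simp
          then show ?thesis using less.prems(5)[OF x(1)] less.prems(5)[OF y] O by simp
        next
          case False
          then have n: "x \<notin> orbit_of (e \<circ> s) h" "e x \<notin> orbit_of (e \<circ> s) h" 
            using O orbit_sym[OF phi fin] by blast+
          then have "orbit_of (?e \<circ> s) h = orbit_of (e \<circ> s) h" 
            unfolding cut_phi[OF x(1)] by (rule orbit_transpose_other[OF phi fin])
          moreover have "(\<Sum>g\<in>orbit_of (e \<circ> s) h. ?kap g) = (\<Sum>g\<in>orbit_of (e \<circ> s) h. kap g)"
            using n by (intro sum.cong) auto
          ultimately show ?thesis using less.prems(5)[OF h] by simp
        qed
      qed
    qed (use h in auto)
    \<comment> \<open>In its face \<open>x\<close> is the only possible exception to divisibility,
      since \<open>e x\<close> lies in another face; so the divisible face sum settles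
      \<open>kap x\<close> too.\<close>
    let ?O = "orbit_of (e \<circ> s) x"
    have "finite ?O" "x \<in> ?O" "?O \<subseteq> D" using orbit_finite[OF phi fin x(1)] orbit_refl[OF phi fin] orbit_subset[OF phi fin x(1)] by auto
    then have "(\<Sum>g\<in>?O. kap g) = kap x + (\<Sum>g\<in>?O - {x}. kap g)" by (rule_tac sum.remove) auto
    moreover have "p dvd (\<Sum>g\<in>?O - {x}. kap g)"
    proof (rule dvd_sum)
      fix g assume g: "g \<in> ?O - {x}"
      then have "g \<noteq> e x" "g \<in> D" using df \<open>?O \<subseteq> D\<close> by auto
      then show "p dvd kap g" using others[of g] g by simp
    qed
    ultimately show False using less.prems(5)[OF x(1)] bad by (simp add: dvd_add_left_iff)
  qed
qed

section \<open>Deleting and inserting an edge\<close>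

text \<open>Colours and labels follow \<open>oedges\<close>: a white dart \<open>h\<close> stands for the edge from the vertex of
  \<open>e h\<close> to the vertex of \<open>h\<close>, and \<open>l h\<close> is the label of the vertex of \<open>h\<close>. So the black darts at a
  vertex are its outgoing edges. The root face need not be monochromatic, since peeling opens
  black faces.\<close>

definition sink :: "(nat \<Rightarrow> nat) \<Rightarrow> (nat \<Rightarrow> nat) \<Rightarrow> (nat \<Rightarrow> bool) \<Rightarrow> (nat \<Rightarrow> nat) \<Rightarrow> nat \<Rightarrow> bool" where
  "sink s e c l h \<longleftrightarrow> (\<forall>g\<in>orbit_of s h. c g \<or> l (e g) + 1 \<noteq> l g)"

text \<open>Connectedness is encoded by the unique sink in \<open>uniq\<close>, the divisibility of
  white degrees by the label steps. \<open>dflt\<close> fixes colours and labels off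
  \<open>D\<close>, so that tuples can be counted. By \<open>rootstep\<close>, the black darts of
  the root face are falls traversed backwards. \<open>euler\<close> is Euler's formula doubled, with
  \<open>card D\<close> twice the number of edges.\<close>

locale lmap = rotsys D s e for D s e +
  fixes p :: nat and c :: "nat \<Rightarrow> bool" and l :: "nat \<Rightarrow> nat" and r :: nat
  assumes fpf: "h \<in> D \<Longrightarrow> e h \<noteq> h"
    and col_e: "h \<in> D \<Longrightarrow> c (e h) = (\<not> c h)"
    and dflt: "h \<notin> D \<Longrightarrow> \<not> c h \<and> l h = 0"
    and lab_s: "l \<circ> s = l"
    and step: "h \<in> D \<Longrightarrow> c h \<Longrightarrow> l (e h) = l h + 1 \<or> l h = l (e h) + (p - 1)"
    and root: "r \<in> D"
    and uniq: "h \<in> D \<Longrightarrow> h' \<in> D \<Longrightarrow> sink s e c l h \<Longrightarrow> sink s e c l h' \<Longrightarrow> h' \<in> orbit_of s h"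
    and mono: "h \<in> D \<Longrightarrow> h \<notin> orbit_of (e \<circ> s) r \<Longrightarrow> c (e (s h)) = c h"
    and blk: "h \<in> D \<Longrightarrow> h \<notin> orbit_of (e \<circ> s) r \<Longrightarrow> \<not> c h \<Longrightarrow> card (orbit_of (e \<circ> s) h) = p"
    and rootstep: "h \<in> orbit_of (e \<circ> s) r \<Longrightarrow> \<not> c h \<Longrightarrow> l h = l (e h) + 1"
    and euler: "2 * (norb s D + norb (e \<circ> s) D) = card D + 4"

text \<open>The step of the boundary word at dart \<open>h\<close> leads to the label of \<open>h\<close>; it is preceded by the label
  of \<open>e h\<close>.\<close>

definition bword :: "(nat \<Rightarrow> nat) \<Rightarrow> (nat \<Rightarrow> nat) \<Rightarrow> (nat \<Rightarrow> bool) \<Rightarrow> (nat \<Rightarrow> nat) \<Rightarrow> nat \<Rightarrow> (bool \<times> nat) list \<Rightarrow> bool" where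
  "bword s e c l r B \<longleftrightarrow> (\<exists>xs. cycl (e \<circ> s) (r # xs) \<and> map (\<lambda>h. (c h, l h)) (r # xs) = B)"

definition wfaces :: "nat set \<Rightarrow> (nat \<Rightarrow> nat) \<Rightarrow> (nat \<Rightarrow> nat) \<Rightarrow> (nat \<Rightarrow> bool) \<Rightarrow> nat set set" where
  "wfaces D s e c = {orbit_of (e \<circ> s) h | h. h \<in> D \<and> c h}"

definition inner :: "nat \<Rightarrow> nat set \<Rightarrow> (nat \<Rightarrow> nat) \<Rightarrow> (nat \<Rightarrow> nat) \<Rightarrow> (nat \<Rightarrow> bool) \<Rightarrow> nat \<Rightarrow> nat multiset" where
  "inner p D s e c r = image_mset (\<lambda>F. card F div p) (mset_set (wfaces D s e c - {orbit_of (e \<circ> s) r}))"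

section \<open>Deleting and inserting an edge in a rotation system\<close>

lemma cycl_maps:
  assumes "cycl f (q @ w)" "q \<noteq> []" "w \<noteq> []"
  shows "map f q = tl q @ [hd w]" "map f w = tl w @ [hd q]"
proof -
  have "map f q @ map f w = (tl q @ [hd w]) @ (tl w @ [hd q])"
    using assms by (cases q; cases w) (auto simp: cycl_def)
  then show "map f q = tl q @ [hd w]" "map f w = tl w @ [hd q]"
    using assms(2,3) by (subst (asm) append_eq_append_conv; simp)+
qed

text \<open>Bypassing \<open>a\<close> alone also detaches \<open>b\<close>: its image
  \<open>a\<close> is replaced by \<open>e a\<close>, which is \<open>b\<close> itself.\<close>

lemma (in rotsys) rem_e:
  assumes "e a = b" shows "rem a e x = (if x = a \<or> x = b then x else e x)"
proof -
  have "x = b" if "e x = a" using inv[of x] assms unfolding that by simp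
  moreover have "e b = a" using inv[of a] unfolding assms .
  ultimately have "e x = a \<longleftrightarrow> x = b" by blast
  then show ?thesis using assms unfolding rem_def by presburger
qed

locale edge = rotsys D s e for D s e +
  fixes a b :: nat
  assumes aD: "a \<in> D" and bD: "b \<in> D" and ab: "e a = b" "a \<noteq> b"
begin

abbreviation "s' \<equiv> rem b (rem a s)"
abbreviation "e' \<equiv> rem a e"
abbreviation "D' \<equiv> D - {a, b}"

lemma ba: "e b = a" using inv[of a] ab by simp

lemma e_iff: "e x = a \<longleftrightarrow> x = b" "e x = b \<longleftrightarrow> x = a"
proof -
  have "x = b" if "e x = a" using inv[of x] ab unfolding that by simp
  moreover have "x = a" if "e x = b" using inv[of x] ba unfolding that by simp
  ultimately show "e x = a \<longleftrightarrow> x = b" "e x = b \<longleftrightarrow> x = a" using ab ba by blast+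
qed

lemma D'_eq: "D - {a} - {b} = D'" by auto

lemma e'_eq: "e' x = (if x = a \<or> x = b then x else e x)"
  by (rule rem_e[OF ab(1)])

lemma e_D': "h \<in> D' \<Longrightarrow> e h \<in> D'"
proof -
  assume "h \<in> D'"
  then have "e h \<in> D" "e h \<noteq> a" "e h \<noteq> b"
    by (auto simp: permutes_in_image[OF e] e_iff)
  then show ?thesis by simp
qed

lemma s'_permutes: "s' permutes D'" 
  using rem_permutes[OF rem_permutes[OF s, of a], of b] unfolding D'_eq .

lemma e'_permutes: "e' permutes D'"
proof -
  have "rem b e' permutes D'" using rem_permutes[OF rem_permutes[OF e, of a], of b] unfolding D'_eq .
  moreover have "rem b e' = e'"
  proof
    fix x 
    have "e x = b \<longleftrightarrow> x = a" using e_iff by blast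
    then show "rem b e' x = e' x" using ab ba by (auto simp: rem_def[of b] e'_eq)
  qed
  ultimately show ?thesis by simp
qed

lemma small: "rotsys D' s' e'"
proof
  show "e' (e' h) = h" for h unfolding e'_eq using inv[of h] by (simp add: e_iff)
qed (use fin s'_permutes e'_permutes in auto)

lemma orb_s': "x \<in> D' \<Longrightarrow> orbit_of s' x = orbit_of s x - {a, b}"
  using orbit_rem[OF rem_permutes[OF s], of a x b] orbit_rem[OF s fin, of x a] fin by auto

lemma card_D: "card D = card D' + 2"
proof -
  have c: "card {a, b} = 2" using ab(2) by simp
  have s: "{a, b} \<subseteq> D" using aD bD by blast
  have "card D' = card D - 2" using card_Diff_subset[OF finite_subset[OF s fin] s] unfolding c .
  moreover have "2 \<le> card D" using card_mono[OF fin s] unfolding c .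
  ultimately show ?thesis by linarith
qed

end

text \<open>The edge separates the faces \<open>a # w\<close> and \<open>b # q\<close>, and its
  deletion joins them to \<open>q @ w\<close>. By \<open>wne\<close> and \<open>qne\<close> neither
  face has degree one, so both ends of the edge keep a dart and no vertex is lost.\<close>

locale edge_cut = edge D s e a b for D s e a b +
  fixes w q :: "nat list"
  assumes cyc_a: "cycl (e \<circ> s) (a # w)" and cyc_b: "cycl (e \<circ> s) (b # q)"
    and disj: "set (a # w) \<inter> set (b # q) = {}" and wne: "w \<noteq> []" and qne: "q \<noteq> []"
begin

lemma orb_a: "orbit_of (e \<circ> s) a = set (a # w)" and orb_b: "orbit_of (e \<circ> s) b = set (b # q)"
  using cycl_orbit[OF cyc_a] cycl_orbit[OF cyc_b] by auto

lemma sub: "set (a # w) \<subseteq> D" "set (b # q) \<subseteq> D"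
  using orbit_subset[OF phi fin] aD bD orb_a orb_b by blast+

lemma dist: "distinct (a # w)" "distinct (b # q)"
  using cyc_a cyc_b by (auto simp: cycl_def)

lemma w_D': "set w \<subseteq> D'" and q_D': "set q \<subseteq> D'"
  using sub disj dist by auto

lemma phi_a: "e (s a) = hd w" and phi_b: "e (s b) = hd q"
proof -
  have "hd ((e \<circ> s) a # map (e \<circ> s) w) = hd (w @ [a])" using cyc_a unfolding cycl_Cons_iff by (simp only:)
  then show "e (s a) = hd w" using wne by simp
  have "hd ((e \<circ> s) b # map (e \<circ> s) q) = hd (q @ [b])" using cyc_b unfolding cycl_Cons_iff by (simp only:)
  then show "e (s b) = hd q" using qne by simp
qed

lemma s_a: "s a = e (hd w)" and s_b: "s b = e (hd q)"
  using inv[of "s a"] inv[of "s b"] unfolding phi_a phi_b by simp_all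

lemma sa_D': "s a \<in> D'" and sb_D': "s b \<in> D'"
proof -
  have "hd w \<in> D'" "hd q \<in> D'" using w_D' q_D' hd_in_set[OF wne] hd_in_set[OF qne] by blast+
  then show "s a \<in> D'" "s b \<in> D'" using e_D' unfolding s_a s_b by blast+
qed

lemma s_last: "s (last q) = a" "s (last w) = b"
proof -
  have "last (map (e \<circ> s) (b # q)) = last (q @ [b])" "last (map (e \<circ> s) (a # w)) = last (w @ [a])"
    using cyc_a cyc_b by (simp_all only: cycl_def rotate1.simps)
  then have "e (s (last q)) = b" "e (s (last w)) = a" using wne qne by (simp_all add: last_map)
  then show "s (last q) = a" "s (last w) = b"
    using inv[of "s (last q)"] inv[of "s (last w)"] ab ba by simp_all
qed

lemma s'_apply: "x \<in> D' \<Longrightarrow> s' x = (if s x = a then s a else if s x = b then s b else s x)"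
  using sa_D' sb_D' ab(2) unfolding rem_def by auto

text \<open>Deletion factors through \<open>cut\<close>: the transposition merges the two faces, and
  afterwards \<open>a\<close> and \<open>b\<close> are merely bypassed. Orbits and their number then
  follow from the lemmas on \<open>transpose\<close> and \<open>rem\<close>.\<close>

lemma phi'_eq: "e' \<circ> s' = rem b (rem a (transpose a b \<circ> (e \<circ> s)))"
proof
  fix x
  have fa: "e (s a) \<noteq> a" "e (s a) \<noteq> b" "e (s b) \<noteq> a" "e (s b) \<noteq> b"
    using e_D'[OF sa_D'] e_D'[OF sb_D'] by auto
  have t: "transpose a b (e (s a)) = e (s a)" "transpose a b (e (s b)) = e (s b)"
    using fa by (auto simp: transpose_def)
  consider "x = a" | "x = b" | "x \<noteq> a" "x \<noteq> b" "s x = a" | "x \<noteq> a" "x \<noteq> b" "s x = b" 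
    | "x \<noteq> a" "x \<noteq> b" "s x \<noteq> a" "s x \<noteq> b" by blast
  then show "(e' \<circ> s') x = rem b (rem a (transpose a b \<circ> (e \<circ> s))) x"
  proof cases
    case 1 then show ?thesis using ab by (simp add: rem_def)
  next
    case 2 then show ?thesis using ab ba by (simp add: rem_def)
  next
    case 3
    have "s' x = s a" using 3 sa_D' ab by (simp add: rem_def)
    then have "(e' \<circ> s') x = e (s a)" using sa_D' by (simp add: e'_eq)
    moreover have "(transpose a b \<circ> (e \<circ> s)) x = a" using 3 ab by simp
    ultimately show ?thesis using 3 fa t by (simp add: rem_def)
  next
    case 4
    have "s' x = s b" using 4 sb_D' ab by (simp add: rem_def)
    then have "(e' \<circ> s') x = e (s b)" using sb_D' by (simp add: e'_eq)
    moreover have "(transpose a b \<circ> (e \<circ> s)) x = b" using 4 ba by simp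
    ultimately show ?thesis using 4 fa t ab by (simp add: rem_def)
  next
    case 5
    have "s' x = s x" using 5 by (simp add: rem_def)
    then have "(e' \<circ> s') x = e (s x)" using 5 by (simp add: e'_eq)
    moreover have "e (s x) \<noteq> a" "e (s x) \<noteq> b" using 5 e_iff by blast+
    moreover from this have "(transpose a b \<circ> (e \<circ> s)) x = e (s x)" by (simp add: transpose_def)
    ultimately show ?thesis using 5 by (simp add: rem_def)
  qed
qed

text \<open>The merged cycle is \<open>a # w @ b # q\<close>. Dropping \<open>a\<close> and
  \<open>b\<close> and rotating makes the list start with the opened face, whose head becomes the
  new root.\<close>

lemma cyc': "cycl (e' \<circ> s') (q @ w)"
proof -
  have "cycl (transpose a b \<circ> (e \<circ> s)) (a # w @ b # q)" using cycl_transpose_merge[OF cyc_a cyc_b disj] .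
  from cycl_rem[OF this] have "cycl (rem a (transpose a b \<circ> (e \<circ> s))) (w @ (b # q))" by simp
  from cycl_append_commute[OF this] have "cycl (rem a (transpose a b \<circ> (e \<circ> s))) (b # q @ w)" by simp
  from cycl_rem[OF this] show ?thesis using qne unfolding phi'_eq by simp
qed

lemma orb': "x \<in> set (q @ w) \<Longrightarrow> orbit_of (e' \<circ> s') x = set (q @ w)"
  by (rule cycl_orbit[OF cyc'])

lemma trans_permutes: "transpose a b \<circ> (e \<circ> s) permutes D"
  by (rule permutes_compose[OF phi permutes_swap_id[OF aD bD]])

lemma orb_other:
  assumes "x \<notin> set (a # w)" "x \<notin> set (b # q)"
  shows "orbit_of (e' \<circ> s') x = orbit_of (e \<circ> s) x"
proof -
  let ?g = "transpose a b \<circ> (e \<circ> s)"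
  have n: "a \<notin> orbit_of (e \<circ> s) x" "b \<notin> orbit_of (e \<circ> s) x"
    using assms orb_a orb_b orbit_sym[OF phi fin] by blast+
  have "orbit_of (rem b (rem a ?g)) x = orbit_of ?g x - {a} - {b}"
    using assms orbit_rem[OF rem_permutes[OF trans_permutes], of a x b] orbit_rem[OF trans_permutes fin, of x a] fin by (simp del: o_apply)
  also have "orbit_of ?g x = orbit_of (e \<circ> s) x" by (rule orbit_transpose_other[OF phi fin n])
  finally show ?thesis unfolding phi'_eq using n by (simp del: o_apply)
qed

lemma norb_s': "norb s' D' = norb s D"
proof -
  have "rem a s b \<noteq> b" using sb_D' sa_D' ab by (simp add: rem_def)
  then have "norb s' (D - {a} - {b}) = norb (rem a s) (D - {a})"
    using bD ab fin by (intro norb_rem rem_permutes s) auto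
  also have "\<dots> = norb s D" using aD sa_D' by (intro norb_rem s fin) auto
  finally show ?thesis by (simp add: D'_eq)
qed

lemma norb_phi': "norb (e' \<circ> s') D' + 1 = norb (e \<circ> s) D"
proof -
  let ?g = "transpose a b \<circ> (e \<circ> s)"
  have fa: "e (s a) \<noteq> a" "e (s a) \<noteq> b" "e (s b) \<noteq> a" "e (s b) \<noteq> b"
    using e_D'[OF sa_D'] e_D'[OF sb_D'] by auto
  have ga: "?g a = e (s a)" "?g b = e (s b)" using fa by (auto simp: transpose_def)
  have "rem a ?g b \<noteq> b" using fa ga ab by (simp add: rem_def del: o_apply)
  then have "norb (rem b (rem a ?g)) (D - {a} - {b}) = norb (rem a ?g) (D - {a})"
    using bD ab fin by (intro norb_rem rem_permutes trans_permutes) auto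
  also have "\<dots> = norb ?g D" using aD ga fa by (intro norb_rem trans_permutes fin) auto
  finally have "norb (e' \<circ> s') D' = norb ?g D" unfolding phi'_eq by (simp add: D'_eq)
  moreover have "b \<notin> orbit_of (e \<circ> s) a" using orb_a disj by auto
  ultimately show ?thesis using norb_transpose_merge[OF phi fin aD bD] by simp
qed

end

text \<open>For a fixed point \<open>a\<close> of \<open>f\<close> this puts \<open>a\<close> into
  the cycle of \<open>y\<close>, directly behind \<open>y\<close>; it undoes
  \<open>rem\<close>.\<close>

definition ins :: "nat \<Rightarrow> nat \<Rightarrow> (nat \<Rightarrow> nat) \<Rightarrow> nat \<Rightarrow> nat" where
  "ins a y f = f \<circ> transpose a y"

lemma rem_ins:
  assumes "f a = a" "a \<noteq> y" "inj f" shows "rem a (ins a y f) = f"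
proof
  fix x
  consider "x = a" | "x = y" | "x \<noteq> a" "x \<noteq> y" by blast
  then show "rem a (ins a y f) x = f x"
  proof cases
    case 3
    then have "f x \<noteq> a" using assms by (metis injD)
    then show ?thesis using 3 by (simp add: rem_def ins_def transpose_def)
  qed (use assms in \<open>simp_all add: rem_def ins_def\<close>)
qed

lemma ins_rem:
  assumes "inj f" "f y = a" "a \<noteq> y" shows "ins a y (rem a f) = f"
proof
  fix x
  consider "x = a" | "x = y" | "x \<noteq> a" "x \<noteq> y" by blast
  then show "ins a y (rem a f) x = f x"
  proof cases
    case 3
    then have "f x \<noteq> a" using assms by (metis injD)
    then show ?thesis using 3 by (simp add: rem_def ins_def transpose_def)
  qed (use assms in \<open>simp_all add: rem_def ins_def\<close>)
qed

lemma ins_permutes: "f permutes D \<Longrightarrow> y \<in> D \<Longrightarrow> ins a y f permutes insert a D"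
  unfolding ins_def by (intro permutes_compose permutes_swap_id) (auto intro: permutes_subset)

lemma edge_join:
  assumes "rotsys D0 t f" and new: "a \<notin> D0" "b \<notin> D0" "a \<noteq> b"
  defines "e \<equiv> f(a := b, b := a)"
  shows "e permutes insert a (insert b D0)" "e (e h) = h" "rem a e = f"
proof -
  interpret rotsys D0 t f by fact
  have tf: "f a = a" "f b = b" using e new by (auto simp: permutes_def)
  show "e (e h) = h" for h
  proof -
    have "f h \<noteq> a \<and> f h \<noteq> b" if "h \<noteq> a" "h \<noteq> b" using that inv tf by metis
    then show ?thesis using inv new by (auto simp: e_def)
  qed
  have "e = transpose a b \<circ> f"
  proof
    fix h show "e h = (transpose a b \<circ> f) h"
    proof (cases "h = a \<or> h = b")
      case False
      then have "f h \<noteq> a \<and> f h \<noteq> b" using inv tf by metis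
      then show ?thesis using False by (simp add: e_def transpose_def)
    qed (use tf new in \<open>auto simp: e_def\<close>)
  qed
  then show "e permutes insert a (insert b D0)"
    using e by (auto intro!: permutes_compose permutes_swap_id intro: permutes_subset)
  show "rem a e = f"
  proof
    fix h show "rem a e h = f h"
    proof (cases "h = a \<or> h = b")
      case False
      then have "f h \<noteq> a" using inv tf by metis
      then show ?thesis using False by (simp add: e_def rem_def)
    qed (use tf new in \<open>auto simp: e_def rem_def\<close>)
  qed
qed

text \<open>Draws a chord inside the face \<open>q @ w\<close>. The positions are dictated by
  \<open>s_last\<close> in \<open>edge_cut\<close>: with \<open>a\<close> directly behind
  \<open>last q\<close>, the face permutation sends \<open>last q\<close> to \<open>e a = b\<close>
  and closes \<open>b # q\<close>; likewise \<open>last w\<close> is sent to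
  \<open>a\<close>.\<close>

lemma edge_insert:
  assumes "rotsys D0 t f" and c: "cycl (f \<circ> t) (q @ w)" and ne: "q \<noteq> []" "w \<noteq> []"
    and qw: "set (q @ w) \<subseteq> D0" and new: "a \<notin> D0" "b \<notin> D0" "a \<noteq> b"
  defines "s \<equiv> ins a (last q) (ins b (last w) t)" and "e \<equiv> f(a := b, b := a)"
  shows "edge_cut (insert a (insert b D0)) s e a b w q" "rem b (rem a s) = t" "rem a e = f"
proof -
  interpret rotsys D0 t f by fact
  let ?y = "last q" and ?x = "last w"
  have d: "distinct (q @ w)" using c by (simp add: cycl_def)
  have in0: "?y \<in> D0" "?x \<in> D0" "hd q \<in> D0" "hd w \<in> D0" using qw ne by auto
  have xy: "?y \<noteq> ?x" using d ne by (metis IntI distinct_append empty_iff last_in_set)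
  have tf: "t a = a" "t b = b" "f a = a" "f b = b" using s e new by (auto simp: permutes_def)
  have sv: "s a = t ?y" "s ?y = a" "s b = t ?x" "s ?x = b" "\<And>z. z \<notin> {a, b, ?x, ?y} \<Longrightarrow> s z = t z"
    using in0 new xy tf unfolding s_def ins_def by (auto simp: transpose_def)
  have sp: "s permutes insert a (insert b D0)"
    unfolding s_def using s in0 by (intro ins_permutes) auto
  have tD: "t h \<in> D0 \<longleftrightarrow> h \<in> D0" "f h \<in> D0 \<longleftrightarrow> h \<in> D0" for h using s e by (auto simp: permutes_in_image)
  note ej = edge_join[OF assms(1) new, folded e_def]
  have fm: "map (f \<circ> t) q = tl q @ [hd w]" "map (f \<circ> t) w = tl w @ [hd q]"
    using cycl_maps[OF c ne] by auto
  have last_fm: "f (t ?y) = hd w" "f (t ?x) = hd q"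
    using arg_cong[OF fm(1), of last] arg_cong[OF fm(2), of last] ne by (simp_all add: last_map)
  have ef: "e (s z) = f (t z)" if "z \<in> D0" "z \<noteq> ?x" "z \<noteq> ?y" for z
  proof -
    have "z \<notin> {a, b, ?x, ?y}" using that new by auto
    moreover have "t z \<noteq> a" "t z \<noteq> b" using that tD new by auto
    ultimately show ?thesis using sv(5) by (simp add: e_def)
  qed
  have blw: "z \<noteq> ?x \<and> z \<noteq> ?y" if "z \<in> set (butlast w)" for z
  proof -
    have "w = butlast w @ [?x]" using ne by simp
    then have "?x \<notin> set (butlast w)" using d by (metis distinct_append not_distinct_conv_prefix)
    moreover have "z \<in> set w" using that by (rule in_set_butlastD)
    ultimately show ?thesis using that d last_in_set[OF ne(1)] last_in_set[OF ne(2)]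
      unfolding distinct_append by blast
  qed
  have blq: "z \<noteq> ?x \<and> z \<noteq> ?y" if "z \<in> set (butlast q)" for z
  proof -
    have "q = butlast q @ [?y]" using ne by simp
    then have "?y \<notin> set (butlast q)" using d by (metis distinct_append not_distinct_conv_prefix)
    moreover have "z \<in> set q" using that by (rule in_set_butlastD)
    ultimately show ?thesis using that d last_in_set[OF ne(1)] last_in_set[OF ne(2)]
      unfolding distinct_append by blast
  qed
  have mw: "map (e \<circ> s) w = tl w @ [a]"
  proof -
    have "map (e \<circ> s) (butlast w @ [?x]) = map (e \<circ> s) (butlast w) @ [e (s ?x)]" by simp
    then have "map (e \<circ> s) w = map (e \<circ> s) (butlast w) @ [e (s ?x)]"
      unfolding append_butlast_last_id[OF ne(2)] .
    also have "map (e \<circ> s) (butlast w) = map (f \<circ> t) (butlast w)"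
      using ef blw qw by (auto dest: in_set_butlastD)
    also have "\<dots> = tl w" unfolding map_butlast fm by simp
    also have "e (s ?x) = a" using sv new by (simp add: e_def)
    finally show ?thesis .
  qed
  have mq: "map (e \<circ> s) q = tl q @ [b]"
  proof -
    have "map (e \<circ> s) (butlast q @ [?y]) = map (e \<circ> s) (butlast q) @ [e (s ?y)]" by simp
    then have "map (e \<circ> s) q = map (e \<circ> s) (butlast q) @ [e (s ?y)]"
      unfolding append_butlast_last_id[OF ne(1)] .
    also have "map (e \<circ> s) (butlast q) = map (f \<circ> t) (butlast q)"
      using ef blq qw by (auto dest: in_set_butlastD)
    also have "\<dots> = tl q" unfolding map_butlast fm by simp
    also have "e (s ?y) = b" using sv new by (simp add: e_def)
    finally show ?thesis .
  qed
  have esa: "e (s a) = hd w" "e (s b) = hd q"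
  proof -
    have "t ?y \<in> D0" "t ?x \<in> D0" using tD in0 by auto
    then have "t ?y \<noteq> a" "t ?y \<noteq> b" "t ?x \<noteq> a" "t ?x \<noteq> b" using new by auto
    then show "e (s a) = hd w" "e (s b) = hd q" using sv last_fm by (simp_all add: e_def)
  qed
  have ww: "w = hd w # tl w" "q = hd q # tl q" using ne by auto
  show "edge_cut (insert a (insert b D0)) s e a b w q"
  proof
    show "cycl (e \<circ> s) (a # w)" unfolding cycl_Cons_iff using mw esa ww(1) d qw new by auto
    show "cycl (e \<circ> s) (b # q)" unfolding cycl_Cons_iff using mq esa ww(2) d qw new by auto
    show "set (a # w) \<inter> set (b # q) = {}" using d qw new by auto
  qed (use fin sp ej(1,2) new ne in \<open>auto simp: e_def\<close>)
  have it: "inj t" using s by (rule permutes_inj)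
  have "inj (ins b ?x t)" unfolding ins_def using it by (simp add: inj_compose)
  moreover have "ins b ?x t a = a" using new in0 tf by (auto simp: ins_def transpose_def)
  moreover have "a \<noteq> ?y" using new in0 by auto
  ultimately have "rem a s = ins b ?x t" unfolding s_def by (intro rem_ins) auto
  moreover have "b \<noteq> ?x" using new in0 by auto
  ultimately show "rem b (rem a s) = t" using it tf by (simp add: rem_ins)
  show "rem a e = f" by (rule ej(3))
qed

text \<open>Deletion forgets only where the edge was attached, and that is recovered from the last
  darts of \<open>q\<close> and \<open>w\<close>; this is the injectivity of the deletion.\<close>

lemma (in edge_cut) ins_cut: "ins a (last q) (ins b (last w) s') = s"
proof -
  have "inj s" using s by (rule permutes_inj)
  moreover have "inj (rem a s)" using rem_permutes[OF s] by (rule permutes_inj)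
  moreover have "last w \<in> D'" "last q \<in> D'"
    using w_D' q_D' last_in_set[OF wne] last_in_set[OF qne] by blast+
  moreover have "rem a s (last w) = b" using s_last \<open>last w \<in> D'\<close> ab by (simp add: rem_def)
  ultimately show ?thesis using s_last ins_rem[of "rem a s" "last w" b] ins_rem[of s "last q" a] by auto
qed

lemma (in edge) e_cut: "(rem a e)(a := b, b := a) = e"
  using ab ba by (auto simp: fun_eq_iff e'_eq)

text \<open>The complementary case: \<open>a\<close> is the only dart of its vertex, so the face
  turns from \<open>a\<close> straight to \<open>b\<close>. Deletion loses a vertex and no face,
  whereas \<open>edge_cut\<close> loses a face and no vertex; either way the Euler relation
  persists.\<close>

locale leaf_cut = edge D s e a b for D s e a b +
  fixes w :: "nat list"
  assumes sa: "s a = a" and cyc: "cycl (e \<circ> s) (a # b # w)" and wne: "w \<noteq> []"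
begin

lemma orb: "x \<in> set (a # b # w) \<Longrightarrow> orbit_of (e \<circ> s) x = set (a # b # w)"
  by (rule cycl_orbit[OF cyc])

lemma sub: "set (a # b # w) \<subseteq> D"
  using orbit_subset[OF phi fin aD] orb[of a] by simp

lemma dist: "distinct (a # b # w)"
  using cyc by (simp add: cycl_def)

lemma w_D': "set w \<subseteq> D'"
  using sub dist by auto

lemma rem_a: "rem a s = s"
  using sa inv by (auto simp: rem_def fun_eq_iff)

lemma phi_b: "e (s b) = hd w"
proof -
  have "hd (map (e \<circ> s) (b # w)) = hd (w @ [a])" using cyc by (simp add: cycl_Cons_iff)
  then show ?thesis using wne by simp
qed

lemma s_b: "s b = e (hd w)"
  using inv[of "s b"] unfolding phi_b by simp

lemma sb_D': "s b \<in> D'"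
  unfolding s_b using e_D' w_D' hd_in_set[OF wne] by blast

lemma s_last: "s (last w) = b"
proof -
  have "last (map (e \<circ> s) (a # b # w)) = last (b # w @ [a])" using cyc by (simp only: cycl_def rotate1.simps append_Cons)
  then have "e (s (last w)) = a" using wne by (simp add: last_map)
  then show ?thesis using e_iff by blast
qed

lemma s_neq_a: "x \<noteq> a \<Longrightarrow> s x \<noteq> a"
  using sa permutes_inj[OF s] by (metis injD)

lemma s'_apply: "x \<in> D' \<Longrightarrow> s' x = (if s x = b then s b else s x)"
  unfolding rem_a by (auto simp: rem_def)

lemma phi'_eq: "e' \<circ> s' = rem b (rem a (e \<circ> s))"
proof
  fix x
  have fb: "e (s b) \<noteq> a" "e (s b) \<noteq> b" using e_D'[OF sb_D'] by auto
  consider "x = a" | "x = b" | "x \<noteq> a" "x \<noteq> b" "s x = b" | "x \<noteq> a" "x \<noteq> b" "s x \<noteq> b" by blast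
  then show "(e' \<circ> s') x = rem b (rem a (e \<circ> s)) x"
  proof cases
    case 1 then show ?thesis using ab sa by (simp add: rem_def)
  next
    case 2 then show ?thesis using ab ba by (simp add: rem_def)
  next
    case 3
    have "s' x = s b" using 3 unfolding rem_a by (simp add: rem_def)
    then have "(e' \<circ> s') x = e (s b)" using sb_D' by (simp add: e'_eq)
    then show ?thesis using 3 ab ba sa fb by (simp add: rem_def)
  next
    case 4
    have "s' x = s x" using 4 unfolding rem_a by (simp add: rem_def)
    then have "(e' \<circ> s') x = e (s x)" using 4 s_neq_a by (simp add: e'_eq)
    moreover have "e (s x) \<noteq> a" "e (s x) \<noteq> b" using 4 e_iff s_neq_a by blast+
    ultimately show ?thesis using 4 by (simp add: rem_def)
  qed
qed

lemma cyc': "cycl (e' \<circ> s') w"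
proof -
  have "cycl (rem a (e \<circ> s)) (b # w)" using cycl_rem[OF cyc] by simp
  from cycl_rem[OF this wne] show ?thesis unfolding phi'_eq .
qed

lemma orb': "x \<in> set w \<Longrightarrow> orbit_of (e' \<circ> s') x = set w"
  by (rule cycl_orbit[OF cyc'])

lemma orb_other:
  assumes "x \<notin> set (a # b # w)"
  shows "orbit_of (e' \<circ> s') x = orbit_of (e \<circ> s) x"
proof -
  have n: "a \<notin> orbit_of (e \<circ> s) x" "b \<notin> orbit_of (e \<circ> s) x"
    using assms orb[of a] orb[of b] orbit_sym[OF phi fin] by auto
  have "orbit_of (rem b (rem a (e \<circ> s))) x = orbit_of (e \<circ> s) x - {a} - {b}"
    using assms orbit_rem[OF rem_permutes[OF phi], of a x b] orbit_rem[OF phi fin, of x a] fin by (simp del: o_apply)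
  then show ?thesis unfolding phi'_eq using n by (simp del: o_apply)
qed

lemma orbit_a: "orbit_of s a = {a}"
  by (rule orbit_fixed[OF s fin sa])

lemma norb_s': "norb s' D' + 1 = norb s D"
proof -
  have "norb (rem a s) (D - {a}) + 1 = norb s D" using aD sa by (intro norb_rem_fixed s fin) auto
  moreover have "norb s' (D - {a} - {b}) = norb (rem a s) (D - {a})"
  proof (rule norb_rem[OF rem_permutes[OF s]])
    show "rem a s b \<noteq> b" unfolding rem_a using sb_D' by auto
  qed (use bD ab fin in auto)
  ultimately show ?thesis unfolding D'_eq by simp
qed

lemma norb_phi': "norb (e' \<circ> s') D' = norb (e \<circ> s) D"
proof -
  have fb: "e (s b) \<noteq> a" "e (s b) \<noteq> b" using e_D'[OF sb_D'] by auto
  have "norb (rem a (e \<circ> s)) (D - {a}) = norb (e \<circ> s) D"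
    using aD sa ab by (intro norb_rem phi fin) auto
  moreover have "norb (rem b (rem a (e \<circ> s))) (D - {a} - {b}) = norb (rem a (e \<circ> s)) (D - {a})"
  proof (rule norb_rem[OF rem_permutes[OF phi]])
    show "rem a (e \<circ> s) b \<noteq> b" using fb ab by (simp add: rem_def)
  qed (use bD ab fin in auto)
  ultimately show ?thesis unfolding D'_eq phi'_eq by simp
qed

lemma ins_cut: "ins b (last w) s' = s"
proof -
  have "last w \<noteq> b" using w_D' last_in_set[OF wne] by blast
  then show ?thesis unfolding rem_a using s_last permutes_inj[OF s] by (intro ins_rem) auto
qed

end

lemma leaf_insert:
  assumes "rotsys D0 t f" and c: "cycl (f \<circ> t) w" and ne: "w \<noteq> []"
    and wD: "set w \<subseteq> D0" and new: "a \<notin> D0" "b \<notin> D0" "a \<noteq> b"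
  defines "s \<equiv> ins b (last w) t" and "e \<equiv> f(a := b, b := a)"
  shows "leaf_cut (insert a (insert b D0)) s e a b w" "rem b (rem a s) = t" "rem a e = f"
proof -
  interpret rotsys D0 t f by fact
  let ?x = "last w"
  have d: "distinct w" using c by (simp add: cycl_def)
  have in0: "?x \<in> D0" "hd w \<in> D0" using wD ne by auto
  have tf: "t a = a" "t b = b" "f a = a" "f b = b" using s e new by (auto simp: permutes_def)
  have sv: "s a = a" "s b = t ?x" "s ?x = b" "\<And>z. z \<notin> {b, ?x} \<Longrightarrow> s z = t z"
    using in0 new tf unfolding s_def ins_def by (auto simp: transpose_def)
  have "s permutes insert b D0"
    unfolding s_def using s in0 by (intro ins_permutes) auto
  then have sp: "s permutes insert a (insert b D0)" by (rule permutes_subset) auto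
  have tD: "t h \<in> D0 \<longleftrightarrow> h \<in> D0" "f h \<in> D0 \<longleftrightarrow> h \<in> D0" for h using s e by (auto simp: permutes_in_image)
  note ej = edge_join[OF assms(1) new, folded e_def]
  have fm: "map (f \<circ> t) w = tl w @ [hd w]" using c by (cases w) (auto simp: cycl_def)
  have last_fm: "f (t ?x) = hd w"
    using arg_cong[OF fm(1), of last] ne by (simp add: last_map)
  have ef: "e (s z) = f (t z)" if "z \<in> D0" "z \<noteq> ?x" for z
  proof -
    have "z \<notin> {b, ?x}" using that new by auto
    moreover have "t z \<noteq> a" "t z \<noteq> b" using that tD new by auto
    ultimately show ?thesis using sv(4) by (simp add: e_def)
  qed
  have blw: "z \<noteq> ?x" if "z \<in> set (butlast w)" for z
  proof -
    have "w = butlast w @ [?x]" using ne by simp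
    then have "?x \<notin> set (butlast w)" using d by (metis distinct_append not_distinct_conv_prefix)
    then show ?thesis using that by auto
  qed
  have mw: "map (e \<circ> s) w = tl w @ [a]"
  proof -
    have "map (e \<circ> s) (butlast w @ [?x]) = map (e \<circ> s) (butlast w) @ [e (s ?x)]" by simp
    then have "map (e \<circ> s) w = map (e \<circ> s) (butlast w) @ [e (s ?x)]"
      unfolding append_butlast_last_id[OF ne] .
    also have "map (e \<circ> s) (butlast w) = map (f \<circ> t) (butlast w)"
      using ef blw wD by (auto dest: in_set_butlastD)
    also have "\<dots> = tl w" unfolding map_butlast fm by simp
    also have "e (s ?x) = a" using sv new by (simp add: e_def)
    finally show ?thesis .
  qed
  have esa: "e (s a) = b" "e (s b) = hd w"
  proof -
    have "t ?x \<in> D0" using tD in0 by auto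
    then have "t ?x \<noteq> a" "t ?x \<noteq> b" using new by auto
    then show "e (s a) = b" "e (s b) = hd w" using sv last_fm new by (simp_all add: e_def)
  qed
  have ww: "w = hd w # tl w" using ne by auto
  show "leaf_cut (insert a (insert b D0)) s e a b w"
  proof
    show "cycl (e \<circ> s) (a # b # w)" unfolding cycl_Cons_iff using mw esa ww d wD new by auto
  qed (use fin sp ej(1,2) sv new ne in \<open>auto simp: e_def\<close>)
  have "b \<noteq> ?x" using new in0 by auto
  then have "rem b s = t" unfolding s_def using s tf by (intro rem_ins) (auto intro: permutes_inj)
  moreover have "rem a s = s" 
  proof
    fix x show "rem a s x = s x"
    proof (cases "x = a")
      case False
      then have "s x \<noteq> a" using sv(1) permutes_inj[OF sp] by (metis injD)
      then show ?thesis using False by (simp add: rem_def)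
    qed (use sv in \<open>simp add: rem_def\<close>)
  qed
  ultimately show "rem b (rem a s) = t" by simp
  show "rem a e = f" by (rule ej(3))
qed

section \<open>Labelled maps under deletion and insertion of an edge\<close>

context edge
begin

lemma lab_rem:
  assumes "l \<circ> s = l" and sa: "s a \<in> D' \<or> s a = a" and sb: "s b \<in> D'"
  shows "l(a := 0, b := 0) \<circ> s' = l(a := 0, b := 0)"
proof
  fix x
  have l: "l (s y) = l y" for y using fun_cong[OF assms(1), of y] by simp
  show "(l(a := 0, b := 0) \<circ> s') x = (l(a := 0, b := 0)) x"
  proof (cases "x \<in> D'")
    case True
    have "s x \<noteq> a" if "s a = a" using that True permutes_inj[OF s] by (metis DiffE injD insertI1)
    then have "s' x = (if s x = a then s a else if s x = b then s b else s x)"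
      using True sa sb ab(2) unfolding rem_def by auto
    moreover have "s' x \<in> D'" using True permutes_in_image[OF s'_permutes] by blast
    ultimately have "l (s' x) = l x" using l by metis
    then show ?thesis using True \<open>s' x \<in> D'\<close> by auto
  next
    case False
    then have "s' x = x" using s'_permutes unfolding permutes_def by blast
    then show ?thesis by (simp only: comp_apply)
  qed
qed

text \<open>Deletion can only destroy outgoing falls. This transfers uniqueness of the sink to the
  map with the edge put back; the other direction is \<open>sink_cut\<close>.\<close>

lemma sink_mono:
  assumes "h \<in> D'" "sink s e c l h"
  shows "sink s' e' (c(a := False, b := False)) (l(a := 0, b := 0)) h"
  unfolding sink_def
proof
  fix g assume "g \<in> orbit_of s' h"
  then have g: "g \<in> orbit_of s h" "g \<noteq> a" "g \<noteq> b" using orb_s'[OF assms(1)] by auto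
  then have "c g \<or> l (e g) + 1 \<noteq> l g" using assms(2) unfolding sink_def by blast
  then show "(c(a := False, b := False)) g \<or> (l(a := 0, b := 0)) (e' g) + 1 \<noteq> (l(a := 0, b := 0)) g"
    using g e_iff by (simp add: e'_eq)
qed

end

context edge_cut
begin

abbreviation "col' c \<equiv> c(a := False, b := False)"
abbreviation "lab' l \<equiv> l(a := 0::nat, b := 0)"

lemma phi'_other:
  assumes "h \<notin> set (a # w)" "h \<notin> set (b # q)" "h \<in> D"
  shows "e' (s' h) = e (s h)" "s h \<in> D'" "e (s h) \<in> D'"
proof -
  have "s h \<noteq> a"
  proof
    assume "s h = a"
    then have "(e \<circ> s) h \<in> orbit_of (e \<circ> s) b" using ab orbit_refl[OF phi fin] by simp
    then show False using orbit_step[OF phi fin] orb_b assms by blast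
  qed
  moreover have "s h \<noteq> b"
  proof
    assume "s h = b"
    then have "(e \<circ> s) h \<in> orbit_of (e \<circ> s) a" using ba orbit_refl[OF phi fin] by simp
    then show False using orbit_step[OF phi fin] orb_a assms by blast
  qed
  ultimately show sh: "s h \<in> D'" using assms(3) by (simp add: permutes_in_image[OF s])
  then show "e (s h) \<in> D'" by (rule e_D')
  have "h \<noteq> a" "h \<noteq> b" using assms by auto
  then show "e' (s' h) = e (s h)" using sh assms(3) s'_apply[of h] e'_eq[of "s h"] by auto
qed

lemma not_root': "h \<notin> orbit_of (e' \<circ> s') (hd q) \<longleftrightarrow> h \<notin> set q \<and> h \<notin> set w"
  using orb'[of "hd q"] qne by auto

text \<open>Two situations in which deletion creates no sink: neither dart of the edge is an
  outgoing fall, or the fall is lost at \<open>a\<close> and the next dart \<open>s a\<close> around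
  that vertex is another one.\<close>

lemma sink_cut:
  assumes "(\<forall>g\<in>{a, b}. c g \<or> l (e g) + 1 \<noteq> l g) \<or> c b \<and> \<not> c (s a) \<and> l (e (s a)) + 1 = l (s a)"
    and "h \<in> D'" "sink s' e' (col' c) (lab' l) h"
  shows "sink s e c l h"
  unfolding sink_def
proof
  fix g assume g: "g \<in> orbit_of s h"
  have *: "c k \<or> l (e k) + 1 \<noteq> l k" if "k \<in> orbit_of s h" "k \<noteq> a" "k \<noteq> b" for k
  proof -
    have "k \<in> orbit_of s' h" using that orb_s'[OF assms(2)] by auto
    then have "(col' c) k \<or> (lab' l) (e' k) + 1 \<noteq> (lab' l) k" using assms(3) unfolding sink_def by blast
    then show ?thesis using that e_iff by (simp add: e'_eq)
  qed
  have "s a \<in> orbit_of s h" if "g = a" using g that orbit_step[OF s fin] by blast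
  then show "c g \<or> l (e g) + 1 \<noteq> l g"
    using assms(1) *[OF g] *[of "s a"] sa_D' by blast
qed

text \<open>The darts of \<open>q\<close> join the root face, where black darts must be reversed
  falls; \<open>qstep\<close> supplies this.\<close>

lemma cut_lmap:
  assumes "lmap D s e p c l a"
    and safe: "(\<forall>g\<in>{a, b}. c g \<or> l (e g) + 1 \<noteq> l g) \<or> c b \<and> \<not> c (s a) \<and> l (e (s a)) + 1 = l (s a)"
    and qstep: "\<And>h. h \<in> set q \<Longrightarrow> \<not> c h \<Longrightarrow> l h = l (e h) + 1"
  shows "lmap D' s' e' p (col' c) (lab' l) (hd q)"
proof -
  interpret L: lmap D s e p c l a by fact
  interpret S: rotsys D' s' e' by (rule small)
  show ?thesis
  proof
    show "e' h \<noteq> h" if "h \<in> D'" for h using that L.fpf by (simp add: e'_eq)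
    show "col' c (e' h) = (\<not> col' c h)" if "h \<in> D'" for h
      using that L.col_e e_iff by (simp add: e'_eq)
    show "\<not> col' c h \<and> lab' l h = 0" if "h \<notin> D'" for h using that L.dflt by auto
    show "lab' l \<circ> s' = lab' l" using lab_rem[OF L.lab_s] sa_D' sb_D' by simp
    show "lab' l (e' h) = lab' l h + 1 \<or> lab' l h = lab' l (e' h) + (p - 1)" if "h \<in> D'" "col' c h" for h
      using that L.step[of h] e_iff by (auto simp: e'_eq)
    show "hd q \<in> D'" using q_D' qne by (meson hd_in_set subsetD)
    show "h' \<in> orbit_of s' h" if "h \<in> D'" "h' \<in> D'" "sink s' e' (col' c) (lab' l) h" "sink s' e' (col' c) (lab' l) h'" for h h'
      using that L.uniq[of h h'] sink_cut[OF safe] orb_s' by auto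
    show "col' c (e' (s' h)) = col' c h" if "h \<in> D'" "h \<notin> orbit_of (e' \<circ> s') (hd q)" for h
    proof -
      have h: "h \<notin> set (a # w)" "h \<notin> set (b # q)" "h \<in> D" using that unfolding not_root' by auto
      show ?thesis using phi'_other[OF h] L.mono[OF h(3)] h orb_a by auto
    qed
    show "card (orbit_of (e' \<circ> s') h) = p" if "h \<in> D'" "h \<notin> orbit_of (e' \<circ> s') (hd q)" "\<not> col' c h" for h
    proof -
      have h: "h \<notin> set (a # w)" "h \<notin> set (b # q)" "h \<in> D" using that unfolding not_root' by auto
      then show ?thesis using L.blk[OF h(3)] h orb_a that(3) orb_other[OF h(1,2)] by auto
    qed
    show "lab' l h = lab' l (e' h) + 1" if h: "h \<in> orbit_of (e' \<circ> s') (hd q)" "\<not> col' c h" for h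
    proof -
      have hqw: "h \<in> set q \<union> set w" using h orb'[of "hd q"] qne by auto
      then have "h \<in> D'" using q_D' w_D' by auto
      moreover have "l h = l (e h) + 1"
        using hqw qstep[of h] L.rootstep[of h] h(2) orb_a \<open>h \<in> D'\<close> by auto
      ultimately show ?thesis using e_iff by (simp add: e'_eq)
    qed
    show "2 * (norb s' D' + norb (e' \<circ> s') D') = card D' + 4"
      using L.euler norb_phi' card_D unfolding norb_s' by simp
  qed
qed

text \<open>The labels of \<open>a\<close> and \<open>b\<close> are forced by \<open>s_last\<close>,
  each sharing its vertex with the last dart of \<open>q\<close> or \<open>w\<close>. The face
  \<open>b # q\<close> leaves the root face, so it has to be monochromatic and, if black, of degree
  \<open>p\<close>.\<close>

lemma uncut_lmap:
  assumes "lmap D' s' e' p (col' c) (lab' l) (hd q)"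
    and dfl: "\<And>h. h \<notin> D \<Longrightarrow> \<not> c h \<and> l h = 0"
    and cb: "c b = (\<not> c a)" and la: "l a = l (last q)" and lb: "l b = l (last w)"
    and stepa: "c a \<Longrightarrow> l b = l a + 1 \<or> l a = l b + (p - 1)"
    and stepb: "\<not> c a \<Longrightarrow> l a = l b + 1"
    and monoq: "\<And>h. h \<in> set q \<Longrightarrow> c h = c b"
    and blkq: "c a \<Longrightarrow> length q + 1 = p"
  shows "lmap D s e p c l a"
proof -
  interpret L: lmap D' s' e' p "col' c" "lab' l" "hd q" by fact
  have lq: "last q \<in> D'" "last w \<in> D'" using q_D' w_D' qne wne by (meson last_in_set subsetD)+
  have lab: "l (s x) = l x" for x
  proof -
    have ls': "l (s' y) = l y" if "y \<in> D'" for y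
    proof -
      have "s' y \<in> D'" using that permutes_in_image[OF s'_permutes] by blast
      then show ?thesis using fun_cong[OF L.lab_s, of y] that by auto
    qed
    have sl: "s' (last q) = s a" "s' (last w) = s b"
      using s'_apply lq s_last ab(2) by auto
    consider "x = a" | "x = b" | "x \<in> D'" "s x = a" | "x \<in> D'" "s x = b" | "x \<in> D'" "s x \<noteq> a" "s x \<noteq> b" | "x \<notin> D"
      by auto
    then show ?thesis
    proof cases
      case 1 then show ?thesis using ls'[OF lq(1)] sl la by simp
    next
      case 2 then show ?thesis using ls'[OF lq(2)] sl lb by simp
    next
      case 3
      then have "x = last q" using s_last permutes_inj[OF s] by (metis injD)
      then show ?thesis using 3 la by simp
    next
      case 4
      then have "x = last w" using s_last permutes_inj[OF s] by (metis injD)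
      then show ?thesis using 4 lb by simp
    next
      case 5 then show ?thesis using ls'[of x] s'_apply[of x] by simp
    next
      case 6 then show ?thesis using s by (simp add: permutes_def)
    qed
  qed
  have rest: "h \<in> D' \<Longrightarrow> col' c h = c h \<and> lab' l h = l h \<and> e' h = e h" for h by (auto simp: e'_eq)
  show ?thesis
  proof
    show "e h \<noteq> h" if "h \<in> D" for h using that L.fpf[of h] rest[of h] ab ba by (cases "h = a \<or> h = b") auto
    show "c (e h) = (\<not> c h)" if "h \<in> D" for h
    proof (cases "h \<in> D'")
      case True then show ?thesis using L.col_e[of h] rest[of h] rest[of "e h"] e_D'[of h] by metis
    next
      case False
      then have "h = a \<or> h = b" using that by auto
      then show ?thesis using cb ab ba by auto
    qed
    show "\<not> c h \<and> l h = 0" if "h \<notin> D" for h using dfl that .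
    show "l \<circ> s = l" using lab by auto
    show "l (e h) = l h + 1 \<or> l h = l (e h) + (p - 1)" if "h \<in> D" "c h" for h
    proof (cases "h \<in> D'")
      case True then show ?thesis using L.step[of h] rest[of h] rest[of "e h"] e_D'[of h] that by metis
    next
      case False
      then have "h = a \<or> h = b" using that by auto
      then show ?thesis using cb ab ba stepa stepb that by auto
    qed
    show "a \<in> D" by (rule aD)
    show "h' \<in> orbit_of s h" if h: "h \<in> D" "h' \<in> D" "sink s e c l h" "sink s e c l h'" for h h'
    proof -
      \<comment> \<open>Every vertex keeps a dart of \<open>D'\<close>, so uniqueness can be tested
        in the smaller map.\<close>
      have *: "\<exists>k\<in>D'. k \<in> orbit_of s h \<and> orbit_of s k = orbit_of s h" if "h \<in> D" for h
      proof (cases "h \<in> D'")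
        case True then show ?thesis using orbit_refl[OF s fin] by blast
      next
        case False
        then have "s h \<in> D'" using that sa_D' sb_D' by auto
        moreover have "s h \<in> orbit_of s h" using orbit_step[OF s fin] orbit_refl[OF s fin] by blast
        ultimately show ?thesis using orbit_eq[OF s fin] by blast
      qed
      obtain k where k1: "k \<in> D'" "orbit_of s k = orbit_of s h" using *[OF h(1)] by blast
      obtain k' where k2: "k' \<in> D'" "orbit_of s k' = orbit_of s h'" using *[OF h(2)] by blast
      note k = k1 k2
      then have "sink s e c l k" "sink s e c l k'" using h unfolding sink_def by simp_all
      then have "k' \<in> orbit_of s' k" using L.uniq[OF k(1,3)] sink_mono[OF k(1)] sink_mono[OF k(3)] by blast
      then have "k' \<in> orbit_of s k" using orb_s'[OF k(1)] by simp
      then show ?thesis using k(2,4) orbit_eq_iff[OF s fin, of k k'] orbit_eq_iff[OF s fin, of h h'] by simp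
    qed
    have out: "h \<in> D' \<and> h \<notin> orbit_of (e' \<circ> s') (hd q)" if "h \<in> D" "h \<notin> set (a # w)" "h \<notin> set (b # q)" for h
      using that unfolding not_root' by auto
    have inq: "e (s h) \<in> set (b # q)" if "h \<in> set (b # q)" for h
      using cycl_image[OF cyc_b that] by simp
    show "c (e (s h)) = c h" if h: "h \<in> D" "h \<notin> orbit_of (e \<circ> s) a" for h
    proof (cases "h \<in> set (b # q)")
      case True then show ?thesis using inq[OF True] monoq by auto
    next
      case False
      then have h': "h \<notin> set (a # w)" "h \<notin> set (b # q)" using h orb_a by auto
      show ?thesis using L.mono[of h] out[OF h(1) h'] phi'_other[OF h' h(1)] rest[of h] rest[of "e (s h)"] by simp
    qed
    show "card (orbit_of (e \<circ> s) h) = p" if h: "h \<in> D" "h \<notin> orbit_of (e \<circ> s) a" "\<not> c h" for h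
    proof (cases "h \<in> set (b # q)")
      case True
      then have "c a" using monoq cb h by auto
      moreover have "card (set (b # q)) = length q + 1" using distinct_card[OF dist(2)] by simp
      ultimately show ?thesis using True cycl_orbit[OF cyc_b True] blkq by simp
    next
      case False
      then have h': "h \<notin> set (a # w)" "h \<notin> set (b # q)" using h orb_a by auto
      show ?thesis using L.blk[of h] out[OF h(1) h'] orb_other[OF h'] rest[of h] h(3) by simp
    qed
    show "l h = l (e h) + 1" if h: "h \<in> orbit_of (e \<circ> s) a" "\<not> c h" for h
    proof (cases "h = a")
      case True then show ?thesis using stepb h ab by simp
    next
      case False
      then have hw: "h \<in> set w" using h orb_a by auto
      then have "h \<in> D'" "e h \<in> D'" using w_D' e_D' by blast+
      moreover have "h \<in> orbit_of (e' \<circ> s') (hd q)" using not_root' hw by blast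
      ultimately show ?thesis using L.rootstep[of h] rest[of h] rest[of "e h"] h(2) by metis
    qed
    show "2 * (norb s D + norb (e \<circ> s) D) = card D + 4"
      using L.euler norb_phi' card_D unfolding norb_s' by simp
  qed
qed

lemma wfaces_cut:
  assumes monoq: "\<And>h. h \<in> set q \<Longrightarrow> c h = c b"
  shows "wfaces D s e c - {orbit_of (e \<circ> s) a} =
    (wfaces D' s' e' (col' c) - {orbit_of (e' \<circ> s') (hd q)}) \<union> (if c b then {set (b # q)} else {})"
    "set (b # q) \<notin> wfaces D' s' e' (col' c)"
proof -
  let ?R = "(wfaces D' s' e' (col' c) - {orbit_of (e' \<circ> s') (hd q)})"
  have root: "orbit_of (e' \<circ> s') (hd q) = set (q @ w)" using orb'[of "hd q"] qne by simp
  have bq: "orbit_of (e \<circ> s) h = set (b # q)" if "h \<in> set (b # q)" for h using cycl_orbit[OF cyc_b that] .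
  have aw: "orbit_of (e \<circ> s) h = set (a # w)" if "h \<in> set (a # w)" for h using cycl_orbit[OF cyc_a that] .
  have ne: "set (b # q) \<noteq> set (a # w)" using disj by auto
  show "wfaces D s e c - {orbit_of (e \<circ> s) a} = ?R \<union> (if c b then {set (b # q)} else {})"
  proof (intro equalityI subsetI)
    fix F assume "F \<in> wfaces D s e c - {orbit_of (e \<circ> s) a}"
    then obtain h where h: "F = orbit_of (e \<circ> s) h" "h \<in> D" "c h" "F \<noteq> set (a # w)" 
      unfolding wfaces_def orb_a by auto
    then have ha: "h \<notin> set (a # w)" using aw by metis
    show "F \<in> ?R \<union> (if c b then {set (b # q)} else {})"
    proof (cases "h \<in> set (b # q)")
      case True
      then have "c b" using h(3) monoq by auto
      then show ?thesis using bq[OF True] h(1) by simp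
    next
      case False
      have "F = orbit_of (e' \<circ> s') h" using orb_other[OF ha False] h by simp
      moreover have "h \<in> D'" "col' c h" using ha False h by auto
      moreover have "F \<noteq> orbit_of (e' \<circ> s') (hd q)" 
        unfolding root using h(1) orbit_refl[OF phi fin, of h] ha False by auto
      ultimately show ?thesis unfolding wfaces_def by blast
    qed
  next
    fix F assume "F \<in> ?R \<union> (if c b then {set (b # q)} else {})"
    then consider "F \<in> ?R" | "c b" "F = set (b # q)" by (auto split: if_splits)
    then show "F \<in> wfaces D s e c - {orbit_of (e \<circ> s) a}"
    proof cases
      case 1
      then obtain h where h: "F = orbit_of (e' \<circ> s') h" "h \<in> D'" "col' c h" "F \<noteq> set (q @ w)"
        unfolding wfaces_def root by blast
      then have hh: "h \<notin> set (a # w)" "h \<notin> set (b # q)" using orb'[of h] by auto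
      then have "F = orbit_of (e \<circ> s) h" using orb_other h by simp
      moreover from this have "F \<noteq> orbit_of (e \<circ> s) a" using orbit_refl[OF phi fin, of h] hh orb_a by auto
      moreover have "h \<in> D" "c h" using h by (auto split: if_splits)
      ultimately show ?thesis unfolding wfaces_def by blast
    next
      case 2
      then show ?thesis using orb_a orb_b ne bD unfolding wfaces_def by auto
    qed
  qed
  show "set (b # q) \<notin> wfaces D' s' e' (col' c)"
  proof
    assume "set (b # q) \<in> wfaces D' s' e' (col' c)"
    then obtain h where h: "set (b # q) = orbit_of (e' \<circ> s') h" "h \<in> D'" unfolding wfaces_def by auto
    have "orbit_of (e' \<circ> s') h \<subseteq> D'" using orbit_subset[OF rotsys.phi[OF small] rotsys.fin[OF small] h(2)] .
    then show False using h by auto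
  qed
qed

text \<open>If the opened face is white, it was an inner face of degree \<open>length q + 1\<close>,
  and opening it takes its factor out of the weight. Black faces carry no weight.\<close>

lemma inner_cut:
  assumes monoq: "\<And>h. h \<in> set q \<Longrightarrow> c h = c b"
  shows "inner p D s e c a = inner p D' s' e' (col' c) (hd q) + (if c b then {#(length q + 1) div p#} else {#})"
proof -
  have "finite (wfaces D' s' e' (col' c))" unfolding wfaces_def using fin by auto
  moreover have "card (set (b # q)) = length q + 1" using distinct_card[OF dist(2)] by simp
  moreover note n = wfaces_cut(2)[of c, OF monoq]
  moreover have "wfaces D s e c - {orbit_of (e \<circ> s) a} =
    (wfaces D' s' e' (col' c) - {orbit_of (e' \<circ> s') (hd q)}) \<union> (if c b then {set (b # q)} else {})"
    by (rule wfaces_cut(1)) (rule monoq)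
  ultimately show ?thesis unfolding inner_def by (simp del: o_apply)
qed

end

context leaf_cut
begin

abbreviation "col' c \<equiv> c(a := False, b := False)"
abbreviation "lab' l \<equiv> l(a := 0::nat, b := 0)"

lemma phi'_other:
  assumes "h \<notin> set (a # b # w)" "h \<in> D"
  shows "e' (s' h) = e (s h)" "s h \<in> D'" "e (s h) \<in> D'"
proof -
  have ha: "h \<noteq> a" "h \<noteq> b" using assms by auto
  have "s h \<noteq> b"
  proof
    assume "s h = b"
    then have "(e \<circ> s) h \<in> orbit_of (e \<circ> s) a" using ba orbit_refl[OF phi fin] by simp
    then show False using orbit_step[OF phi fin] orb[of a] assms by auto
  qed
  then show sh: "s h \<in> D'" using s_neq_a[OF ha(1)] assms(2) by (simp add: permutes_in_image[OF s])
  then show "e (s h) \<in> D'" by (rule e_D')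
  show "e' (s' h) = e (s h)" using sh assms(2) ha s'_apply[of h] e'_eq[of "s h"] by auto
qed

lemma not_root': "h \<notin> orbit_of (e' \<circ> s') (hd w) \<longleftrightarrow> h \<notin> set w"
  using orb'[of "hd w"] wne by auto

lemma orb_s'_leaf: "x \<in> D' \<Longrightarrow> orbit_of s' x = orbit_of s x - {b}" "x \<in> D' \<Longrightarrow> a \<notin> orbit_of s x"
proof -
  show n: "a \<notin> orbit_of s x" if "x \<in> D'"
    using that orbit_a orbit_sym[OF s fin, of a x] by auto
  show "x \<in> D' \<Longrightarrow> orbit_of s' x = orbit_of s x - {b}" using n orb_s' by auto
qed

lemma cut_lmap:
  assumes "lmap D s e p c l a" and cb: "c b"
  shows "lmap D' s' e' p (col' c) (lab' l) (hd w)"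
proof -
  interpret L: lmap D s e p c l a by fact
  interpret S: rotsys D' s' e' by (rule small)
  have sink: "sink s e c l h" if h: "h \<in> D'" "sink s' e' (col' c) (lab' l) h" for h
    unfolding sink_def
  proof
    fix g assume g: "g \<in> orbit_of s h"
    show "c g \<or> l (e g) + 1 \<noteq> l g"
    proof (cases "g = b")
      case False
      have "g \<noteq> a" using g orb_s'_leaf(2)[OF h(1)] by blast
      moreover have "g \<in> orbit_of s' h" using g False orb_s'_leaf(1)[OF h(1)] by blast
      then have "(col' c) g \<or> (lab' l) (e' g) + 1 \<noteq> (lab' l) g" using h(2) unfolding sink_def by blast
      ultimately show ?thesis using False e_iff by (simp add: e'_eq)
    qed (use cb in simp)
  qed
  show ?thesis
  proof
    show "e' h \<noteq> h" if "h \<in> D'" for h using that L.fpf by (simp add: e'_eq)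
    show "col' c (e' h) = (\<not> col' c h)" if "h \<in> D'" for h
      using that L.col_e e_iff by (simp add: e'_eq)
    show "\<not> col' c h \<and> lab' l h = 0" if "h \<notin> D'" for h using that L.dflt by auto
    show "lab' l \<circ> s' = lab' l" using lab_rem[OF L.lab_s] sa sb_D' by simp
    show "lab' l (e' h) = lab' l h + 1 \<or> lab' l h = lab' l (e' h) + (p - 1)" if "h \<in> D'" "col' c h" for h
      using that L.step[of h] e_iff by (auto simp: e'_eq)
    show "hd w \<in> D'" using w_D' wne by (meson hd_in_set subsetD)
    show "h' \<in> orbit_of s' h" if "h \<in> D'" "h' \<in> D'" "sink s' e' (col' c) (lab' l) h" "sink s' e' (col' c) (lab' l) h'" for h h'
      using that L.uniq[of h h'] sink orb_s' by auto
    show "col' c (e' (s' h)) = col' c h" if "h \<in> D'" "h \<notin> orbit_of (e' \<circ> s') (hd w)" for h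
    proof -
      have h: "h \<notin> set (a # b # w)" "h \<in> D" using that unfolding not_root' by auto
      show ?thesis using phi'_other[OF h] L.mono[OF h(2)] h orb[of a] by auto
    qed
    show "card (orbit_of (e' \<circ> s') h) = p" if "h \<in> D'" "h \<notin> orbit_of (e' \<circ> s') (hd w)" "\<not> col' c h" for h
    proof -
      have h: "h \<notin> set (a # b # w)" "h \<in> D" using that unfolding not_root' by auto
      then show ?thesis using L.blk[OF h(2)] h orb[of a] that(3) orb_other[OF h(1)] by auto
    qed
    show "lab' l h = lab' l (e' h) + 1" if h: "h \<in> orbit_of (e' \<circ> s') (hd w)" "\<not> col' c h" for h
    proof -
      have hw: "h \<in> set w" using h orb'[of "hd w"] wne by auto
      then have "h \<in> D'" using w_D' by auto
      moreover have "l h = l (e h) + 1"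
        using hw L.rootstep[of h] h(2) orb[of a] \<open>h \<in> D'\<close> by auto
      ultimately show ?thesis using e_iff by (simp add: e'_eq)
    qed
    show "2 * (norb s' D' + norb (e' \<circ> s') D') = card D' + 4"
      using L.euler norb_s' card_D unfolding norb_phi' by simp
  qed
qed

lemma uncut_lmap:
  assumes "lmap D' s' e' p (col' c) (lab' l) (hd w)"
    and dfl: "\<And>h. h \<notin> D \<Longrightarrow> \<not> c h \<and> l h = 0"
    and ca: "\<not> c a" and cb: "c b" and la: "l a = l b + 1" and lb: "l b = l (last w)"
  shows "lmap D s e p c l a"
proof -
  interpret L: lmap D' s' e' p "col' c" "lab' l" "hd w" by fact
  have lw: "last w \<in> D'" using w_D' wne by (meson last_in_set subsetD)
  have lab: "l (s x) = l x" for x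
  proof -
    have ls': "l (s' y) = l y" if "y \<in> D'" for y
    proof -
      have "s' y \<in> D'" using that permutes_in_image[OF s'_permutes] by blast
      then show ?thesis using fun_cong[OF L.lab_s, of y] that by auto
    qed
    have sl: "s' (last w) = s b" using s'_apply lw s_last ab(2) by auto
    consider "x = a" | "x = b" | "x \<in> D'" "s x = b" | "x \<in> D'" "s x \<noteq> b" | "x \<notin> D"
      by auto
    then show ?thesis
    proof cases
      case 1 then show ?thesis using sa by simp
    next
      case 2 then show ?thesis using ls'[OF lw] sl lb by simp
    next
      case 3
      then have "x = last w" using s_last permutes_inj[OF s] by (metis injD)
      then show ?thesis using 3 lb by simp
    next
      case 4 then show ?thesis using ls'[of x] s'_apply[of x] by simp
    next
      case 5 then show ?thesis using s by (simp add: permutes_def)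
    qed
  qed
  have rest: "h \<in> D' \<Longrightarrow> col' c h = c h \<and> lab' l h = l h \<and> e' h = e h" for h by (auto simp: e'_eq)
  show ?thesis
  proof
    show "e h \<noteq> h" if "h \<in> D" for h using that L.fpf[of h] rest[of h] ab ba by (cases "h = a \<or> h = b") auto
    show "c (e h) = (\<not> c h)" if "h \<in> D" for h
    proof (cases "h \<in> D'")
      case True then show ?thesis using L.col_e[of h] rest[of h] rest[of "e h"] e_D'[of h] by metis
    next
      case False
      then have "h = a \<or> h = b" using that by auto
      then show ?thesis using ca cb ab ba by auto
    qed
    show "\<not> c h \<and> l h = 0" if "h \<notin> D" for h using dfl that .
    show "l \<circ> s = l" using lab by auto
    show "l (e h) = l h + 1 \<or> l h = l (e h) + (p - 1)" if "h \<in> D" "c h" for h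
    proof (cases "h \<in> D'")
      case True then show ?thesis using L.step[of h] rest[of h] rest[of "e h"] e_D'[of h] that by metis
    next
      case False
      then have "h = b" using that ca by auto
      then show ?thesis using la ba by auto
    qed
    show "a \<in> D" by (rule aD)
    show "h' \<in> orbit_of s h" if h: "h \<in> D" "h' \<in> D" "sink s e c l h" "sink s e c l h'" for h h'
    proof -
      \<comment> \<open>The new leaf has an outgoing fall along the new edge; so a sink is not the
        leaf and keeps a dart of \<open>D'\<close>.\<close>
      have *: "\<exists>k\<in>D'. orbit_of s k = orbit_of s h" if "h \<in> D" "sink s e c l h" for h
      proof (cases "h \<in> D'")
        case True then show ?thesis by blast
      next
        case False
        have "h \<noteq> a" using that(2) ca la ab unfolding sink_def orbit_a[symmetric] using orbit_refl[OF s fin, of a] by metis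
        then have "h = b" using False that by auto
        moreover have "s b \<in> orbit_of s b" using orbit_step[OF s fin] orbit_refl[OF s fin] by blast
        ultimately show ?thesis using orbit_eq[OF s fin] sb_D' by blast
      qed
      obtain k where k1: "k \<in> D'" "orbit_of s k = orbit_of s h" using *[OF h(1,3)] by blast
      obtain k' where k2: "k' \<in> D'" "orbit_of s k' = orbit_of s h'" using *[OF h(2,4)] by blast
      note k = k1 k2
      then have "sink s e c l k" "sink s e c l k'" using h unfolding sink_def by simp_all
      then have "k' \<in> orbit_of s' k" using L.uniq[OF k(1,3)] sink_mono[OF k(1)] sink_mono[OF k(3)] by blast
      then have "k' \<in> orbit_of s k" using orb_s'[OF k(1)] by simp
      then show ?thesis using k(2,4) orbit_eq_iff[OF s fin, of k k'] orbit_eq_iff[OF s fin, of h h'] by simp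
    qed
    have out: "h \<in> D' \<and> h \<notin> orbit_of (e' \<circ> s') (hd w)" if "h \<in> D" "h \<notin> set (a # b # w)" for h
      using that unfolding not_root' by auto
    show "c (e (s h)) = c h" if h: "h \<in> D" "h \<notin> orbit_of (e \<circ> s) a" for h
    proof -
      have h': "h \<notin> set (a # b # w)" using h orb[of a] by auto
      show ?thesis using L.mono[of h] out[OF h(1) h'] phi'_other[OF h' h(1)] rest[of h] rest[of "e (s h)"] by simp
    qed
    show "card (orbit_of (e \<circ> s) h) = p" if h: "h \<in> D" "h \<notin> orbit_of (e \<circ> s) a" "\<not> c h" for h
    proof -
      have h': "h \<notin> set (a # b # w)" using h orb[of a] by auto
      show ?thesis using L.blk[of h] out[OF h(1) h'] orb_other[OF h'] rest[of h] h(3) by simp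
    qed
    show "l h = l (e h) + 1" if h: "h \<in> orbit_of (e \<circ> s) a" "\<not> c h" for h
    proof (cases "h = a")
      case True then show ?thesis using la ab by simp
    next
      case False
      then have hw: "h \<in> set w" using h orb[of a] cb by auto
      then have "h \<in> D'" "e h \<in> D'" using w_D' e_D' by blast+
      moreover have "h \<in> orbit_of (e' \<circ> s') (hd w)" using not_root' hw by blast
      ultimately show ?thesis using L.rootstep[of h] rest[of h] rest[of "e h"] h(2) by metis
    qed
    show "2 * (norb s D + norb (e \<circ> s) D) = card D + 4"
      using L.euler norb_s' card_D unfolding norb_phi' by simp
  qed
qed

lemma wfaces_cut:
  "wfaces D s e c - {orbit_of (e \<circ> s) a} = wfaces D' s' e' (col' c) - {orbit_of (e' \<circ> s') (hd w)}"
proof (intro equalityI subsetI)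
  have root: "orbit_of (e' \<circ> s') (hd w) = set w" using orb'[of "hd w"] wne by simp
  have ra: "orbit_of (e \<circ> s) a = set (a # b # w)" using orb[of a] by simp
  {
    fix F assume "F \<in> wfaces D s e c - {orbit_of (e \<circ> s) a}"
    then obtain h where h: "F = orbit_of (e \<circ> s) h" "h \<in> D" "c h" "F \<noteq> set (a # b # w)" 
      unfolding wfaces_def ra by blast
    then have ha: "h \<notin> set (a # b # w)" using orb by metis
    have "F = orbit_of (e' \<circ> s') h" using orb_other[OF ha] h by simp
    moreover have "h \<in> D'" "col' c h" using ha h by auto
    moreover have "F \<noteq> orbit_of (e' \<circ> s') (hd w)" 
      unfolding root using h(1) orbit_refl[OF phi fin, of h] ha by auto
    ultimately show "F \<in> wfaces D' s' e' (col' c) - {orbit_of (e' \<circ> s') (hd w)}" unfolding wfaces_def by blast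
  next
    fix F assume "F \<in> wfaces D' s' e' (col' c) - {orbit_of (e' \<circ> s') (hd w)}"
    then obtain h where h: "F = orbit_of (e' \<circ> s') h" "h \<in> D'" "col' c h" "F \<noteq> set w"
      unfolding wfaces_def root by blast
    then have hh: "h \<notin> set (a # b # w)" using orb'[of h] by auto
    then have "F = orbit_of (e \<circ> s) h" using orb_other h by simp
    moreover from this have "F \<noteq> orbit_of (e \<circ> s) a" using orbit_refl[OF phi fin, of h] hh ra by auto
    moreover have "h \<in> D" "c h" using h by (auto split: if_splits)
    ultimately show "F \<in> wfaces D s e c - {orbit_of (e \<circ> s) a}" unfolding wfaces_def by blast
  }
qed

lemma inner_cut: "inner p D s e c a = inner p D' s' e' (col' c) (hd w)"
  unfolding inner_def wfaces_cut ..

end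

section \<open>Labels along a black face\<close>

lemma (in lmap) lab: "l (s x) = l x"
  using fun_cong[OF lab_s, of x] by simp

lemma (in lmap) phi_D: "e (s h) \<in> D \<longleftrightarrow> h \<in> D"
  using permutes_in_image[OF phi, of h] by simp

lemma (in lmap) lab_e_phi: "l (e (e (s h))) = l h"
  using inv lab by simp

lemma upt_shift_Cons:
  assumes "\<not> c" "x = y + 1" "zs = map (\<lambda>j. (False, x + j)) [1..<Suc n]"
  shows "(c, x) # zs = map (\<lambda>j. (False, y + j)) [1..<Suc (Suc n)]"
proof -
  have "[1..<Suc (Suc n)] = 1 # map Suc [1..<Suc n]"
    by (simp add: map_Suc_upt upt_conv_Cons del: upt_Suc)
  then have "map (\<lambda>j. (False, y + j)) [1..<Suc (Suc n)] = (False, y + 1) # map (\<lambda>j. (False, y + Suc j)) [1..<Suc n]"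
    by (simp del: upt_Suc)
  also have "(\<lambda>j. (False, y + Suc j)) = (\<lambda>j. (False, x + j))" using assms(2) by auto
  finally show ?thesis using assms by simp
qed

text \<open>A black step raises the label by 1 or lowers it by \<open>p - 1\<close>, so it gains at
  most 1, and a run that attains the bound consists of unit steps only. For the black face behind a
  rise this determines all labels.\<close>

lemma (in lmap) black_chain:
  assumes "map (e \<circ> s) (y # q) = q @ [z]" "y \<in> D" "\<And>h. h \<in> set q \<Longrightarrow> \<not> c h" 
  shows "l (last (y # q)) \<le> l y + length q"
    and "l (last (y # q)) = l y + length q \<Longrightarrow>
      (\<forall>h\<in>set q. l h = l (e h) + 1) \<and> map (\<lambda>h. (c h, l h)) q = map (\<lambda>j. (False, l y + j)) [1..<Suc (length q)]"
proof -
  have "l (last (y # q)) \<le> l y + length q \<and> (l (last (y # q)) = l y + length q \<longrightarrow>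
      (\<forall>h\<in>set q. l h = l (e h) + 1) \<and> map (\<lambda>h. (c h, l h)) q = map (\<lambda>j. (False, l y + j)) [1..<Suc (length q)])"
    using assms
  proof (induction q arbitrary: y)
    case (Cons h q)
    have "(e \<circ> s) y = h" "map (e \<circ> s) (h # q) = q @ [z]"
      using Cons.prems(1) by (simp_all only: list.map list.inject append_Cons)
    then have h: "h = e (s y)" "map (e \<circ> s) (h # q) = q @ [z]" by (simp, blast)
    have hD: "h \<in> D" using h(1) Cons.prems(2) phi_D by simp
    have IH: "l (last (h # q)) \<le> l h + length q" "l (last (h # q)) = l h + length q \<Longrightarrow>
      (\<forall>h\<in>set q. l h = l (e h) + 1) \<and> map (\<lambda>h. (c h, l h)) q = map (\<lambda>j. (False, l h + j)) [1..<Suc (length q)]"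
      using Cons.IH[OF h(2) hD] Cons.prems(3) by (meson list.set_intros(2))+
    have eh: "l (e h) = l y" unfolding h(1) by (rule lab_e_phi)
    have nc: "\<not> c h" using Cons.prems(3) by simp
    have "e h \<in> D" using hD permutes_in_image[OF e] by simp
    then have st: "l h = l (e h) + 1 \<or> l (e h) = l h + (p - 1)" using step[of "e h"] col_e[OF hD] nc inv by simp
    then have le: "l h \<le> l y + 1" using eh by auto
    show ?case
    proof (intro conjI impI)
      show "l (last (y # h # q)) \<le> l y + length (h # q)" using IH(1) le by simp
      assume a: "l (last (y # h # q)) = l y + length (h # q)"
      then have lh: "l h = l y + 1" using IH(1) le by simp
      then have "l (last (h # q)) = l h + length q" using a by simp
      note IH2 = IH(2)[OF this]
      have "l h = l (e h) + 1" unfolding lh eh ..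
      then show "\<forall>h\<in>set (h # q). l h = l (e h) + 1" using conjunct1[OF IH2] unfolding list.set by blast
      show "map (\<lambda>h. (c h, l h)) (h # q) = map (\<lambda>j. (False, l y + j)) [1..<Suc (length (h # q))]"
        unfolding list.map list.size add_Suc_right add_0_right using nc lh conjunct2[OF IH2] by (rule upt_shift_Cons)
    qed
  qed simp
  then show "l (last (y # q)) \<le> l y + length q" "l (last (y # q)) = l y + length q \<Longrightarrow>
      (\<forall>h\<in>set q. l h = l (e h) + 1) \<and> map (\<lambda>h. (c h, l h)) q = map (\<lambda>j. (False, l y + j)) [1..<Suc (length q)]" by blast+
qed

section \<open>Deletion as a bijection between sets of labelled maps\<close>

type_synonym lm = "(nat \<Rightarrow> nat) \<times> (nat \<Rightarrow> nat) \<times> (nat \<Rightarrow> bool) \<times> (nat \<Rightarrow> nat) \<times> nat"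

definition lmaps :: "nat \<Rightarrow> nat set \<Rightarrow> (bool \<times> nat) list \<Rightarrow> nat multiset \<Rightarrow> lm set" where
  "lmaps p D B m = {(s, e, c, l, r). lmap D s e p c l r \<and> bword s e c l r B \<and> inner p D s e c r = m}"

lemma bwordE:
  assumes "bword s e c l r (z # W)"
  obtains w where "cycl (e \<circ> s) (r # w)" "map (\<lambda>h. (c h, l h)) w = W" "c r = fst z" "l r = snd z"
  using assms unfolding bword_def by (auto)

text \<open>The new root \<open>e (s b)\<close> is the successor of \<open>b\<close> on its face:
  the head of the opened face, or the remaining root face if the edge is a leaf. So one formula
  serves both cases.\<close>

definition edge_del :: "nat \<Rightarrow> nat \<Rightarrow> lm \<Rightarrow> lm" where
  "edge_del a b = (\<lambda>(s, e, c, l, r). (rem b (rem a s), rem a e, c(a := False, b := False), l(a := 0, b := 0), e (s b)))"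

definition face_lmaps :: "nat \<Rightarrow> nat set \<Rightarrow> (bool \<times> nat) list \<Rightarrow> nat multiset \<Rightarrow> nat \<Rightarrow> nat \<Rightarrow> (bool \<times> nat) list \<Rightarrow> lm set" where
  "face_lmaps p D B m a b Q = {(s, e, c, l, r). (s, e, c, l, r) \<in> lmaps p D B m \<and> r = a \<and> e a = b \<and> b \<notin> orbit_of (e \<circ> s) a \<and>
     (\<exists>q. cycl (e \<circ> s) (b # q) \<and> map (\<lambda>h. (c h, l h)) q = Q)}"

lemma face_lmaps_edge_cut:
  assumes "(s, e, c, l, r) \<in> face_lmaps p D ((ca, la) # W) m a b Q" "W \<noteq> []" "Q \<noteq> []"
  obtains w q where "edge_cut D s e a b w q" "lmap D s e p c l a" "r = a" "inner p D s e c a = m" "c a = ca" "l a = la"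
    "c b = (\<not> ca)" "map (\<lambda>h. (c h, l h)) q = Q" "map (\<lambda>h. (c h, l h)) w = W" "l (last q) = la" "l b = snd (last W)"
proof -
  from assms(1) have r: "r = a" and L: "lmap D s e p c l a" and m: "inner p D s e c a = m"
    and bw: "bword s e c l a ((ca, la) # W)" and ab: "e a = b" "b \<notin> orbit_of (e \<circ> s) a"
    and "\<exists>q. cycl (e \<circ> s) (b # q) \<and> map (\<lambda>h. (c h, l h)) q = Q"
    unfolding face_lmaps_def lmaps_def by auto
  then obtain q where q: "cycl (e \<circ> s) (b # q)" "map (\<lambda>h. (c h, l h)) q = Q" by auto
  obtain w where w: "cycl (e \<circ> s) (a # w)" "map (\<lambda>h. (c h, l h)) w = W" "c a = ca" "l a = la"
    using bw by (rule bwordE) auto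
  interpret L: lmap D s e p c l a by fact
  have aD: "a \<in> D" by (rule L.root)
  have bD: "b \<in> D" using aD ab L.e by (auto simp: permutes_in_image)
  have O: "orbit_of (e \<circ> s) a = set (a # w)" "orbit_of (e \<circ> s) b = set (b # q)"
    using cycl_orbit[OF w(1)] cycl_orbit[OF q(1)] by auto
  have disj: "set (a # w) \<inter> set (b # q) = {}" 
    using ab(2) orbit_eq[OF L.phi L.fin] orbit_refl[OF L.phi L.fin] unfolding O[symmetric] by blast
  have ne: "w \<noteq> []" "q \<noteq> []" using w q assms by auto
  interpret E: edge_cut D s e a b w q
    by unfold_locales (use aD bD ab L.fpf[OF aD] w(1) q(1) disj ne in auto)
  have "l (last q) = la" using L.lab[of "last q"] E.s_last w by simp
  moreover have "l b = l (last w)" using L.lab[of "last w"] E.s_last by simp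
  then have "l b = snd (last W)" using w(2) ne by (auto simp: last_map)
  moreover have "c b = (\<not> ca)" using L.col_e[OF aD] ab w by simp
  ultimately show ?thesis using that E.edge_cut_axioms L r m w q by blast
qed

text \<open>The alternatives of \<open>cond\<close> are the two moves that open a face. Behind a
  rise lies a black face, whose labels are forced to climb. Behind a black step lies a white face
  with word \<open>Q\<close>; there the condition on \<open>hd W\<close> provides the fall that
  replaces the lost one.\<close>

lemma edge_bij:
  assumes fin: "finite D" and abD: "a \<in> D" "b \<in> D" "a \<noteq> b" and ne: "W \<noteq> []" "Q \<noteq> []"
    and la: "la = snd (last Q)" and p2: "p \<ge> 2"
    and cond: "ca \<and> la = snd (last W) + (p - 1) \<and> Q = map (\<lambda>j. (False, snd (last W) + j)) [1..<p] \<and> m = m' \<or>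
      \<not> ca \<and> la = snd (last W) + 1 \<and> (\<forall>z\<in>set Q. fst z) \<and> hd W = (True, snd (last W)) \<and> m = add_mset ((length Q + 1) div p) m'"
  shows "bij_betw (edge_del a b) (face_lmaps p D ((ca, la) # W) m a b Q) (lmaps p (D - {a, b}) (Q @ W) m')"
  unfolding bij_betw_def
proof (intro conjI)
  let ?X = "face_lmaps p D ((ca, la) # W) m a b Q"
  show "inj_on (edge_del a b) ?X"
  proof (rule inj_onI)
    fix M1 M2 assume M12: "M1 \<in> ?X" "M2 \<in> ?X" "edge_del a b M1 = edge_del a b M2"
    obtain s1 e1 c1 l1 r1 where M1: "M1 = (s1, e1, c1, l1, r1)" by (cases M1)
    obtain s2 e2 c2 l2 r2 where M2: "M2 = (s2, e2, c2, l2, r2)" by (cases M2)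
    note X1 = M12(1)[unfolded M1] and X2 = M12(2)[unfolded M2] and eq = M12(3)[unfolded M1 M2]
    obtain w1 q1 where 1: "edge_cut D s1 e1 a b w1 q1" "lmap D s1 e1 p c1 l1 a" "r1 = a" "c1 a = ca" "l1 a = la"
      "c1 b = (\<not> ca)" "map (\<lambda>h. (c1 h, l1 h)) q1 = Q" "l1 b = snd (last W)"
      by (rule face_lmaps_edge_cut[OF X1 ne]) auto
    obtain w2 q2 where 2: "edge_cut D s2 e2 a b w2 q2" "lmap D s2 e2 p c2 l2 a" "r2 = a" "c2 a = ca" "l2 a = la"
      "c2 b = (\<not> ca)" "map (\<lambda>h. (c2 h, l2 h)) q2 = Q" "l2 b = snd (last W)"
      by (rule face_lmaps_edge_cut[OF X2 ne]) auto
    interpret E1: edge_cut D s1 e1 a b w1 q1 by fact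
    interpret E2: edge_cut D s2 e2 a b w2 q2 by fact
    have eqs: "rem b (rem a s1) = rem b (rem a s2)" "rem a e1 = rem a e2" 
      "c1(a := False, b := False) = c2(a := False, b := False)" "l1(a := 0, b := 0) = l2(a := 0, b := 0)" "e1 (s1 b) = e2 (s2 b)"
      using eq by (auto simp: edge_del_def)
    \<comment> \<open>Equal roots give equal boundary lists, and the length of \<open>Q\<close>
      fixes where such a list splits into \<open>q\<close> and \<open>w\<close>.\<close>
    have hq: "hd q1 = hd q2" using eqs(5) E1.phi_b E2.phi_b by simp
    have "cycl (rem a e1 \<circ> rem b (rem a s1)) (q1 @ w1)" by (rule E1.cyc')
    moreover have "cycl (rem a e1 \<circ> rem b (rem a s1)) (q2 @ w2)" unfolding eqs by (rule E2.cyc')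
    ultimately have "q1 @ w1 = q2 @ w2"
      using hq E1.qne E2.qne cycl_unique by (metis append_Cons hd_Cons_tl)
    moreover have "length q1 = length q2" using 1(7) 2(7) by (metis length_map)
    ultimately have qw: "q1 = q2" "w1 = w2" by auto
    have "s1 = s2" using E1.ins_cut E2.ins_cut unfolding qw eqs by simp
    moreover have "e1 = e2" using E1.e_cut E2.e_cut unfolding eqs by simp
    moreover have "c1 = c2"
    proof
      fix h show "c1 h = c2 h" using fun_cong[OF eqs(3), of h] 1 2 by (cases "h = a"; cases "h = b") auto
    qed
    moreover have "l1 = l2"
    proof
      fix h show "l1 h = l2 h" using fun_cong[OF eqs(4), of h] 1 2 by (cases "h = a"; cases "h = b") auto
    qed
    ultimately show "M1 = M2" unfolding M1 M2 using 1 2 by simp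
  qed
  have mapq: "map (\<lambda>h. ((c(a := False, b := False)) h, (l(a := 0, b := 0)) h)) xs = map (\<lambda>h. (c h, l h)) xs"
    if "set xs \<subseteq> D - {a, b}" for c :: "nat \<Rightarrow> bool" and l :: "nat \<Rightarrow> nat" and xs
    using that by (auto intro!: map_cong)
  show "edge_del a b ` ?X = lmaps p (D - {a, b}) (Q @ W) m'"
  proof (intro equalityI subsetI)
    fix M assume "M \<in> edge_del a b ` ?X"
    then obtain s e c l r where X: "(s, e, c, l, r) \<in> ?X" and M: "M = edge_del a b (s, e, c, l, r)" by auto
    obtain w q where 1: "edge_cut D s e a b w q" "lmap D s e p c l a" "r = a" "inner p D s e c a = m" "c a = ca" "l a = la"
    "c b = (\<not> ca)" "map (\<lambda>h. (c h, l h)) q = Q" "map (\<lambda>h. (c h, l h)) w = W" "l (last q) = la" "l b = snd (last W)"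
      by (rule face_lmaps_edge_cut[OF X ne]) auto
    interpret E: edge_cut D s e a b w q by fact
    interpret L: lmap D s e p c l a by fact
    have monoq: "c h = c b" if "h \<in> set q" for h
    proof -
      have "fst (c h, l h) = (\<not> ca)" using cond that 1(8) by (metis (no_types, lifting) fst_conv image_eqI imageE list.set_map)
      then show ?thesis using 1(7) by simp
    qed
    have qlen: "length q = length Q" using 1(8) by auto
    \<comment> \<open>A black face is opened only behind a rise. Its other \<open>p - 1\<close>
      darts have to climb by \<open>p - 1\<close>, so each of them reverses a fall.\<close>
    have qstep: "l h = l (e h) + 1" if "h \<in> set q" "\<not> c h" for h
    proof -
      have ca: "ca" using monoq[OF that(1)] that(2) 1(7) by simp
      then have n: "length q = p - 1" "la = l b + (p - 1)" using cond qlen 1(11) by auto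
      have "map (e \<circ> s) (b # q) = q @ [b]" using E.cyc_b by (simp add: cycl_def)
      moreover have "l (last (b # q)) = l b + length q" using 1(10) n E.qne by simp
      ultimately show ?thesis using L.black_chain(2)[of b q b] monoq ca 1(7) E.bD that by blast
    qed
    \<comment> \<open>On a rise neither dart is an outgoing fall. On a black step,
      \<open>s a\<close> is opposite to the first dart of \<open>w\<close> and is another outgoing
      fall at the top vertex.\<close>
    have safe: "(\<forall>g\<in>{a, b}. c g \<or> l (e g) + 1 \<noteq> l g) \<or> c b \<and> \<not> c (s a) \<and> l (e (s a)) + 1 = l (s a)"
    proof (cases ca)
      case True
      have "l (e b) + 1 \<noteq> l b" using cond True E.ba 1(6,11) by auto
      then show ?thesis using True 1(5) by simp
    next
      case False
      have "(c (hd w), l (hd w)) = hd W" using 1(9) E.wne by (metis list.map_sel(1))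
      then have hw: "c (hd w)" "l (hd w) = snd (last W)" using cond False by auto
      have hwD: "hd w \<in> D" using E.w_D' hd_in_set[OF E.wne] by blast
      have "\<not> c (s a)" unfolding E.s_a using L.col_e[OF hwD] hw by simp
      moreover have "l (e (s a)) + 1 = l (s a)" using E.phi_a hw L.lab[of a] 1(6) cond False by simp
      ultimately show ?thesis using False 1(7) by simp
    qed
    have "lmap (D - {a, b}) (rem b (rem a s)) (rem a e) p (c(a := False, b := False)) (l(a := 0, b := 0)) (hd q)"
      using E.cut_lmap[OF 1(2) safe qstep] .
    moreover have "bword (rem b (rem a s)) (rem a e) (c(a := False, b := False)) (l(a := 0, b := 0)) (hd q) (Q @ W)"
      unfolding bword_def
    proof (intro exI conjI)
      have qq: "q = hd q # tl q" using E.qne by simp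
      show "cycl (rem a e \<circ> rem b (rem a s)) (hd q # (tl q @ w))" using E.cyc' qq by (metis append_Cons)
      have "hd q # (tl q @ w) = q @ w" using qq by (metis append_Cons)
      then show "map (\<lambda>h. ((c(a := False, b := False)) h, (l(a := 0, b := 0)) h)) (hd q # (tl q @ w)) = Q @ W"
        using mapq[of q c l] mapq[of w c l] E.q_D' E.w_D' 1(8,9) by (simp only: map_append)
    qed
    moreover have "inner p (D - {a, b}) (rem b (rem a s)) (rem a e) (c(a := False, b := False)) (hd q) = m'"
      using E.inner_cut[of c p, OF monoq] 1(4,7) cond qlen by auto
    ultimately show "M \<in> lmaps p (D - {a, b}) (Q @ W) m'"
      unfolding M edge_del_def lmaps_def using E.phi_b by simp
  next
    fix M assume "M \<in> lmaps p (D - {a, b}) (Q @ W) m'"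
    then obtain t f c0 l0 r0 where M: "M = (t, f, c0, l0, r0)" and L0: "lmap (D - {a, b}) t f p c0 l0 r0"
      and bw: "bword t f c0 l0 r0 (Q @ W)" and in0: "inner p (D - {a, b}) t f c0 r0 = m'"
      unfolding lmaps_def by auto
    interpret L0: lmap "D - {a, b}" t f p c0 l0 r0 by fact
    obtain xs where xs: "cycl (f \<circ> t) (r0 # xs)" "map (\<lambda>h. (c0 h, l0 h)) (r0 # xs) = Q @ W" using bw unfolding bword_def by auto
    obtain q w where qw: "r0 # xs = q @ w" "map (\<lambda>h. (c0 h, l0 h)) q = Q" "map (\<lambda>h. (c0 h, l0 h)) w = W"
      using xs(2) unfolding map_eq_append_conv by blast
    have qwne: "q \<noteq> []" "w \<noteq> []" using qw ne by auto
    have r0: "r0 = hd q" using qw(1) qwne by (metis hd_append2 list.sel(1))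
    have cyc: "cycl (f \<circ> t) (q @ w)" using xs(1) qw(1) by simp
    have sub: "set (q @ w) \<subseteq> D - {a, b}"
      using cycl_orbit[OF cyc, of r0] orbit_subset[OF L0.phi L0.fin L0.root] r0 qwne by simp
    define s where "s = ins a (last q) (ins b (last w) t)"
    define e where "e = f(a := b, b := a)"
    define c where "c = c0(a := ca, b := \<not> ca)"
    define l where "l = l0(a := la, b := snd (last W))"
    have DD: "insert a (insert b (D - {a, b})) = D" using abD by auto
    have "edge_cut (insert a (insert b (D - {a, b}))) s e a b w q" and st: "rem b (rem a s) = t" "rem a e = f"
      unfolding s_def e_def using abD by (auto intro!: edge_insert[OF L0.rotsys_axioms cyc qwne sub])
    then interpret E: edge_cut D s e a b w q unfolding DD by simp
    have c0: "c(a := False, b := False) = c0" and l0: "l(a := 0, b := 0) = l0"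
      unfolding c_def l_def using L0.dflt[of a] L0.dflt[of b] by (auto simp: fun_eq_iff)
    have cl: "c h = c0 h \<and> l h = l0 h" if "h \<in> D - {a, b}" for h using that by (auto simp: c_def l_def)
    have ccb: "c a = ca" "c b = (\<not> ca)" "l a = la" "l b = snd (last W)" using abD by (auto simp: c_def l_def)
    have mq: "map (\<lambda>h. (c h, l h)) q = Q" "map (\<lambda>h. (c h, l h)) w = W"
      using qw(2,3) cl E.q_D' E.w_D' by (auto intro!: map_cong)
    have lq: "l (last q) = la" using la mq(1) qwne by (metis last_map snd_conv)
    have lw: "l (last w) = snd (last W)" using mq(2) qwne by (metis last_map snd_conv)
    have monoq: "c h = c b" if "h \<in> set q" for h
    proof -
      have "fst (c h, l h) = (\<not> ca)" using cond that mq(1) by (metis (no_types, lifting) fst_conv image_eqI imageE list.set_map)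
      then show ?thesis using ccb by simp
    qed
    have qlen: "length q = length Q" using mq by auto
    have LL: "lmap D s e p c l a"
    proof (rule E.uncut_lmap)
      show "lmap (D - {a, b}) (rem b (rem a s)) (rem a e) p (c(a := False, b := False)) (l(a := 0, b := 0)) (hd q)"
        unfolding st c0 l0 using L0 r0 by simp
      show "\<not> c h \<and> l h = 0" if "h \<notin> D" for h
        using that L0.dflt[of h] abD by (auto simp: c_def l_def)
      show "c a \<Longrightarrow> l b = l a + 1 \<or> l a = l b + (p - 1)" using ccb cond by auto
      show "\<not> c a \<Longrightarrow> l a = l b + 1" using ccb cond by auto
      show "c a \<Longrightarrow> length q + 1 = p" using ccb cond qlen p2 by auto
    qed (use ccb lq lw monoq in auto)
    have "inner p D s e c a = m"
      using E.inner_cut[of c p, OF monoq] st c0 in0 r0 cond ccb qlen by auto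
    moreover have "bword s e c l a ((ca, la) # W)"
      unfolding bword_def using E.cyc_a mq(2) ccb by auto
    moreover have "b \<notin> orbit_of (e \<circ> s) a" using E.orb_a E.disj by auto
    ultimately have "(s, e, c, l, a) \<in> ?X"
      unfolding face_lmaps_def lmaps_def using LL E.ab E.cyc_b mq by blast
    moreover have "edge_del a b (s, e, c, l, a) = M"
      unfolding edge_del_def M using st c0 l0 r0 E.phi_b by simp
    ultimately show "M \<in> edge_del a b ` ?X" by (metis image_eqI)
  qed
qed

lemma (in lmap) reroot:
  assumes "r' \<in> orbit_of (e \<circ> s) r"
  shows "lmap D s e p c l r'" "orbit_of (e \<circ> s) r' = orbit_of (e \<circ> s) r" "inner p D s e c r' = inner p D s e c r"
proof -
  show o: "orbit_of (e \<circ> s) r' = orbit_of (e \<circ> s) r" using orbit_eq[OF phi fin assms] .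
  then show "inner p D s e c r' = inner p D s e c r" unfolding inner_def by (simp only:)
  have "r' \<in> D" using orbit_subset[OF phi fin root] assms by blast
  then show "lmap D s e p c l r'"
    by unfold_locales (use fpf col_e dflt lab_s step uniq mono blk rootstep euler in \<open>simp_all only: o not_False_eq_True\<close>)
qed

text \<open>Moves the root one dart along the root face, so that a peeling move may start at any
  letter of the word.\<close>

lemma lmaps_rotate:
  "bij_betw (\<lambda>(s, e, c, l, r). (s, e, c, l, e (s r))) (lmaps p D (x # B) m) (lmaps p D (B @ [x]) m)"
  unfolding bij_betw_def
proof (intro conjI)
  let ?f = "(\<lambda>(s, e, c, l, r). (s, e, c, l, e (s r))) :: lm \<Rightarrow> lm"
  show "inj_on ?f (lmaps p D (x # B) m)"
  proof (rule inj_onI)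
    fix M1 M2 assume M12: "M1 \<in> lmaps p D (x # B) m" "M2 \<in> lmaps p D (x # B) m" "?f M1 = ?f M2"
    obtain s1 e1 c1 l1 r1 where M1: "M1 = (s1, e1, c1, l1, r1)" by (cases M1)
    obtain s2 e2 c2 l2 r2 where M2: "M2 = (s2, e2, c2, l2, r2)" by (cases M2)
    have "lmap D s1 e1 p c1 l1 r1" using M12(1) unfolding M1 lmaps_def by simp
    then interpret lmap D s1 e1 p c1 l1 r1 .
    have "(e1 \<circ> s1) r1 = (e1 \<circ> s1) r2" using M12(3) unfolding M1 M2 by auto
    then have "r1 = r2" using permutes_inj[OF phi] by (rule injD[rotated])
    then show "M1 = M2" using M12(3) unfolding M1 M2 by auto
  qed
  show "?f ` lmaps p D (x # B) m = lmaps p D (B @ [x]) m"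
  proof (intro equalityI subsetI)
    fix M assume "M \<in> ?f ` lmaps p D (x # B) m"
    then obtain s e c l r where M: "M = (s, e, c, l, e (s r))" and L: "lmap D s e p c l r" and bw: "bword s e c l r (x # B)"
      and m: "inner p D s e c r = m" unfolding lmaps_def by auto
    interpret lmap D s e p c l r by fact
    obtain w where w: "cycl (e \<circ> s) (r # w)" "map (\<lambda>h. (c h, l h)) (r # w) = x # B" using bw unfolding bword_def by auto
    have "(e \<circ> s) r \<in> orbit_of (e \<circ> s) r" using orbit_step[OF phi fin] orbit_refl[OF phi fin] by blast
    then have r': "e (s r) \<in> orbit_of (e \<circ> s) r" by simp
    have c1: "cycl (e \<circ> s) (w @ [r])" using cycl_rotate1[OF w(1)] by simp
    have "hd ((e \<circ> s) r # map (e \<circ> s) w) = hd (w @ [r])" using w(1) unfolding cycl_Cons_iff by simp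
    then have hd: "hd (w @ [r]) = e (s r)" by simp
    obtain v where v: "w @ [r] = e (s r) # v" using hd by (cases "w @ [r]") auto
    have "map (\<lambda>h. (c h, l h)) (w @ [r]) = B @ [x]" using w(2) by simp
    then have "bword s e c l (e (s r)) (B @ [x])" unfolding bword_def using c1 unfolding v by blast
    then show "M \<in> lmaps p D (B @ [x]) m" using reroot[OF r'] m unfolding M lmaps_def by simp
  next
    fix M assume "M \<in> lmaps p D (B @ [x]) m"
    then obtain s e c l r where M: "M = (s, e, c, l, r)" and L: "lmap D s e p c l r" and bw: "bword s e c l r (B @ [x])"
      and m: "inner p D s e c r = m" unfolding lmaps_def by auto
    interpret lmap D s e p c l r by fact
    obtain w where w: "cycl (e \<circ> s) (r # w)" "map (\<lambda>h. (c h, l h)) (r # w) = B @ [x]" using bw unfolding bword_def by auto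
    obtain u y where uy: "r # w = u @ [y]" by (cases "r # w" rule: rev_cases) auto
    have c1: "cycl (e \<circ> s) (y # u)" using cycl_append_commute[of "e \<circ> s" u "[y]"] w(1) uy by simp
    have "hd ((e \<circ> s) y # map (e \<circ> s) u) = hd (u @ [y])" using c1 unfolding cycl_Cons_iff by simp
    then have y: "e (s y) = r" unfolding uy[symmetric] by simp
    have "y \<in> set (r # w)" unfolding uy by simp
    then have "y \<in> orbit_of (e \<circ> s) r" using cycl_orbit[OF w(1), of r] by simp
    note rr = reroot[OF this]
    have "map (\<lambda>h. (c h, l h)) u @ [(c y, l y)] = B @ [x]" using w(2) unfolding uy by simp
    then have "map (\<lambda>h. (c h, l h)) (y # u) = x # B" unfolding append1_eq_conv by simp
    with c1 have bwy: "bword s e c l y (x # B)" unfolding bword_def by (intro exI[of _ u] conjI)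
    have A: "(s, e, c, l, y) \<in> lmaps p D (x # B) m"
      unfolding lmaps_def mem_Collect_eq prod.case using rr(1) bwy rr(3)[unfolded m] by (intro conjI)
    have "M = ?f (s, e, c, l, y)" unfolding M using y by simp
    then show "M \<in> ?f ` lmaps p D (x # B) m" using A by (rule image_eqI)
  qed
qed

definition leaf_lmaps :: "nat \<Rightarrow> nat set \<Rightarrow> (bool \<times> nat) list \<Rightarrow> nat multiset \<Rightarrow> nat \<Rightarrow> nat \<Rightarrow> lm set" where
  "leaf_lmaps p D B m a b = {(s, e, c, l, r). (s, e, c, l, r) \<in> lmaps p D B m \<and> r = a \<and> e a = b \<and> s a = a}"

lemma leaf_lmapsE:
  assumes "(s, e, c, l, r) \<in> leaf_lmaps p D ((False, la) # (True, lb) # W) m a b"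
  obtains w where "lmap D s e p c l a" "r = a" "inner p D s e c a = m" "e a = b" "s a = a" "\<not> c a" "c b" "l a = la" "l b = lb"
    "cycl (e \<circ> s) (a # b # w)" "map (\<lambda>h. (c h, l h)) w = W"
proof -
  from assms have r: "r = a" and L: "lmap D s e p c l a" and m: "inner p D s e c a = m"
    and bw: "bword s e c l a ((False, la) # (True, lb) # W)" and ab: "e a = b" "s a = a"
    unfolding leaf_lmaps_def lmaps_def by auto
  obtain v where v: "cycl (e \<circ> s) (a # v)" "map (\<lambda>h. (c h, l h)) v = (True, lb) # W" "\<not> c a" "l a = la"
    using bw by (rule bwordE) auto
  obtain x w where vw: "v = x # w" using v(2) by (cases v) auto
  have "hd ((e \<circ> s) a # map (e \<circ> s) v) = hd (v @ [a])" using v(1) unfolding cycl_Cons_iff by simp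
  then have "x = b" using ab vw by simp
  then show ?thesis using that[of w] L r m ab v vw by auto
qed

lemma leaf_bij:
  assumes fin: "finite D" and abD: "a \<in> D" "b \<in> D" "a \<noteq> b" and ne: "W \<noteq> []"
    and lb: "lb = snd (last W)" and la: "la = lb + 1"
  shows "bij_betw (edge_del a b) (leaf_lmaps p D ((False, la) # (True, lb) # W) m a b) (lmaps p (D - {a, b}) W m)"
  unfolding bij_betw_def
proof (intro conjI)
  let ?X = "leaf_lmaps p D ((False, la) # (True, lb) # W) m a b"
  have leaf: "leaf_cut D s e a b w" if "lmap D s e p c l a" "e a = b" "s a = a" "cycl (e \<circ> s) (a # b # w)" 
    "map (\<lambda>h. (c h, l h)) w = W" for s e c l w
  proof -
    interpret lmap D s e p c l a by fact
    show ?thesis by unfold_locales (use abD that ne in auto)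
  qed
  show "inj_on (edge_del a b) ?X"
  proof (rule inj_onI)
    fix M1 M2 assume M12: "M1 \<in> ?X" "M2 \<in> ?X" "edge_del a b M1 = edge_del a b M2"
    obtain s1 e1 c1 l1 r1 where M1: "M1 = (s1, e1, c1, l1, r1)" by (cases M1)
    obtain s2 e2 c2 l2 r2 where M2: "M2 = (s2, e2, c2, l2, r2)" by (cases M2)
    note X1 = M12(1)[unfolded M1] and X2 = M12(2)[unfolded M2] and eq = M12(3)[unfolded M1 M2]
    obtain w1 where 1: "lmap D s1 e1 p c1 l1 a" "r1 = a" "e1 a = b" "s1 a = a" "\<not> c1 a" "c1 b" "l1 a = la" "l1 b = lb"
      "cycl (e1 \<circ> s1) (a # b # w1)" "map (\<lambda>h. (c1 h, l1 h)) w1 = W"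
      by (rule leaf_lmapsE[OF X1]) auto
    obtain w2 where 2: "lmap D s2 e2 p c2 l2 a" "r2 = a" "e2 a = b" "s2 a = a" "\<not> c2 a" "c2 b" "l2 a = la" "l2 b = lb"
      "cycl (e2 \<circ> s2) (a # b # w2)" "map (\<lambda>h. (c2 h, l2 h)) w2 = W"
      by (rule leaf_lmapsE[OF X2]) auto
    interpret E1: leaf_cut D s1 e1 a b w1 by (rule leaf[OF 1(1,3,4,9,10)])
    interpret E2: leaf_cut D s2 e2 a b w2 by (rule leaf[OF 2(1,3,4,9,10)])
    have eqs: "rem b (rem a s1) = rem b (rem a s2)" "rem a e1 = rem a e2" 
      "c1(a := False, b := False) = c2(a := False, b := False)" "l1(a := 0, b := 0) = l2(a := 0, b := 0)" "e1 (s1 b) = e2 (s2 b)"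
      using eq by (auto simp: edge_del_def)
    have hq: "hd w1 = hd w2" using eqs(5) E1.phi_b E2.phi_b by simp
    have "cycl (rem a e1 \<circ> rem b (rem a s1)) w1" by (rule E1.cyc')
    moreover have "cycl (rem a e1 \<circ> rem b (rem a s1)) w2" unfolding eqs by (rule E2.cyc')
    ultimately have w: "w1 = w2"
      using hq E1.wne E2.wne cycl_unique by (metis hd_Cons_tl)
    have "s1 = s2" using E1.ins_cut E2.ins_cut unfolding w eqs by simp
    moreover have "e1 = e2" using E1.e_cut E2.e_cut unfolding eqs by simp
    moreover have "c1 = c2"
    proof
      fix h show "c1 h = c2 h" using fun_cong[OF eqs(3), of h] 1 2 by (cases "h = a"; cases "h = b") auto
    qed
    moreover have "l1 = l2"
    proof
      fix h show "l1 h = l2 h" using fun_cong[OF eqs(4), of h] 1 2 by (cases "h = a"; cases "h = b") auto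
    qed
    ultimately show "M1 = M2" unfolding M1 M2 using 1 2 by simp
  qed
  show "edge_del a b ` ?X = lmaps p (D - {a, b}) W m"
  proof (intro equalityI subsetI)
    fix M assume "M \<in> edge_del a b ` ?X"
    then obtain s e c l r where X: "(s, e, c, l, r) \<in> ?X" and M: "M = edge_del a b (s, e, c, l, r)" by auto
    obtain w where 1: "lmap D s e p c l a" "r = a" "inner p D s e c a = m" "e a = b" "s a = a" "\<not> c a" "c b" "l a = la" "l b = lb"
      "cycl (e \<circ> s) (a # b # w)" "map (\<lambda>h. (c h, l h)) w = W"
      by (rule leaf_lmapsE[OF X]) auto
    interpret E: leaf_cut D s e a b w by (rule leaf[OF 1(1,4,5,10,11)])
    have "lmap (D - {a, b}) (rem b (rem a s)) (rem a e) p (c(a := False, b := False)) (l(a := 0, b := 0)) (hd w)"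
      using E.cut_lmap[OF 1(1,7)] .
    moreover have "bword (rem b (rem a s)) (rem a e) (c(a := False, b := False)) (l(a := 0, b := 0)) (hd w) W"
      unfolding bword_def
    proof (intro exI conjI)
      have ww: "w = hd w # tl w" using E.wne by simp
      show "cycl (rem a e \<circ> rem b (rem a s)) (hd w # tl w)" using E.cyc' ww by simp
      have "map (\<lambda>h. ((c(a := False, b := False)) h, (l(a := 0, b := 0)) h)) w = map (\<lambda>h. (c h, l h)) w"
        using E.w_D' by (intro map_cong) auto
      then show "map (\<lambda>h. ((c(a := False, b := False)) h, (l(a := 0, b := 0)) h)) (hd w # tl w) = W"
        using 1(11) ww by simp
    qed
    moreover have "inner p (D - {a, b}) (rem b (rem a s)) (rem a e) (c(a := False, b := False)) (hd w) = m"
      using E.inner_cut[of p c] 1(3) by simp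
    ultimately show "M \<in> lmaps p (D - {a, b}) W m"
      unfolding M edge_del_def lmaps_def using E.phi_b by simp
  next
    fix M assume "M \<in> lmaps p (D - {a, b}) W m"
    then obtain t f c0 l0 r0 where M: "M = (t, f, c0, l0, r0)" and L0: "lmap (D - {a, b}) t f p c0 l0 r0"
      and bw: "bword t f c0 l0 r0 W" and in0: "inner p (D - {a, b}) t f c0 r0 = m"
      unfolding lmaps_def by auto
    interpret L0: lmap "D - {a, b}" t f p c0 l0 r0 by fact
    obtain xs where xs: "cycl (f \<circ> t) (r0 # xs)" "map (\<lambda>h. (c0 h, l0 h)) (r0 # xs) = W" using bw unfolding bword_def by auto
    define w where "w = r0 # xs"
    have wne: "w \<noteq> []" and r0: "r0 = hd w" and cyc: "cycl (f \<circ> t) w" and mw: "map (\<lambda>h. (c0 h, l0 h)) w = W"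
      using xs unfolding w_def by auto
    have sub: "set w \<subseteq> D - {a, b}"
      using cycl_orbit[OF cyc, of r0] orbit_subset[OF L0.phi L0.fin L0.root] r0 wne by simp
    define s where "s = ins b (last w) t"
    define e where "e = f(a := b, b := a)"
    define c where "c = c0(a := False, b := True)"
    define l where "l = l0(a := la, b := lb)"
    have DD: "insert a (insert b (D - {a, b})) = D" using abD by auto
    have "leaf_cut (insert a (insert b (D - {a, b}))) s e a b w" and st: "rem b (rem a s) = t" "rem a e = f"
      unfolding s_def e_def using abD by (auto intro!: leaf_insert[OF L0.rotsys_axioms cyc wne sub])
    then interpret E: leaf_cut D s e a b w unfolding DD by simp
    have c0: "c(a := False, b := False) = c0" and l0: "l(a := 0, b := 0) = l0"
      unfolding c_def l_def using L0.dflt[of a] L0.dflt[of b] by (auto simp: fun_eq_iff)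
    have cl: "c h = c0 h \<and> l h = l0 h" if "h \<in> D - {a, b}" for h using that by (auto simp: c_def l_def)
    have ccb: "\<not> c a" "c b" "l a = la" "l b = lb" using abD by (auto simp: c_def l_def)
    have mq: "map (\<lambda>h. (c h, l h)) w = W"
      using mw cl E.w_D' by (auto intro!: map_cong)
    have lw: "l (last w) = lb" using mq wne lb by (metis last_map snd_conv)
    have LL: "lmap D s e p c l a"
    proof (rule E.uncut_lmap)
      show "lmap (D - {a, b}) (rem b (rem a s)) (rem a e) p (c(a := False, b := False)) (l(a := 0, b := 0)) (hd w)"
        unfolding st c0 l0 using L0 r0 by simp
      show "\<not> c h \<and> l h = 0" if "h \<notin> D" for h
        using that L0.dflt[of h] abD by (auto simp: c_def l_def)
    qed (use ccb la lw in auto)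
    have "inner p D s e c a = m"
      using E.inner_cut[of p c] st c0 in0 r0 by simp
    moreover have "bword s e c l a ((False, la) # (True, lb) # W)"
      unfolding bword_def using E.cyc mq ccb by (intro exI[of _ "b # w"]) auto
    ultimately have "(s, e, c, l, a) \<in> ?X"
      unfolding leaf_lmaps_def lmaps_def using LL E.ab E.sa by blast
    moreover have "edge_del a b (s, e, c, l, a) = M"
      unfolding edge_del_def M using st c0 l0 r0 E.phi_b by simp
    ultimately show "M \<in> edge_del a b ` ?X" by (metis image_eqI)
  qed
qed

text \<open>When the word ends after these two letters, \<open>b\<close> is the only dart of its
  vertex and a sink. Any dart besides \<open>a\<close> and \<open>b\<close> with minimal label would
  sit at a second sink.\<close>

lemma single_edge_forced:
  assumes "(s, e, c, l, r) \<in> leaf_lmaps p D [(False, la), (True, lb)] m a b" 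
  shows "D = {a, b} \<and> m = {#} \<and> s = id \<and> e = transpose a b \<and> c = (\<lambda>x. x = b) \<and> l = (\<lambda>x. if x = a then la else if x = b then lb else 0) \<and> r = a"
proof -
  obtain w where "lmap D s e p c l a" and ra: "r = a" and m: "inner p D s e c a = m" and 1: "e a = b" "s a = a" "\<not> c a" "c b" "l a = la" "l b = lb"
    and "cycl (e \<circ> s) (a # b # w)" "map (\<lambda>h. (c h, l h)) w = []"
    by (rule leaf_lmapsE[OF assms]) auto
  then have cy: "cycl (e \<circ> s) [a, b]" by simp
  interpret lmap D s e p c l a by fact
  have aD: "a \<in> D" by (rule root)
  have bD: "b \<in> D" using aD 1 by (metis e permutes_in_image)
  have ba: "e b = a" using inv 1 by metis
  have ne: "a \<noteq> b" using fpf[OF aD] 1 by simp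
  have "e (s b) = a" using cy by (simp add: cycl_def)
  then have sb: "s b = b" using inv 1 by metis
  have Dab: "D = {a, b}"
  proof (rule ccontr)
    assume "D \<noteq> {a, b}"
    then have "D - {a, b} \<noteq> {}" "finite (D - {a, b})" using aD bD fin by auto
    then have "Min (l ` (D - {a, b})) \<in> l ` (D - {a, b})" by (intro Min_in) auto
    then obtain h where h: "h \<in> D - {a, b}" "Min (l ` (D - {a, b})) = l h" by blast
    have mn: "l h \<le> l g" if "g \<in> D - {a, b}" for g
      using that \<open>finite (D - {a, b})\<close> unfolding h(2)[symmetric] by (intro Min_le) auto
    have oh: "g \<in> D - {a, b} \<and> l g = l h" if "g \<in> orbit_of s h" for g
      using that
    proof (rule orbit_induct[OF s fin])
      fix z assume z: "z \<in> D - {a, b} \<and> l z = l h"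
      then have "s z \<noteq> a" "s z \<noteq> b" using 1 sb permutes_inj[OF s] by (metis DiffE injD insertI1 insertI2)+
      then show "s z \<in> D - {a, b} \<and> l (s z) = l h" using z lab by (simp add: permutes_in_image[OF s])
    qed (use h in simp)
    have "sink s e c l h"
      unfolding sink_def
    proof
      fix g assume "g \<in> orbit_of s h"
      then have g: "g \<in> D - {a, b}" "l g = l h" using oh by auto
      have "e g \<noteq> a" "e g \<noteq> b" using g inv 1 ba by (metis DiffE insertI1 insertI2)+
      then have "e g \<in> D - {a, b}" using g by (simp add: permutes_in_image[OF e])
      then show "c g \<or> l (e g) + 1 \<noteq> l g" using mn g by fastforce
    qed
    moreover have "sink s e c l b" unfolding sink_def using orbit_fixed[OF s fin sb] 1 by simp
    ultimately have "h \<in> orbit_of s b" using uniq h bD by blast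
    then show False using orbit_fixed[OF s fin sb] h by auto
  qed
  have W: "wfaces D s e c - {orbit_of (e \<circ> s) a} = {}"
  proof -
    have "orbit_of (e \<circ> s) h = orbit_of (e \<circ> s) a" if "h \<in> D" for h
      using that cycl_orbit[OF cy] unfolding Dab by auto
    then show ?thesis unfolding wfaces_def by blast
  qed
  have "m = {#}" using m unfolding inner_def W by simp
  moreover have "s = id"
  proof
    fix x show "s x = id x" using 1 sb s Dab unfolding permutes_def by (cases "x = a"; cases "x = b") auto
  qed
  moreover have "e = transpose a b"
  proof
    fix x show "e x = transpose a b x" using 1 ba e Dab unfolding permutes_def
      by (cases "x = a"; cases "x = b") (auto simp: transpose_def)
  qed
  moreover have "c = (\<lambda>x. x = b)"
  proof
    fix x show "c x = (x = b)" using 1 dflt[of x] Dab by (cases "x = a"; cases "x = b") auto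
  qed
  moreover have "l = (\<lambda>x. if x = a then la else if x = b then lb else 0)"
  proof
    fix x show "l x = (if x = a then la else if x = b then lb else 0)" using 1 dflt[of x] Dab by (cases "x = a"; cases "x = b") auto
  qed
  ultimately show ?thesis using Dab ra by blast
qed

lemma single_edge_exists:
  assumes ne: "a \<noteq> b" and la: "la = lb + 1"
  shows "(id, transpose a b, (\<lambda>x. x = b), (\<lambda>x. if x = a then la else if x = b then lb else 0), a) \<in> leaf_lmaps p {a, b} [(False, la), (True, lb)] {#} a b"
proof -
  let ?e = "transpose a b" and ?c = "\<lambda>x. x = b" and ?l = "\<lambda>x. if x = a then la else if x = b then lb else 0" and ?D = "{a, b}"
  have cy: "cycl (?e \<circ> id) [a, b]" using ne by (simp add: cycl_def)
  have orb: "orbit_of (?e \<circ> id) x = {a, b}" if "x \<in> {a, b}" for x using cycl_orbit[OF cy] that by auto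
  have orbid: "orbit_of id x = {x}" for x using orbit_fixed[of id "{x}" x] permutes_id by auto
  have L: "lmap ?D id ?e p ?c ?l a"
  proof
    show "?e permutes ?D" by (rule permutes_swap_id) auto
    show "2 * (norb id ?D + norb (?e \<circ> id) ?D) = card ?D + 4"
    proof -
      have "norb id ?D = 2" unfolding norb_def using ne orbid by (simp add: card_insert_if)
      moreover have "norb (?e \<circ> id) ?D = 1" using norb_cycl[OF cy] by simp
      ultimately show ?thesis using ne by simp
    qed
    show "h' \<in> orbit_of id h" if "h \<in> ?D" "h' \<in> ?D" "sink id ?e ?c ?l h" "sink id ?e ?c ?l h'" for h h'
    proof -
      have "\<not> sink id ?e ?c ?l a" unfolding sink_def orbid using ne la by simp
      then show ?thesis using that orbid by auto
    qed
  qed (use ne la orb permutes_id in \<open>auto simp: fun_eq_iff transpose_def split: if_splits\<close>)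
  have "bword id ?e ?c ?l a [(False, la), (True, lb)]"
    unfolding bword_def using cy ne by (intro exI[of _ "[b]"]) auto
  moreover have W: "wfaces ?D id ?e ?c - {orbit_of (?e \<circ> id) a} = {}"
    using orb unfolding wfaces_def by auto
  have "inner p ?D id ?e ?c a = {#}" unfolding inner_def W by simp
  ultimately show ?thesis unfolding leaf_lmaps_def lmaps_def using L by simp
qed

lemma single_edge_card:
  assumes ne: "a \<noteq> b" and la: "la = lb + 1"
  shows "finite (leaf_lmaps p D [(False, la), (True, lb)] m a b)"
    and "card (leaf_lmaps p D [(False, la), (True, lb)] m a b) = (if D = {a, b} \<and> m = {#} then 1 else 0)"
proof -
  let ?M = "(id, transpose a b, (\<lambda>x. x = b), (\<lambda>x. if x = a then la else if x = b then lb else 0), a) :: lm"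
  have sub: "leaf_lmaps p D [(False, la), (True, lb)] m a b \<subseteq> {?M}"
  proof
    fix M assume M: "M \<in> leaf_lmaps p D [(False, la), (True, lb)] m a b"
    obtain s e c l r where "M = (s, e, c, l, r)" by (cases M)
    then show "M \<in> {?M}" using single_edge_forced[of s e c l r p D la lb m a b] M by simp
  qed
  then show "finite (leaf_lmaps p D [(False, la), (True, lb)] m a b)" by (rule finite_subset) simp
  show "card (leaf_lmaps p D [(False, la), (True, lb)] m a b) = (if D = {a, b} \<and> m = {#} then 1 else 0)"
  proof (cases "D = {a, b} \<and> m = {#}")
    case True
    then have "leaf_lmaps p D [(False, la), (True, lb)] m a b = {?M}" using sub single_edge_exists[OF assms, of p] by auto
    then show ?thesis using True by simp
  next
    case False
    have "leaf_lmaps p D [(False, la), (True, lb)] m a b = {}"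
    proof (rule ccontr)
      assume "leaf_lmaps p D [(False, la), (True, lb)] m a b \<noteq> {}"
      then obtain M where M: "M \<in> leaf_lmaps p D [(False, la), (True, lb)] m a b" by blast
      obtain s e c l r where "M = (s, e, c, l, r)" by (cases M)
      then show False using single_edge_forced[of s e c l r p D la lb m a b] M False by simp
    qed
    then show ?thesis using False by simp
  qed
qed

section \<open>Peeling recursions\<close>

text \<open>A white step follows the orientation of its edge and may be a fall or a rise; a black
  step runs against the orientation, and on the boundary it only reverses falls.\<close>

fun okw :: "nat \<Rightarrow> nat \<Rightarrow> bool \<times> nat \<Rightarrow> bool" where
  "okw p x (c, y) = (if c then x = y + 1 \<or> y = x + (p - 1) else y = x + 1)"

fun walk :: "nat \<Rightarrow> nat \<Rightarrow> (bool \<times> nat) list \<Rightarrow> bool" where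
  "walk p x [] = True"
| "walk p x (z # B) = (okw p x z \<and> walk p (snd z) B)"

fun endl :: "nat \<Rightarrow> (bool \<times> nat) list \<Rightarrow> nat" where
  "endl x [] = x"
| "endl x (z # B) = endl (snd z) B"

lemma endl_eq: "endl x B = (if B = [] then x else snd (last B))"
  by (induction B arbitrary: x) auto

lemma endl_append [simp]: "endl x (A @ B) = endl (endl x A) B"
  by (induction A arbitrary: x) auto

lemma walk_append [simp]: "walk p x (A @ B) \<longleftrightarrow> walk p x A \<and> walk p (endl x A) B"
  by (induction A arbitrary: x) auto

text \<open>Label plus number of steps is unchanged by a fall and grows by \<open>p\<close> with a
  rise. For a closed word this is why white degrees are multiples of \<open>p\<close>.\<close>

lemma white_len:
  assumes "walk p x Q" "\<forall>z\<in>set Q. fst z" "p \<ge> 1"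
  shows "\<exists>k. endl x Q + length Q = x + k * p"
  using assms
proof (induction Q arbitrary: x)
  case Nil then show ?case by (intro exI[of _ 0]) simp
next
  case (Cons z Q)
  obtain y where z: "z = (True, y)" using Cons.prems by (cases z) auto
  obtain k where k: "endl y Q + length Q = y + k * p" using Cons.IH[of y] Cons.prems z by auto
  have "x = y + 1 \<or> y = x + (p - 1)" using Cons.prems z by simp
  then show ?case
  proof
    assume "x = y + 1" then show ?thesis using k z by (intro exI[of _ k]) simp
  next
    assume "y = x + (p - 1)" then show ?thesis using k z Cons.prems(3) by (intro exI[of _ "Suc k"]) simp
  qed
qed

text \<open>Preceded by the fall from \<open>x + 1\<close> to \<open>x\<close>, such a word runs
  once around a white face. That fall belongs to the peeled edge, which explains the degree
  \<open>length Q + 1\<close>.\<close>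

definition face_words :: "nat \<Rightarrow> nat \<Rightarrow> (bool \<times> nat) list set" where
  "face_words p x = {Q. (\<forall>z\<in>set Q. fst z) \<and> walk p x Q \<and> endl x Q = x + 1}"

definition face_weight :: "nat \<Rightarrow> (bool \<times> nat) list \<Rightarrow> nat" where
  "face_weight p Q = (length Q + 1) div p"

text \<open>Restricting to degrees that occur in \<open>m\<close> makes the set finite, so that it
  can index sums.\<close>

definition inner_face_words :: "nat \<Rightarrow> nat \<Rightarrow> nat multiset \<Rightarrow> (bool \<times> nat) list set" where
  "inner_face_words p x m = {Q \<in> face_words p x. face_weight p Q \<in># m}"

lemma face_words_length:
  assumes "Q \<in> face_words p x" "p \<ge> 2" shows "length Q + 1 = face_weight p Q * p" "face_weight p Q \<ge> 1" "Q \<noteq> []"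
proof -
  obtain k where k: "endl x Q + length Q = x + k * p" using white_len[of p x Q] assms unfolding face_words_def by auto
  then have "length Q + 1 = k * p" using assms unfolding face_words_def by simp
  then show 1: "length Q + 1 = face_weight p Q * p" using assms(2) unfolding face_weight_def by simp
  then show "face_weight p Q \<ge> 1" by (cases "face_weight p Q") auto
  show "Q \<noteq> []" using assms unfolding face_words_def by auto
qed

lemma finite_walks: "finite {B. length B = n \<and> walk p x B}"
proof (induction n arbitrary: x)
  case 0
  have "{B. length B = 0 \<and> walk p x B} \<subseteq> {[]}" by auto
  then show ?case by (rule finite_subset) simp
next
  case (Suc n)
  let ?Z = "{(True, x - 1), (True, x + (p - 1)), (False, x + 1)}"
  have "{B. length B = Suc n \<and> walk p x B} \<subseteq> (\<Union>z\<in>?Z. (\<lambda>B. z # B) ` {B. length B = n \<and> walk p (snd z) B})"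
  proof
    fix B assume "B \<in> {B. length B = Suc n \<and> walk p x B}"
    then obtain c y B' where B: "B = (c, y) # B'" "length B' = n" "walk p y B'" "okw p x (c, y)" by (cases B) auto
    then have Z: "(c, y) \<in> ?Z" by (auto split: if_splits)
    show "B \<in> (\<Union>z\<in>?Z. (\<lambda>B. z # B) ` {B. length B = n \<and> walk p (snd z) B})"
      unfolding B(1) by (rule UN_I[OF Z], rule imageI) (use B(2,3) in simp)
  qed
  then show ?case by (rule finite_subset) (use Suc.IH in auto)
qed

lemma finite_inner_face_words: assumes "p \<ge> 2" shows "finite (inner_face_words p x m)"
proof -
  have "inner_face_words p x m \<subseteq> (\<Union>k\<in>set_mset m. {B. length B = k * p - 1 \<and> walk p x B})"
  proof
    fix Q assume Q: "Q \<in> inner_face_words p x m"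
    then have "Q \<in> face_words p x" by (simp add: inner_face_words_def)
    from face_words_length(1)[OF this assms] have "length Q = face_weight p Q * p - 1" by simp
    then show "Q \<in> (\<Union>k\<in>set_mset m. {B. length B = k * p - 1 \<and> walk p x B})" using Q unfolding inner_face_words_def face_words_def by auto
  qed
  then show ?thesis by (rule finite_subset) (use finite_walks in auto)
qed

section \<open>The face behind the root edge\<close>

context lmap
begin

lemma boundary_walk:
  assumes "map (e \<circ> s) (y # q) = q @ [z]" "y \<in> D" "\<And>h. h \<in> set q \<Longrightarrow> c h \<or> l h = l (e h) + 1"
  shows "walk p (l y) (map (\<lambda>h. (c h, l h)) q)"
  using assms
proof (induction q arbitrary: y)
  case (Cons h q)
  have "(e \<circ> s) y = h" "map (e \<circ> s) (h # q) = q @ [z]"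
    using Cons.prems(1) by (simp_all only: list.map list.inject append_Cons)
  then have h: "h = e (s y)" "map (e \<circ> s) (h # q) = q @ [z]" by (simp, blast)
  have hD: "h \<in> D" using h(1) Cons.prems(2) phi_D by simp
  have eh: "l (e h) = l y" unfolding h(1) by (rule lab_e_phi)
  have "walk p (l h) (map (\<lambda>h. (c h, l h)) q)"
    by (rule Cons.IH[OF h(2) hD]) (use Cons.prems(3) in simp)
  moreover have "okw p (l y) (c h, l h)" using step[OF hD] Cons.prems(3)[of h] unfolding eh by auto
  ultimately show ?case by simp
qed simp

lemma last_label:
  assumes "cycl (e \<circ> s) (y # q)" shows "l (e y) = l (last (y # q))" "s (last (y # q)) = e y"
proof -
  have "map (e \<circ> s) (y # q) = q @ [y]" using assms by (simp add: cycl_def)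
  then have "last (map (e \<circ> s) (y # q)) = y" by (metis last_snoc)
  then have "e (s (last (y # q))) = y" by (subst (asm) last_map) auto
  then show s: "s (last (y # q)) = e y" using inv[of "s (last (y # q))"] by simp
  show "l (e y) = l (last (y # q))" unfolding s[symmetric] by (rule lab)
qed

lemma root_label:
  assumes "bword s e c l r B" shows "l (e r) = snd (last B)"
proof -
  obtain w where w: "cycl (e \<circ> s) (r # w)" "map (\<lambda>h. (c h, l h)) (r # w) = B" using assms unfolding bword_def by auto
  have "snd (last B) = l (last (r # w))" unfolding w(2)[symmetric] by (subst last_map) auto
  then show ?thesis using last_label[OF w(1)] by simp
qed

lemma face_mono:
  assumes "b \<in> D" "b \<notin> orbit_of (e \<circ> s) r" "h \<in> orbit_of (e \<circ> s) b" shows "c h = c b"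
  using assms(3)
proof (rule orbit_induct[OF phi fin])
  fix z assume z: "z \<in> orbit_of (e \<circ> s) b" "c z = c b"
  have "z \<in> D" using z orbit_subset[OF phi fin assms(1)] by blast
  moreover have "z \<notin> orbit_of (e \<circ> s) r" using z assms(2) orbit_eq[OF phi fin] orbit_refl[OF phi fin] by metis
  ultimately show "c ((e \<circ> s) z) = c b" using mono z by simp
qed simp

lemma face_cycle:
  assumes "b \<in> D" "b \<notin> orbit_of (e \<circ> s) r"
  obtains q where "cycl (e \<circ> s) (b # q)" "\<forall>h\<in>set q. c h = c b" "map (e \<circ> s) (b # q) = q @ [b]"
    "orbit_of (e \<circ> s) b = set (b # q)" "card (orbit_of (e \<circ> s) b) = length q + 1"
proof -
  obtain q where q: "cycl (e \<circ> s) (b # q)" using cycl_exists[OF phi fin] by blast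
  have o: "orbit_of (e \<circ> s) b = set (b # q)" using cycl_orbit[OF q] by simp
  have "distinct (b # q)" using q by (simp add: cycl_def)
  then have "card (set (b # q)) = length (b # q)" by (rule distinct_card)
  then have k: "card (orbit_of (e \<circ> s) b) = length q + 1" unfolding o by simp
  have m: "\<forall>h\<in>set q. c h = c b"
  proof
    fix h assume "h \<in> set q"
    then have "h \<in> orbit_of (e \<circ> s) b" unfolding o by simp
    then show "c h = c b" by (rule face_mono[OF assms])
  qed
  have "map (e \<circ> s) (b # q) = q @ [b]" using q by (simp only: cycl_def rotate1.simps)
  from that[OF q m this o k] show ?thesis .
qed

lemma planar_all: "norb s D + norb e D + norb (e \<circ> s) D = card D + 2"
proof -
  have "{h \<in> D. e h \<noteq> h} = D" using fpf by blast
  then have "norb e D + card D div 2 = card D" "even (card D)" using norb_invol[OF fin e inv] by simp_all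
  then show ?thesis using euler by (elim evenE) simp
qed

text \<open>If the top vertex had a second dart, \<open>s r\<close> would be a fall that survives
  the removal of the root edge. Then all local minima after the cut are sinks, hence at one vertex,
  and \<open>planar_distinct_faces\<close> puts different faces on the two sides.\<close>

lemma peak_leaf:
  assumes r: "\<not> c r" "l (e (s r)) + 1 = l r" "l (e r) + 1 = l r" and same: "e r \<in> orbit_of (e \<circ> s) r"
  shows "s r = r"
proof (rule ccontr)
  assume ne: "s r \<noteq> r"
  have sink: "sink s e c l h" if h: "locmin s (cut r e) l h" for h
    unfolding sink_def
  proof
    fix g assume g: "g \<in> orbit_of s h"
    have *: "\<not> l (e k) < l k" if "k \<in> orbit_of s h" "k \<noteq> r" "k \<noteq> e r" for k
      using h that unfolding locmin_cut by blast
    consider "g = r" | "g = e r" | "g \<noteq> r" "g \<noteq> e r" by blast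
    then show "c g \<or> l (e g) + 1 \<noteq> l g"
    proof cases
      case 1
      then have "s r \<in> orbit_of s h" using g orbit_step[OF s fin] by blast
      moreover have "s r \<noteq> e r" using lab[of r] r by auto
      ultimately show ?thesis using *[of "s r"] ne lab[of r] r by simp
    next
      case 2
      then show ?thesis using col_e[OF root] r by simp
    next
      case 3
      then show ?thesis using *[OF g] by auto
    qed
  qed
  have "e r \<notin> orbit_of (e \<circ> s) r"
    using uniq sink by (intro planar_distinct_faces[OF rotsys_axioms lab_s planar_all root fpf[OF root]]) blast
  then show False using same by simp
qed

end

text \<open>Root dart and opposite dart of the peeled edge; the number of choices is the ratio of
  \<open>fact (card D)\<close> to \<open>fact (card D - 2)\<close>.\<close>

definition pairs :: "nat set \<Rightarrow> (nat \<times> nat) set" where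
  "pairs D = {(a, b). a \<in> D \<and> b \<in> D \<and> a \<noteq> b}"

lemma pairs_finite: "finite D \<Longrightarrow> finite (pairs D)"
  unfolding pairs_def by (rule finite_subset[of _ "D \<times> D"]) auto

lemma pairs_card: assumes "finite D" shows "card (pairs D) = card D * (card D - 1)"
proof -
  have "pairs D = (SIGMA a:D. D - {a})" unfolding pairs_def by auto
  then show ?thesis using assms by (simp add: card_SigmaI)
qed

lemma lmaps_rise:
  assumes p: "p \<ge> 2" and fin: "finite D" and W: "W \<noteq> []" and la: "la = snd (last W) + (p - 1)"
    and IH: "\<And>a b. a \<in> D \<Longrightarrow> b \<in> D \<Longrightarrow> a \<noteq> b \<Longrightarrow>
      finite (lmaps p (D - {a, b}) (map (\<lambda>j. (False, snd (last W) + j)) [1..<p] @ W) m) \<and>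
      card (lmaps p (D - {a, b}) (map (\<lambda>j. (False, snd (last W) + j)) [1..<p] @ W) m) = N"
  shows "finite (lmaps p D ((True, la) # W) m) \<and> card (lmaps p D ((True, la) # W) m) = card D * (card D - 1) * N"
proof -
  let ?B = "(True, la) # W" and ?Q = "map (\<lambda>j. (False, snd (last W) + j)) [1..<p]"
  let ?X = "\<lambda>(a, b). face_lmaps p D ?B m a b ?Q"
  have Qne: "?Q \<noteq> []" using p by simp
  have lastQ: "la = snd (last ?Q)" using p la Qne by (simp add: last_map)
  have X: "finite (?X ab) \<and> card (?X ab) = N" if abP: "ab \<in> pairs D" for ab
  proof -
    obtain a b where ab: "ab = (a, b)" "a \<in> D" "b \<in> D" "a \<noteq> b" using abP unfolding pairs_def by (cases ab) auto
    have "bij_betw (edge_del a b) (face_lmaps p D ?B m a b ?Q) (lmaps p (D - {a, b}) (?Q @ W) m)"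
      by (rule edge_bij[OF fin ab(2-4) W Qne lastQ p]) (use la in blast)
    then show ?thesis using IH[OF ab(2-4)] ab(1) bij_betw_finite bij_betw_same_card by fastforce
  qed
  have U: "lmaps p D ?B m = (\<Union>ab\<in>pairs D. ?X ab)"
  proof (intro equalityI subsetI)
    fix M assume M: "M \<in> lmaps p D ?B m"
    obtain s e c l r where Mr: "M = (s, e, c, l, r)" by (cases M)
    have "lmap D s e p c l r" and bw: "bword s e c l r ?B" using M unfolding Mr lmaps_def by auto
    then interpret lmap D s e p c l r by simp
    have cr: "c r" "l r = la" using bwordE[OF bw] by auto
    have lb: "l (e r) = snd (last W)" using root_label[OF bw] W by simp
    have bD: "e r \<in> D" using root permutes_in_image[OF e] by simp
    have cb: "\<not> c (e r)" using col_e[OF root] cr by simp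
    \<comment> \<open>A black dart of the root face reverses a fall, but \<open>e r\<close> reverses
      a rise; so another face lies behind the edge.\<close>
    have out: "e r \<notin> orbit_of (e \<circ> s) r"
    proof
      assume "e r \<in> orbit_of (e \<circ> s) r"
      from rootstep[OF this cb] have "l (e r) = l r + 1" using inv by simp
      then show False using cr lb la by simp
    qed
    obtain q where q: "cycl (e \<circ> s) (e r # q)" "\<forall>h\<in>set q. c h = c (e r)" "map (e \<circ> s) (e r # q) = q @ [e r]"
      "orbit_of (e \<circ> s) (e r) = set (e r # q)" "card (orbit_of (e \<circ> s) (e r)) = length q + 1"
      using face_cycle[OF bD out] .
    \<comment> \<open>The face behind has \<open>p\<close> darts and has to climb back
      \<open>p - 1\<close> in its remaining \<open>p - 1\<close> steps, which forces the word of
      \<open>q\<close>.\<close>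
    have len: "length q + 1 = p" using blk[OF bD out cb] q(5) by simp
    have "l (last (e r # q)) = l r" using last_label(1)[OF q(1)] inv by simp
    then have "l (last (e r # q)) = l (e r) + length q" using cr lb la len by simp
    then have "map (\<lambda>h. (c h, l h)) q = map (\<lambda>j. (False, l (e r) + j)) [1..<Suc (length q)]"
      using black_chain(2)[OF q(3) bD] q(2) cb by blast
    moreover have "Suc (length q) = p" using len by simp
    ultimately have "map (\<lambda>h. (c h, l h)) q = ?Q" by (simp only: lb)
    then have "M \<in> ?X (r, e r)" unfolding Mr face_lmaps_def prod.case using M Mr out q(1) by blast
    moreover have "(r, e r) \<in> pairs D" unfolding pairs_def using root bD fpf[OF root] by auto
    ultimately show "M \<in> (\<Union>ab\<in>pairs D. ?X ab)" by blast
  next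
    fix M assume "M \<in> (\<Union>ab\<in>pairs D. ?X ab)"
    then show "M \<in> lmaps p D ?B m" unfolding face_lmaps_def by auto
  qed
  have disj: "?X ab \<inter> ?X ab' = {}" if "ab \<noteq> ab'" for ab ab'
    using that unfolding face_lmaps_def by (cases ab; cases ab') auto
  have "finite (lmaps p D ?B m)" unfolding U using X pairs_finite[OF fin] by blast
  moreover have "card (lmaps p D ?B m) = (\<Sum>ab\<in>pairs D. card (?X ab))"
    unfolding U using X disj by (intro card_UN_disjoint pairs_finite[OF fin]) blast+
  moreover have "\<dots> = card D * (card D - 1) * N" using X by (simp add: pairs_card[OF fin])
  ultimately show ?thesis by simp
qed

text \<open>Either the root face itself lies behind the black step, and the edge is a leaf by
  \<open>peak_leaf\<close>, or an inner white face does, whose word is \<open>Q\<close>. The terms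
  \<open>NL\<close> and \<open>NX\<close> will match the summand 1 and the generating function in
  \<open>V\<close>.\<close>

lemma lmaps_peak:
  assumes p: "p \<ge> 2" and fin: "finite D" and la: "la = lb + 1" and lb: "lb = endl lb W"
    and IHL: "\<And>a b. a \<in> D \<Longrightarrow> b \<in> D \<Longrightarrow> a \<noteq> b \<Longrightarrow>
      finite (leaf_lmaps p D ((False, la) # (True, lb) # W) m a b) \<and> card (leaf_lmaps p D ((False, la) # (True, lb) # W) m a b) = NL"
    and IHX: "\<And>a b Q. a \<in> D \<Longrightarrow> b \<in> D \<Longrightarrow> a \<noteq> b \<Longrightarrow> Q \<in> inner_face_words p lb m \<Longrightarrow>
      finite (lmaps p (D - {a, b}) (Q @ (True, lb) # W) (m - {#face_weight p Q#})) \<and>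
      card (lmaps p (D - {a, b}) (Q @ (True, lb) # W) (m - {#face_weight p Q#})) = NX Q"
  shows "finite (lmaps p D ((False, la) # (True, lb) # W) m) \<and>
    card (lmaps p D ((False, la) # (True, lb) # W) m) = card D * (card D - 1) * (NL + (\<Sum>Q\<in>inner_face_words p lb m. NX Q))"
proof -
  let ?W = "(True, lb) # W"
  let ?B = "(False, la) # ?W"
  let ?X = "\<lambda>(a, b) Q. face_lmaps p D ?B m a b Q" and ?L = "\<lambda>(a, b). leaf_lmaps p D ?B m a b"
  let ?Y = "\<lambda>ab. ?L ab \<union> (\<Union>Q\<in>inner_face_words p lb m. ?X ab Q)"
  have lW: "snd (last ?W) = lb" using lb endl_eq[of lb W] by (auto split: if_splits)
  have X: "finite (?X ab Q) \<and> card (?X ab Q) = NX Q" if abP: "ab \<in> pairs D" "Q \<in> inner_face_words p lb m" for ab Q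
  proof -
    obtain a b where ab: "ab = (a, b)" "a \<in> D" "b \<in> D" "a \<noteq> b" using abP(1) unfolding pairs_def by (cases ab) auto
    have Q: "Q \<in> face_words p lb" "face_weight p Q \<in># m" using abP(2) unfolding inner_face_words_def by auto
    have Qne: "Q \<noteq> []" using face_words_length(3)[OF Q(1) p] .
    have lQ: "la = snd (last Q)" using Q(1) Qne la endl_eq[of lb Q] unfolding face_words_def by simp
    have white: "\<forall>z\<in>set Q. fst z" using Q(1) unfolding face_words_def by simp
    have mm: "m = add_mset ((length Q + 1) div p) (m - {#face_weight p Q#})" using Q(2) unfolding face_weight_def by simp
    have "bij_betw (edge_del a b) (face_lmaps p D ?B m a b Q) (lmaps p (D - {a, b}) (Q @ ?W) (m - {#face_weight p Q#}))"
      by (rule edge_bij[OF fin ab(2-4) _ Qne lQ p]) (use la lW white mm in auto)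
    then show ?thesis using IHX[OF ab(2-4) abP(2)] ab(1) bij_betw_finite bij_betw_same_card by fastforce
  qed
  have U: "lmaps p D ?B m = (\<Union>ab\<in>pairs D. ?Y ab)"
  proof (intro equalityI subsetI)
    fix M assume M: "M \<in> lmaps p D ?B m"
    obtain s e c l r where Mr: "M = (s, e, c, l, r)" by (cases M)
    have "lmap D s e p c l r" and bw: "bword s e c l r ?B" and inm: "inner p D s e c r = m" using M unfolding Mr lmaps_def by auto
    then interpret lmap D s e p c l r by simp
    obtain v where v: "cycl (e \<circ> s) (r # v)" "map (\<lambda>h. (c h, l h)) v = ?W" "\<not> c r" "l r = la"
      using bw by (rule bwordE) auto
    obtain x w where vw: "v = x # w" "l x = lb" using v(2) by (cases v) auto
    have "hd ((e \<circ> s) r # map (e \<circ> s) v) = hd (v @ [r])" using v(1) unfolding cycl_Cons_iff by simp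
    then have x: "e (s r) = x" using vw by simp
    have leb: "l (e r) = lb" using root_label[OF bw] lW by simp
    have bD: "e r \<in> D" using root permutes_in_image[OF e] by simp
    have cb: "c (e r)" using col_e[OF root] v by simp
    have pr: "(r, e r) \<in> pairs D" unfolding pairs_def using root bD fpf[OF root] by auto
    have "M \<in> ?Y (r, e r)"
    proof (cases "e r \<in> orbit_of (e \<circ> s) r")
      case True
      have "s r = r" using True v leb x vw la by (intro peak_leaf) auto
      then have "M \<in> ?L (r, e r)" unfolding Mr leaf_lmaps_def prod.case using M Mr by blast
      then show ?thesis by blast
    next
      case out: False
      obtain q where q: "cycl (e \<circ> s) (e r # q)" "\<forall>h\<in>set q. c h = c (e r)" "map (e \<circ> s) (e r # q) = q @ [e r]"
        "orbit_of (e \<circ> s) (e r) = set (e r # q)" "card (orbit_of (e \<circ> s) (e r)) = length q + 1"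
        using face_cycle[OF bD out] .
      let ?Q = "map (\<lambda>h. (c h, l h)) q"
      have white: "\<forall>z\<in>set ?Q. fst z" using q(2) cb by auto
      have "walk p (l (e r)) ?Q" by (rule boundary_walk[OF q(3) bD]) (use q(2) cb in blast)
      moreover have lq: "l (last (e r # q)) = la" using last_label(1)[OF q(1)] inv v by simp
      moreover have "q \<noteq> []" using lq leb la by auto
      then have "endl lb ?Q = la" using lq endl_eq[of lb ?Q] by (simp add: last_map)
      ultimately have face_words: "?Q \<in> face_words p lb" unfolding face_words_def using white leb la by simp
      have "orbit_of (e \<circ> s) (e r) \<in> wfaces D s e c - {orbit_of (e \<circ> s) r}"
      proof -
        have "orbit_of (e \<circ> s) (e r) \<noteq> orbit_of (e \<circ> s) r" using out orbit_refl[OF phi fin, of "e r"] by metis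
        then show ?thesis unfolding wfaces_def using bD cb by blast
      qed
      moreover have "finite (wfaces D s e c)" unfolding wfaces_def using fin by simp
      ultimately have "card (orbit_of (e \<circ> s) (e r)) div p \<in># m"
        unfolding inm[symmetric] inner_def by simp
      then have "face_weight p ?Q \<in># m" unfolding face_weight_def q(5) by simp
      then have inner_face_words: "?Q \<in> inner_face_words p lb m" unfolding inner_face_words_def using face_words by simp
      have "M \<in> ?X (r, e r) ?Q" unfolding Mr face_lmaps_def prod.case using M Mr out q(1) by blast
      then show ?thesis using inner_face_words by blast
    qed
    then show "M \<in> (\<Union>ab\<in>pairs D. ?Y ab)" using pr by blast
  next
    fix M assume "M \<in> (\<Union>ab\<in>pairs D. ?Y ab)"
    then show "M \<in> lmaps p D ?B m" unfolding face_lmaps_def leaf_lmaps_def by auto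
  qed
  have disj: "?Y ab \<inter> ?Y ab' = {}" if "ab \<noteq> ab'" for ab ab'
    using that unfolding face_lmaps_def leaf_lmaps_def by (cases ab; cases ab') auto
  have disjX: "?X ab Q \<inter> ?X ab Q' = {}" if "Q \<noteq> Q'" for ab Q Q'
  proof -
    obtain a b where ab: "ab = (a, b)" by (cases ab)
    have "q = q'" if "cycl f (b # q)" "cycl f (b # q')" for q q' and f :: "nat \<Rightarrow> nat" using that by (rule cycl_unique)
    then show ?thesis using that unfolding ab face_lmaps_def by auto
  qed
  \<comment> \<open>At a leaf, \<open>b\<close> follows \<open>a\<close> on the root face, so both
    sides of the edge are that face.\<close>
  have disjL: "?L ab \<inter> ?X ab Q = {}" for ab Q
  proof -
    obtain a b where ab: "ab = (a, b)" by (cases ab)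
    have False if "(s, e, c, l, r) \<in> leaf_lmaps p D ?B m a b" "(s, e, c, l, r) \<in> face_lmaps p D ?B m a b Q" for s e c l r
    proof -
      have "lmap D s e p c l r" and 1: "e a = b" "s a = a" "b \<notin> orbit_of (e \<circ> s) a" using that unfolding face_lmaps_def leaf_lmaps_def lmaps_def by auto
      then interpret lmap D s e p c l r by simp
      have "(e \<circ> s) a \<in> orbit_of (e \<circ> s) a" using orbit_step[OF phi fin] orbit_refl[OF phi fin] by blast
      then show False using 1 by simp
    qed
    then show ?thesis unfolding ab by auto
  qed
  have Y: "finite (?Y ab) \<and> card (?Y ab) = NL + (\<Sum>Q\<in>inner_face_words p lb m. NX Q)" if ab: "ab \<in> pairs D" for ab
  proof -
    have L: "finite (?L ab)" "card (?L ab) = NL" using IHL ab unfolding pairs_def by auto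
    have fU: "finite (\<Union>Q\<in>inner_face_words p lb m. ?X ab Q)" using X[OF ab] finite_inner_face_words[OF p] by blast
    have "card (\<Union>Q\<in>inner_face_words p lb m. ?X ab Q) = (\<Sum>Q\<in>inner_face_words p lb m. card (?X ab Q))"
      using X[OF ab] disjX by (intro card_UN_disjoint finite_inner_face_words[OF p]) blast+
    also have "\<dots> = (\<Sum>Q\<in>inner_face_words p lb m. NX Q)" using X[OF ab] by (intro sum.cong) auto
    finally have cU: "card (\<Union>Q\<in>inner_face_words p lb m. ?X ab Q) = (\<Sum>Q\<in>inner_face_words p lb m. NX Q)" .
    have "?L ab \<inter> (\<Union>Q\<in>inner_face_words p lb m. ?X ab Q) = {}" using disjL by blast
    then show ?thesis using L fU cU by (simp add: card_Un_disjoint)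
  qed
  have "finite (lmaps p D ?B m)" unfolding U using Y pairs_finite[OF fin] by blast
  moreover have "card (lmaps p D ?B m) = (\<Sum>ab\<in>pairs D. card (?Y ab))"
    unfolding U using Y disj by (intro card_UN_disjoint pairs_finite[OF fin]) blast+
  moreover have "\<dots> = card D * (card D - 1) * (NL + (\<Sum>Q\<in>inner_face_words p lb m. NX Q))" using Y by (simp add: pairs_card[OF fin])
  ultimately show ?thesis by simp
qed

section \<open>Generating functions of labelled maps\<close>

lemma finite_submultisets: "finite {a. a \<subseteq># (m :: 'a multiset)}"
proof (induction m)
  case empty then show ?case by simp
next
  case (add x m)
  have "{a. a \<subseteq># add_mset x m} \<subseteq> {a. a \<subseteq># m} \<union> add_mset x ` {a. a \<subseteq># m}"
  proof
    fix a assume a: "a \<in> {a. a \<subseteq># add_mset x m}"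
    show "a \<in> {a. a \<subseteq># m} \<union> add_mset x ` {a. a \<subseteq># m}"
    proof (cases "x \<in># a")
      case True
      then obtain b where "a = add_mset x b" by (meson mset_add)
      then show ?thesis using a by auto
    next
      case False
      have "count a y \<le> count m y" for y
        using mset_subset_eq_count[of a "add_mset x m" y] a False by (cases "y = x") (auto simp: not_in_iff)
      then show ?thesis by (simp add: subseteq_mset_def)
    qed
  qed
  then show ?case by (rule finite_subset) (use add in simp)
qed

text \<open>Sums over splittings \<open>a + b = m\<close> avoid multiset differences, and
  commutativity and associativity become reindexing.\<close>

lemma ser_mult_pairs: "ser_mult f g m = (\<Sum>(a, b)\<in>{(a, b). a + b = m}. f a * g b)"
  unfolding ser_mult_def
  by (rule sum.reindex_bij_witness[of _ fst "\<lambda>a. (a, m - a)"]) auto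

lemma finite_splits: "finite {(a, b). a + b = (m :: 'a multiset)}"
proof -
  have "{(a, b). a + b = m} \<subseteq> {a. a \<subseteq># m} \<times> {a. a \<subseteq># m}" by auto
  then show ?thesis by (rule finite_subset) (simp add: finite_submultisets)
qed

lemma ser_mult_commute: "ser_mult f g = ser_mult g f"
proof
  fix m
  show "ser_mult f g m = ser_mult g f m" unfolding ser_mult_pairs
    by (rule sum.reindex_bij_witness[of _ "\<lambda>(a, b). (b, a)" "\<lambda>(a, b). (b, a)"]) (auto simp: ac_simps)
qed

lemma ser_mult_assoc: "ser_mult (ser_mult f g) h = ser_mult f (ser_mult g h)"
proof
  fix m
  let ?S = "\<lambda>m :: nat multiset. {(a, b). a + b = m}"
  have "ser_mult (ser_mult f g) h m = (\<Sum>x\<in>?S m. \<Sum>y\<in>?S (fst x). f (fst y) * g (snd y) * h (snd x))"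
    unfolding ser_mult_pairs by (intro sum.cong) (auto simp: case_prod_beta sum_distrib_right)
  also have "\<dots> = (\<Sum>(x, y)\<in>Sigma (?S m) (\<lambda>x. ?S (fst x)). f (fst y) * g (snd y) * h (snd x))"
    by (intro sum.Sigma) (auto simp: finite_splits)
  also have "\<dots> = (\<Sum>(x, y)\<in>Sigma (?S m) (\<lambda>x. ?S (snd x)). f (fst x) * (g (fst y) * h (snd y)))"
    by (rule sum.reindex_bij_witness[of _ "\<lambda>(x, y). ((fst x + fst y, snd y), (fst x, fst y))" "\<lambda>(x, y). ((fst y, snd y + snd x), (snd y, snd x))"])
      (auto simp: ac_simps)
  also have "\<dots> = (\<Sum>x\<in>?S m. \<Sum>y\<in>?S (snd x). f (fst x) * (g (fst y) * h (snd y)))"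
    by (intro sum.Sigma[symmetric]) (auto simp: finite_splits)
  also have "\<dots> = ser_mult f (ser_mult g h) m"
    unfolding ser_mult_pairs by (intro sum.cong) (auto simp: case_prod_beta sum_distrib_left)
  finally show "ser_mult (ser_mult f g) h m = ser_mult f (ser_mult g h) m" .
qed

lemma ser_mult_one: "ser_mult f ser_one = f"
proof
  fix m
  have "ser_mult f ser_one m = (\<Sum>a\<in>{a. a \<subseteq># m}. if a = m then f m else 0)"
    unfolding ser_mult_def ser_one_def by (intro sum.cong) (auto simp: Diff_eq_empty_iff_mset)
  then show "ser_mult f ser_one m = f m" by (simp add: finite_submultisets)
qed

interpretation ser: comm_monoid ser_mult ser_one
  by unfold_locales (rule ser_mult_assoc, rule ser_mult_commute, rule ser_mult_one)

text \<open>Black steps have to be neutral: opening a black face trades a rise, of weight 1, for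
  \<open>p - 1\<close> of them.\<close>

fun stepw :: "(nat \<Rightarrow> ser) \<Rightarrow> nat \<Rightarrow> bool \<times> nat \<Rightarrow> ser" where
  "stepw V x (c, y) = (if c \<and> x = y + 1 then V x else ser_one)"

fun walkw :: "(nat \<Rightarrow> ser) \<Rightarrow> nat \<Rightarrow> (bool \<times> nat) list \<Rightarrow> ser" where
  "walkw V x [] = ser_one"
| "walkw V x (z # B) = ser_mult (stepw V x z) (walkw V (snd z) B)"

lemma walkw_append: "walkw V x (A @ B) = ser_mult (walkw V x A) (walkw V (endl x A) B)"
  by (induction A arbitrary: x) (simp_all add: ser.assoc)

abbreviation nwhite :: "(bool \<times> nat) list \<Rightarrow> nat" where
  "nwhite B \<equiv> length (filter fst B)"

lemma black_up:
  "walk p x (map (\<lambda>j. (False, x + j)) [1..<Suc n])" "endl x (map (\<lambda>j. (False, x + j)) [1..<Suc n]) = x + n"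
  "walkw V x (map (\<lambda>j. (False, x + j)) [1..<Suc n]) = ser_one" "nwhite (map (\<lambda>j. (False, x + j)) [1..<Suc n]) = 0"
proof -
  have "walk p x (map (\<lambda>j. (False, x + j)) [1..<Suc n]) \<and> endl x (map (\<lambda>j. (False, x + j)) [1..<Suc n]) = x + n \<and>
    walkw V x (map (\<lambda>j. (False, x + j)) [1..<Suc n]) = ser_one"
    by (induction n) (simp_all add: walkw_append ser.assoc)
  then show "walk p x (map (\<lambda>j. (False, x + j)) [1..<Suc n])" "endl x (map (\<lambda>j. (False, x + j)) [1..<Suc n]) = x + n"
    "walkw V x (map (\<lambda>j. (False, x + j)) [1..<Suc n]) = ser_one" by blast+
  show "nwhite (map (\<lambda>j. (False, x + j)) [1..<Suc n]) = 0" by (simp add: filter_empty_conv del: upt_Suc)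
qed

lemma nwhite_face_words: "Q \<in> face_words p x \<Longrightarrow> nwhite Q = length Q"
  unfolding face_words_def by (simp add: filter_id_conv)

text \<open>Finiteness is part of the claim because \<open>card\<close> of an infinite set is 0, and
  it comes out of the same recursion. The factor \<open>fact (card D)\<close> accounts for the
  naming of the darts.\<close>

definition counted :: "nat \<Rightarrow> (nat \<Rightarrow> ser) \<Rightarrow> nat set \<Rightarrow> nat \<Rightarrow> (bool \<times> nat) list \<Rightarrow> nat multiset \<Rightarrow> bool" where
  "counted p V D x B m \<longleftrightarrow> finite (lmaps p D B m) \<and> card (lmaps p D B m) = fact (card D) * walkw V x B m"

lemma counted_rotate1: 
  assumes "endl x (z # B) = x" "counted p V D (snd z) (B @ [z]) m"
  shows "counted p V D x (z # B) m"
proof -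
  have "endl (snd z) B = x" using assms by simp
  then have "walkw V (snd z) (B @ [z]) = walkw V x (z # B)" by (simp add: walkw_append ser.commute)
  then show ?thesis using assms(2) bij_betw_finite[OF lmaps_rotate[of p D z B m]] bij_betw_same_card[OF lmaps_rotate[of p D z B m]]
    unfolding counted_def by simp
qed

lemma counted_rotate:
  assumes "endl x (A @ C) = x" "counted p V D (endl x A) (C @ A) m"
  shows "counted p V D x (A @ C) m"
  using assms
proof (induction A arbitrary: x C)
  case (Cons z A)
  have e: "endl x (z # A @ C) = x" using Cons.prems(1) by simp
  have "counted p V D (snd z) (A @ (C @ [z])) m"
    by (rule Cons.IH) (use Cons.prems in simp_all)
  then show ?case using counted_rotate1[OF e, of p V D m] by simp
qed simp

text \<open>A maximal label is not entered by a fall, which would start higher, nor by a rise, which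
  \<open>norise\<close> excludes; so it is entered by a black step. The cyclically next step goes no
  higher and hence is a fall.\<close>

lemma peak_exists:
  assumes "walk p x B" "endl x B = x" "B \<noteq> []" "p \<ge> 2"
    and norise: "\<And>A y C. B = A @ (True, y) # C \<Longrightarrow> y \<noteq> endl x A + (p - 1)"
  obtains A C W y where "B = A @ C" "C @ A = (False, y + 1) # (True, y) # W" "endl x A = y"
proof -
  let ?L = "snd ` set B"
  have fin: "finite ?L" "?L \<noteq> {}" using assms(3) by auto
  then have "Max ?L \<in> ?L" by (rule Max_in)
  then obtain c where "(c, Max ?L) \<in> set B" by auto
  define M where "M = Max ?L"
  obtain A C' where B: "B = A @ (c, M) # C'" using \<open>(c, Max ?L) \<in> set B\<close> unfolding M_def by (meson split_list)
  let ?y = "endl x A"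
  have le: "snd z \<le> M" if "z \<in> set B" for z using fin that unfolding M_def by auto
  \<comment> \<open>The walk is closed, so for the first letter the preceding label is the last
    label of the word.\<close>
  have yle: "?y \<le> M"
  proof (cases "A = []")
    case True
    have "x = snd (last B)" using assms(2,3) endl_eq[of x B] by simp
    then show ?thesis using True le[of "last B"] assms(3) by simp
  next
    case False
    then have "last A \<in> set B" using B by (metis UnCI last_in_set set_append)
    then show ?thesis using le[of "last A"] endl_eq[of x A] False by simp
  qed
  have ok: "okw p ?y (c, M)" and w: "walk p M C'" "walk p x A" using assms(1) unfolding B by (simp_all del: okw.simps)
  have c: "\<not> c" "M = ?y + 1"
  proof -
    show "\<not> c"
    proof
      assume c
      then have "M \<noteq> ?y + (p - 1)" using norise[of A M C'] B by simp
      then show False using ok \<open>c\<close> yle by simp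
    qed
    then show "M = ?y + 1" using ok by simp
  qed
  let ?W = "C' @ A"
  have endW: "endl M ?W = ?y"
  proof -
    have "endl M C' = x" using assms(2) unfolding B by simp
    then show ?thesis by simp
  qed
  have wW: "walk p M ?W"
  proof -
    have "endl M C' = x" using assms(2) unfolding B by simp
    then show ?thesis using w by simp
  qed
  have "?W \<noteq> []" using endW c(2) by (metis Suc_eq_plus1 endl.simps(1) n_not_Suc_n)
  then obtain c' y' W where W: "?W = (c', y') # W" by (metis neq_Nil_conv surj_pair)
  have "(c', y') \<in> set ?W" unfolding W by simp
  then have "(c', y') \<in> set B" using B by (metis Un_iff in_set_conv_decomp_first set_append set_ConsD list.set_intros(2))
  then have y'le: "y' \<le> M" using le[of "(c', y')"] by simp
  have ok': "okw p M (c', y')" using wW unfolding W by (simp del: okw.simps)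
  have c': c' using ok' y'le by (cases c') auto
  have "y' = ?y"
  proof (rule ccontr)
    assume "y' \<noteq> ?y"
    then have r: "y' = M + (p - 1)" using ok' c' c(2) by auto
    then show False using y'le assms(4) by simp
  qed
  then have "(C' @ A) = (True, ?y) # W" using W c' by simp
  then have "((c, M) # C') @ A = (False, ?y + 1) # (True, ?y) # W" using c by simp
  then show ?thesis using that[of A "(c, M) # C'" ?y W] B by simp
qed

text \<open>Both sides sum over the ways of singling out the face adjacent to the peeled edge.\<close>

lemma peel_convolution:
  assumes p: "p \<ge> 2" and V: "\<And>a. a \<subseteq># m \<Longrightarrow> v a = ser_one a + (\<Sum>Q\<in>inner_face_words p x a. H Q (a - {#face_weight p Q#}))"
  shows "ser_mult v G m = G m + (\<Sum>Q\<in>inner_face_words p x m. ser_mult (H Q) G (m - {#face_weight p Q#}))"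
proof -
  have "ser_mult v G m = (\<Sum>a\<in>{a. a \<subseteq># m}. ser_one a * G (m - a)) + (\<Sum>a\<in>{a. a \<subseteq># m}. \<Sum>Q\<in>inner_face_words p x a. H Q (a - {#face_weight p Q#}) * G (m - a))"
    unfolding ser_mult_def sum.distrib[symmetric]
    by (intro sum.cong refl) (simp add: V distrib_right sum_distrib_right)
  also have "(\<Sum>a\<in>{a. a \<subseteq># m}. ser_one a * G (m - a)) = G m"
    using fun_cong[OF ser.left_neutral, of G m] unfolding ser_mult_def .
  also have "(\<Sum>a\<in>{a. a \<subseteq># m}. \<Sum>Q\<in>inner_face_words p x a. H Q (a - {#face_weight p Q#}) * G (m - a)) =
    (\<Sum>(a, Q)\<in>Sigma {a. a \<subseteq># m} (inner_face_words p x). H Q (a - {#face_weight p Q#}) * G (m - a))"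
    by (intro sum.Sigma) (auto simp: finite_submultisets finite_inner_face_words[OF p])
  also have "\<dots> = (\<Sum>(Q, a)\<in>Sigma (inner_face_words p x m) (\<lambda>Q. {a. a \<subseteq># m - {#face_weight p Q#}}). H Q a * G (m - {#face_weight p Q#} - a))"
  \<comment> \<open>A submultiset of \<open>m\<close> that contains the degree of \<open>Q\<close>
    is this degree added to a submultiset of what remains of \<open>m\<close>.\<close>
  proof (rule sum.reindex_bij_witness[of _ "\<lambda>(Q, a). (add_mset (face_weight p Q) a, Q)" "\<lambda>(a, Q). (Q, a - {#face_weight p Q#})"], goal_cases)
    case (1 z)
    then show ?case by (auto simp: inner_face_words_def)
  next
    case (2 z)
    then obtain a Q where z: "z = (a, Q)" and a: "a \<subseteq># m" and Q: "Q \<in> face_words p x" "face_weight p Q \<in># a" by (auto simp: inner_face_words_def)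
    have "face_weight p Q \<in># m" using mset_subset_eqD[OF a Q(2)] .
    then have "a - {#face_weight p Q#} \<subseteq># m - {#face_weight p Q#}" using a by (simp add: subset_eq_diff_conv)
    then show ?case using z Q \<open>face_weight p Q \<in># m\<close> by (simp add: inner_face_words_def)
  next
    case (3 z)
    then show ?case by auto
  next
    case (4 z)
    then show ?case by (auto simp: inner_face_words_def insert_subset_eq_iff subset_eq_diff_conv)
  next
    case (5 z)
    then show ?case by (auto simp: inner_face_words_def)
  qed
  also have "\<dots> = (\<Sum>Q\<in>inner_face_words p x m. ser_mult (H Q) G (m - {#face_weight p Q#}))"
    unfolding ser_mult_def by (intro sum.Sigma[symmetric]) (auto simp: finite_submultisets finite_inner_face_words[OF p])
  finally show ?thesis .
qed

lemma sum_mset_diff_single: "k \<in># m \<Longrightarrow> sum_mset (m - {#k#}) + k = sum_mset (m :: nat multiset)"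
proof -
  assume "k \<in># m"
  then obtain m' where "m = add_mset k m'" by (rule mset_add)
  then show ?thesis by simp
qed

text \<open>\<open>VH\<close> resolves the circularity: it computes a coefficient of
  \<open>V\<close> once certain labelled maps are counted, and the induction counts them because
  they have fewer darts. As to the number of darts, each edge has one white dart; the root face
  contains \<open>nwhite B\<close> of them, and an inner face contributing \<open>k\<close> to
  \<open>m\<close> contains \<open>k * p\<close>.\<close>

theorem all_counted:
  assumes p: "p \<ge> 2"
    and VH: "\<And>i a f. i \<ge> 1 \<Longrightarrow>
      (\<And>Q. Q \<in> inner_face_words p (i - 1) a \<Longrightarrow>
        finite (lmaps p {..<2 * (p * sum_mset a)} ((True, i - 1) # Q) (a - {#face_weight p Q#})) \<and>
        card (lmaps p {..<2 * (p * sum_mset a)} ((True, i - 1) # Q) (a - {#face_weight p Q#})) = fact (2 * (p * sum_mset a)) * f Q) \<Longrightarrow>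
      V i a = ser_one a + (\<Sum>Q\<in>inner_face_words p (i - 1) a. f Q)"
    and D: "finite D" "card D = 2 * (nwhite B + p * sum_mset m)"
    and B: "B \<noteq> []" "walk p x B" "endl x B = x"
  shows "counted p V D x B m"
  using D B
proof (induction "card D" arbitrary: D B m x rule: less_induct)
  case less
  note fin = less.prems(1) and cD = less.prems(2) and B = less.prems(3-5)
  show ?case
  proof (cases "\<exists>A y C. B = A @ (True, y) # C \<and> y = endl x A + (p - 1)")
    case True
    then obtain A y C where BA: "B = A @ (True, y) # C" and y: "y = endl x A + (p - 1)" by blast
    let ?x = "endl x A" and ?W = "C @ A" and ?Q = "map (\<lambda>j. (False, endl x A + j)) [1..<p]"
    have eC: "endl y C = x" using B(3) unfolding BA by simp
    have wW: "walk p y ?W" "endl y ?W = ?x" using B(2) eC unfolding BA by simp_all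
    have Wne: "?W \<noteq> []"
    proof
      assume W: "?W = []"
      have "endl y ?W = y" unfolding W by simp
      then have "y = ?x" using wW(2) by (rule trans[OF sym])
      then show False using y p by linarith
    qed
    have lW: "snd (last ?W) = ?x"
      using endl_eq[of y ?W] wW(2) unfolding if_not_P[OF Wne] by (rule trans[OF sym])
    have pp: "Suc (p - 1) = p" using p by simp
    note bu = black_up(1)[of p ?x "p - 1", unfolded pp] black_up(2)[of ?x "p - 1", unfolded pp]
      black_up(3)[of V ?x "p - 1", unfolded pp] black_up(4)[of ?x "p - 1", unfolded pp]
    have card2: "card D = 2 * (nwhite ?W + p * sum_mset m) + 2" using cD unfolding BA by simp
    have IH: "counted p V (D - {a, b}) ?x (?Q @ ?W) m" if ab: "a \<in> D" "b \<in> D" "a \<noteq> b" for a b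
    proof (rule less.hyps)
      have cc: "card (D - {a, b}) = card D - 2" using fin ab by (simp add: card_Diff_subset)
      then show "card (D - {a, b}) < card D" using card2 by simp
      show "card (D - {a, b}) = 2 * (nwhite (?Q @ ?W) + p * sum_mset m)" using cc card2 bu(4) by simp
      show "walk p ?x (?Q @ ?W)" unfolding walk_append[of p ?x ?Q ?W] bu(2) y[symmetric] using bu(1) wW(1) by blast
      show "endl ?x (?Q @ ?W) = ?x" unfolding endl_append[of ?x ?Q ?W] bu(2) y[symmetric] by (rule wW(2))
      show "?Q @ ?W \<noteq> []" using Wne by simp
    qed (use fin in simp)
    have wwQ: "walkw V ?x (?Q @ ?W) = walkw V y ?W"
      unfolding walkw_append[of V ?x ?Q ?W] bu(2) bu(3) y[symmetric] by (simp add: ser.left_neutral)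
    have fa: "card (D - {a, b}) = card D - 2" if "a \<in> D" "b \<in> D" "a \<noteq> b" for a b using fin that by (simp add: card_Diff_subset)
    have "finite (lmaps p D ((True, y) # ?W) m) \<and> card (lmaps p D ((True, y) # ?W) m) = card D * (card D - 1) * (fact (card D - 2) * walkw V y ?W m)"
    proof (rule lmaps_rise[OF p fin Wne])
      show "y = snd (last ?W) + (p - 1)" unfolding lW by (rule y)
      fix a b assume ab: "a \<in> D" "b \<in> D" "a \<noteq> b"
      show "finite (lmaps p (D - {a, b}) (map (\<lambda>j. (False, snd (last ?W) + j)) [1..<p] @ ?W) m) \<and>
        card (lmaps p (D - {a, b}) (map (\<lambda>j. (False, snd (last ?W) + j)) [1..<p] @ ?W) m) = fact (card D - 2) * walkw V y ?W m"
        using IH[OF ab] unfolding counted_def lW wwQ fa[OF ab] .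
    qed
    moreover have "card D * (card D - 1) * fact (card D - 2) = fact (card D)"
    proof -
      obtain N where "card D = Suc (Suc N)" using card2 by (metis add_2_eq_Suc')
      then show ?thesis by (simp add: algebra_simps)
    qed
    moreover have "walkw V ?x ((True, y) # ?W) = walkw V y ?W" using y p by (simp add: ser.left_neutral)
    ultimately have "counted p V D ?x ((True, y) # ?W) m" unfolding counted_def by (metis mult.assoc)
    then show ?thesis using counted_rotate[of x A "(True, y) # C" p V D m] B(3) unfolding BA by simp
  next
    case False
    then have nr: "\<And>A y C. B = A @ (True, y) # C \<Longrightarrow> y \<noteq> endl x A + (p - 1)" by blast
    obtain A C W y where BA: "B = A @ C" and CA: "C @ A = (False, y + 1) # (True, y) # W" and yA: "endl x A = y"
      using peak_exists[OF B(2,3,1) p nr] .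
    let ?B = "(False, y + 1) # (True, y) # W"
    have eC: "endl y C = x" using B(3) yA unfolding BA by simp
    have wB: "walk p y ?B" "endl y ?B = y"
      unfolding CA[symmetric] using B(2) eC yA unfolding BA by simp_all
    then have wW: "walk p y W" "endl y W = y" by simp_all
    have nB: "nwhite B = nwhite W + 1"
      using arg_cong[OF CA, of nwhite] unfolding BA by simp
    have card2: "card D = 2 * (nwhite W + p * sum_mset m) + 2" using cD nB by simp
    have fa: "card (D - {a, b}) = card D - 2" if "a \<in> D" "b \<in> D" "a \<noteq> b" for a b using fin that by (simp add: card_Diff_subset)
    let ?H = "\<lambda>Q. walkw V (y + 1) ((True, y) # Q)"
    \<comment> \<open>The coefficient at \<open>a\<close> involves maps with
      \<open>2 * (p * sum_mset a)\<close> darts. This is at most \<open>card D - 2\<close>, so the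
      induction hypothesis applies to them.\<close>
    have Vy: "V (y + 1) a = ser_one a + (\<Sum>Q\<in>inner_face_words p y a. ?H Q (a - {#face_weight p Q#}))" if a: "a \<subseteq># m" for a
    proof -
      have "V (y + 1) a = ser_one a + (\<Sum>Q\<in>inner_face_words p (y + 1 - 1) a. ?H Q (a - {#face_weight p Q#}))"
      proof (rule VH)
        fix Q assume "Q \<in> inner_face_words p (y + 1 - 1) a"
        then have Q: "Q \<in> face_words p y" "face_weight p Q \<in># a" unfolding inner_face_words_def by simp_all
        note ql = face_words_length(1)[OF Q(1) p]
        have "sum_mset a \<le> sum_mset m" using a by (metis le_add1 subset_mset.add_diff_inverse sum_mset.union)
        then have pa: "p * sum_mset a \<le> p * sum_mset m" by (rule mult_le_mono2)
        have "counted p V {..<2 * (p * sum_mset a)} (y + 1) ((True, y) # Q) (a - {#face_weight p Q#})"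
        proof (rule less.hyps)
          show "card {..<2 * (p * sum_mset a)} < card D" unfolding card_lessThan using mult_le_mono2[OF pa, of 2]
            by (rule le_less_trans) (simp add: card2)
          have "p * sum_mset a = p * sum_mset (a - {#face_weight p Q#}) + face_weight p Q * p"
            using sum_mset_diff_single[OF Q(2)] by (metis distrib_left mult.commute)
          then show "card {..<2 * (p * sum_mset a)} = 2 * (nwhite ((True, y) # Q) + p * sum_mset (a - {#face_weight p Q#}))"
            using nwhite_face_words[OF Q(1)] ql by simp
          show "walk p (y + 1) ((True, y) # Q)" "endl (y + 1) ((True, y) # Q) = y + 1" using Q(1) unfolding face_words_def by simp_all
        qed simp_all
        then show "finite (lmaps p {..<2 * (p * sum_mset a)} ((True, y + 1 - 1) # Q) (a - {#face_weight p Q#})) \<and>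
          card (lmaps p {..<2 * (p * sum_mset a)} ((True, y + 1 - 1) # Q) (a - {#face_weight p Q#})) = fact (2 * (p * sum_mset a)) * ?H Q (a - {#face_weight p Q#})"
          unfolding counted_def by simp
      qed simp
      then show ?thesis by simp
    qed
    let ?G = "walkw V y W"
    have conv: "ser_mult (V (y + 1)) ?G m = ?G m + (\<Sum>Q\<in>inner_face_words p y m. ser_mult (?H Q) ?G (m - {#face_weight p Q#}))"
      by (rule peel_convolution[OF p Vy])
    have main: "finite (lmaps p D ?B m) \<and> card (lmaps p D ?B m) = card D * (card D - 1) *
      (fact (card D - 2) * ?G m + (\<Sum>Q\<in>inner_face_words p y m. fact (card D - 2) * ser_mult (?H Q) ?G (m - {#face_weight p Q#})))"
    proof (rule lmaps_peak[OF p fin refl wW(2)[symmetric]])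
      fix a b assume ab: "a \<in> D" "b \<in> D" "a \<noteq> b"
      show "finite (leaf_lmaps p D ?B m a b) \<and> card (leaf_lmaps p D ?B m a b) = fact (card D - 2) * ?G m"
      proof (cases "W = []")
        case True
        \<comment> \<open>Entries 0 in \<open>m\<close> are possible, so \<open>D = {a, b}\<close>
          does not force \<open>m = {#}\<close>; if it fails, both the count and
          \<open>ser_one m\<close> are 0.\<close>
        have "D = {a, b} \<longleftrightarrow> m = {#} \<or> sum_mset m = 0"
        proof -
          have "D = {a, b} \<longleftrightarrow> card D = 2"
            using ab fin by (metis card_2_iff card_subset_eq empty_subsetI insert_subset)
          then show ?thesis using card2 True p by auto
        qed
        then have "m = {#} \<Longrightarrow> D = {a, b}" by simp
        moreover have "m = {#} \<Longrightarrow> card D = 2" using card2 True by simp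
        ultimately show ?thesis using single_edge_card[OF ab(3) refl, of p D y m] True by (auto simp: ser_one_def)
      next
        case Wne: False
        have lW: "y = snd (last W)" using wW(2) Wne endl_eq[of y W] by simp
        have "counted p V (D - {a, b}) y W m"
        proof (rule less.hyps)
          show "card (D - {a, b}) < card D" using fa[OF ab] card2 by simp
          show "card (D - {a, b}) = 2 * (nwhite W + p * sum_mset m)" using fa[OF ab] card2 by simp
        qed (use fin Wne wW in simp_all)
        then show ?thesis using bij_betw_finite[OF leaf_bij[OF fin ab Wne lW refl, of p m]]
            bij_betw_same_card[OF leaf_bij[OF fin ab Wne lW refl, of p m]] fa[OF ab]
          unfolding counted_def by simp
      qed
      fix Q assume "Q \<in> inner_face_words p y m"
      then have Q: "Q \<in> face_words p y" "face_weight p Q \<in># m" unfolding inner_face_words_def by simp_all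
      note ql = face_words_length(1)[OF Q(1) p]
      have eQ: "walk p y Q" "endl y Q = y + 1" using Q(1) unfolding face_words_def by simp_all
      have "counted p V (D - {a, b}) y (Q @ (True, y) # W) (m - {#face_weight p Q#})"
      proof (rule less.hyps)
        show "card (D - {a, b}) < card D" using fa[OF ab] card2 by simp
        have "p * sum_mset m = p * sum_mset (m - {#face_weight p Q#}) + face_weight p Q * p"
          using sum_mset_diff_single[OF Q(2)] by (metis distrib_left mult.commute)
        then show "card (D - {a, b}) = 2 * (nwhite (Q @ (True, y) # W) + p * sum_mset (m - {#face_weight p Q#}))"
          using nwhite_face_words[OF Q(1)] ql fa[OF ab] card2 by simp
        show "walk p y (Q @ (True, y) # W)" using eQ wW by simp
        show "endl y (Q @ (True, y) # W) = y" using eQ wW by simp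
      qed (use fin in simp_all)
      \<comment> \<open>The fall after \<open>Q\<close> returns to \<open>y\<close>. Together with
        \<open>Q\<close> it makes up the closed word of the opened face, and the remaining factor is
        that of \<open>W\<close>.\<close>
      moreover have "walkw V y (Q @ (True, y) # W) = ser_mult (?H Q) ?G"
        using eQ by (simp add: walkw_append ser.assoc ser.left_commute)
      ultimately show "finite (lmaps p (D - {a, b}) (Q @ (True, y) # W) (m - {#face_weight p Q#})) \<and>
        card (lmaps p (D - {a, b}) (Q @ (True, y) # W) (m - {#face_weight p Q#})) = fact (card D - 2) * ser_mult (?H Q) ?G (m - {#face_weight p Q#})"
        using fa[OF ab] unfolding counted_def by simp
    qed
    have "walkw V y ?B = ser_mult (V (y + 1)) ?G" by (simp add: ser.left_neutral)
    then have wB': "walkw V y ?B m = ?G m + (\<Sum>Q\<in>inner_face_words p y m. ser_mult (?H Q) ?G (m - {#face_weight p Q#}))" using conv by simp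
    have "card D * (card D - 1) * fact (card D - 2) = fact (card D)"
    proof -
      obtain N where "card D = Suc (Suc N)" using card2 by (metis add_2_eq_Suc')
      then show ?thesis by (simp add: algebra_simps)
    qed
    then have f: "card D * (card D - 1) * (fact (card D - 2) * k) = fact (card D) * k" for k
      by (simp only: mult.assoc[symmetric])
    have "card (lmaps p D ?B m) = fact (card D) * walkw V y ?B m"
      unfolding conjunct2[OF main] wB' f[symmetric] by (simp only: distrib_left sum_distrib_left)
    then have "counted p V D y ?B m" unfolding counted_def using main by blast
    then show ?thesis using counted_rotate[of x A C p V D m] B(3) yA CA unfolding BA by simp
  qed
qed

section \<open>Constellations as labelled maps\<close>

definition rcons_of :: "nat \<Rightarrow> lm \<Rightarrow> rcons" where
  "rcons_of N = (\<lambda>(s, e, c, l, r). \<lparr>nd = N, sg = s, al = e, wh = c, rt = r\<rparr>)"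

text \<open>The pointed vertex as a set of darts (see \<open>v_props\<close>); it is recovered from
  the labels instead of being stored.\<close>

definition sinks :: "nat \<Rightarrow> lm \<Rightarrow> nat set" where
  "sinks N = (\<lambda>(s, e, c, l, r). {h \<in> {..<N}. sink s e c l h})"

lemma rcons_of_simps [simp]: "nd (rcons_of N (s, e, c, l, r)) = N" "sg (rcons_of N (s, e, c, l, r)) = s" "al (rcons_of N (s, e, c, l, r)) = e"
  "wh (rcons_of N (s, e, c, l, r)) = c" "rt (rcons_of N (s, e, c, l, r)) = r"
  by (simp_all add: rcons_of_def)

lemma perm_on_permutes: "perm_on N f \<longleftrightarrow> f permutes {..<N}"
  unfolding perm_on_def
  by (metis bij_imp_permutes lessThan_iff not_le permutes_imp_bij permutes_not_in)

lemma (in lmap) cycle_walk: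
  assumes "cycl (e \<circ> s) (y # q)" "y \<in> D" "\<And>h. h \<in> set (y # q) \<Longrightarrow> c h \<or> l h = l (e h) + 1"
  shows "walk p (l (e y)) (map (\<lambda>h. (c h, l h)) (y # q))" "endl (l (e y)) (map (\<lambda>h. (c h, l h)) (y # q)) = l (e y)"
proof -
  have m: "map (e \<circ> s) (y # q) = q @ [y]" using assms(1) by (simp only: cycl_def rotate1.simps)
  have "walk p (l y) (map (\<lambda>h. (c h, l h)) q)" using boundary_walk[OF m assms(2)] assms(3) by simp
  moreover have "okw p (l (e y)) (c y, l y)" using step[OF assms(2)] assms(3)[of y] by auto
  ultimately show "walk p (l (e y)) (map (\<lambda>h. (c h, l h)) (y # q))" by simp
  have "endl (l (e y)) (map (\<lambda>h. (c h, l h)) (y # q)) = snd (last (map (\<lambda>h. (c h, l h)) (y # q)))"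
    unfolding endl_eq by simp
  also have "\<dots> = l (last (y # q))" by (subst last_map) auto
  finally show "endl (l (e y)) (map (\<lambda>h. (c h, l h)) (y # q)) = l (e y)" using last_label(1)[OF assms(1)] by simp
qed

text \<open>With a white root face all faces are monochromatic, and the labelled map is a pointed
  constellation whose distances are shifted by a constant.\<close>

locale white_lmap = lmap "{..<N}" s e p c l r for N s e p c l r +
  assumes p2: "p \<ge> 2" and rootwhite: "h \<in> orbit_of (e \<circ> s) r \<Longrightarrow> c h"
begin

abbreviation "M \<equiv> rcons_of N (s, e, c, l, r)"
abbreviation "v \<equiv> sinks N (s, e, c, l, r)"

lemma lab_orbit: "g \<in> orbit_of s h \<Longrightarrow> l g = l h"
  by (rule orbit_induct[OF s fin]) (simp_all add: lab)

lemma descend: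
  assumes "h < N" "\<not> sink s e c l h"
  obtains g where "g \<in> orbit_of s h" "g < N" "e g < N" "\<not> c g" "l (e g) + 1 = l g" "l g = l h"
proof -
  obtain g where g: "g \<in> orbit_of s h" "\<not> c g" "l (e g) + 1 = l g" using assms(2) unfolding sink_def by blast
  have "g \<in> {..<N}" using orbit_subset[OF s fin] g(1) assms(1) by blast
  moreover from this have "e g \<in> {..<N}" by (simp only: permutes_in_image[OF e])
  ultimately show ?thesis using that g lab_orbit[OF g(1)] by simp
qed

lemma M_vert: "vert M h = orbit_of s h" and M_face: "face M h = orbit_of (e \<circ> s) h"
  unfolding vert_def face_def by simp_all

lemma col_phi: assumes "h < N" shows "c (e (s h)) = c h"
proof (cases "h \<in> orbit_of (e \<circ> s) r")
  case True
  then have "(e \<circ> s) h \<in> orbit_of (e \<circ> s) r" using orbit_step[OF phi fin] by blast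
  then show ?thesis using rootwhite True by simp
next
  case False
  then show ?thesis using mono assms by simp
qed

text \<open>Follow outgoing falls until a sink is reached. One induction yields the oriented path of
  length \<open>l h - l k\<close> and, for any relation \<open>T\<close> that contains the moves
  \<open>s\<close> and \<open>e\<close>, connection both ways; as there is one sink, the map is
  connected.\<close>

lemma to_sink:
  assumes "h < N"
  shows "\<exists>k\<in>v. l k \<le> l h \<and> (orbit_of s h, orbit_of s k) \<in> oedges M ^^ (l h - l k) \<and>
    (\<forall>T. (\<forall>a<N. (a, s a) \<in> T) \<longrightarrow> (\<forall>a<N. (a, e a) \<in> T) \<longrightarrow> (h, k) \<in> T\<^sup>* \<and> (k, h) \<in> T\<^sup>*)"
  using assms
proof (induction "l h" arbitrary: h rule: less_induct)
  case less
  show ?case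
  proof (cases "sink s e c l h")
    case True
    then have "h \<in> v" using less.prems by (simp add: sinks_def)
    then show ?thesis by (intro bexI[of _ h]) auto
  next
    case False
    obtain g where g: "g \<in> orbit_of s h" "g < N" "e g < N" "\<not> c g" "l (e g) + 1 = l g" "l g = l h"
      using descend[OF less.prems False] .
    have "l (e g) < l h" using g by simp
    from less.hyps[OF this g(3)] obtain k where k: "k \<in> v" "l k \<le> l (e g)"
      "(orbit_of s (e g), orbit_of s k) \<in> oedges M ^^ (l (e g) - l k)"
      "\<And>T. (\<forall>a<N. (a, s a) \<in> T) \<Longrightarrow> (\<forall>a<N. (a, e a) \<in> T) \<Longrightarrow> (e g, k) \<in> T\<^sup>* \<and> (k, e g) \<in> T\<^sup>*" by blast
    have oe: "(orbit_of s h, orbit_of s (e g)) \<in> oedges M"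
    proof -
      have "c (e g)" using col_e[of g] g by simp
      moreover have "orbit_of s h = orbit_of s (e (e g))" using inv orbit_eq[OF s fin g(1)] by simp
      ultimately show ?thesis unfolding oedges_def M_vert using g(3) by auto
    qed
    have n: "l h - l k = Suc (l (e g) - l k)" using g k(2) by simp
    have "(orbit_of s h, orbit_of s k) \<in> oedges M ^^ (l h - l k)"
      unfolding n using relpow_Suc_I2[OF oe k(3)] .
    moreover have "(h, k) \<in> T\<^sup>* \<and> (k, h) \<in> T\<^sup>*" if T: "\<forall>a<N. (a, s a) \<in> T" "\<forall>a<N. (a, e a) \<in> T" for T
    proof -
      have o: "(x, y) \<in> T\<^sup>*" if "y \<in> orbit_of s x" "x < N" for x y
      proof -
        have "y \<in> {..<N} \<and> (x, y) \<in> T\<^sup>*"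
          using that(1)
        proof (rule orbit_induct[OF s fin])
          fix z assume z: "z \<in> {..<N} \<and> (x, z) \<in> T\<^sup>*"
          then have "s z \<in> {..<N}" by (simp only: permutes_in_image[OF s])
          moreover have "(z, s z) \<in> T" using T(1) z by simp
          ultimately show "s z \<in> {..<N} \<and> (x, s z) \<in> T\<^sup>*" using z by (meson rtrancl.rtrancl_into_rtrancl)
        qed (use that in simp)
        then show ?thesis by blast
      qed
      have hg: "(h, g) \<in> T\<^sup>*" "(g, h) \<in> T\<^sup>*" using o[OF g(1) less.prems] o[of h g] g(2) orbit_sym[OF s fin] g(1) by blast+
      have "(g, e g) \<in> T" using T(2) g(2) by blast
      moreover have "(e g, e (e g)) \<in> T" using T(2) g(3) by blast
      then have "(e g, g) \<in> T" using inv by simp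
      ultimately show ?thesis using k(4)[OF T] hg by (meson rtrancl.rtrancl_into_rtrancl rtrancl_trans)
    qed
    ultimately show ?thesis using k(1,2) g by (intro bexI[of _ k]) auto
  qed
qed

lemma to_sink_conn:
  assumes "h < N" "\<forall>a<N. (a, s a) \<in> T" "\<forall>a<N. (a, e a) \<in> T"
  obtains k where "k \<in> v" "(h, k) \<in> T\<^sup>*" "(k, h) \<in> T\<^sup>*"
proof -
  obtain k where k: "k \<in> v" and K: "\<forall>T. (\<forall>a<N. (a, s a) \<in> T) \<longrightarrow> (\<forall>a<N. (a, e a) \<in> T) \<longrightarrow> (h, k) \<in> T\<^sup>* \<and> (k, h) \<in> T\<^sup>*"
    using to_sink[OF assms(1)] by (elim bexE conjE)
  show ?thesis using that[OF k] mp[OF mp[OF spec[OF K, of T] assms(2)] assms(3)] by (elim conjE)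
qed

lemma v_props:
  obtains k where "k < N" "sink s e c l k" "v = orbit_of s k"
proof -
  have "r < N" using root by simp
  from to_sink[OF this] obtain k where "k \<in> v" by blast
  then have k: "k < N" "sink s e c l k" by (auto simp: sinks_def)
  have "v = orbit_of s k"
  proof (intro equalityI subsetI)
    fix h assume "h \<in> v"
    then show "h \<in> orbit_of s k" using uniq[of k h] k by (auto simp: sinks_def)
  next
    fix h assume h: "h \<in> orbit_of s k"
    have "h \<in> {..<N}" using orbit_subset[OF s fin] h k by blast
    moreover have "sink s e c l h" using k(2) unfolding sink_def orbit_eq[OF s fin h] .
    ultimately show "h \<in> v" by (simp add: sinks_def)
  qed
  then show ?thesis using that k by blast
qed

lemma v_vertex: "v \<in> vertices M"
proof -
  obtain k where "k < N" "v = orbit_of s k" using v_props by metis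
  then show ?thesis unfolding vertices_def M_vert by auto
qed

text \<open>Along an oriented edge the label drops by at most 1, so no path is shorter than the
  label difference; the path in \<open>to_sink\<close> attains this bound.\<close>

lemma relpow_le: "(orbit_of s x, orbit_of s y) \<in> oedges M ^^ k \<Longrightarrow> l x \<le> l y + k"
proof (induction k arbitrary: x)
  case 0
  then have "y \<in> orbit_of s x" using orbit_refl[OF s fin, of y] by simp
  then show ?case using lab_orbit by simp
next
  case (Suc k)
  then obtain u where u: "(orbit_of s x, u) \<in> oedges M" "(u, orbit_of s y) \<in> oedges M ^^ k" by (meson relpow_Suc_D2)
  then obtain h where h: "orbit_of s x = orbit_of s (e h)" "u = orbit_of s h" "h < N" "c h"
    unfolding oedges_def M_vert by auto
  have "e h \<in> orbit_of s x" unfolding h(1) by (rule orbit_refl[OF s fin])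
  then have "l x = l (e h)" using lab_orbit by simp
  also have "\<dots> \<le> l h + 1" using step[of h] h by auto
  finally show ?case using Suc.IH[of h] u h by simp
qed

lemma dist_eq:
  assumes "h < N" "k \<in> v"
  shows "l h = vtype M v (vert M h) + l k"
proof -
  obtain k0 where k0: "v = orbit_of s k0" using v_props by metis
  then have vk: "v = orbit_of s k" using assms(2) orbit_eq[OF s fin] by metis
  obtain k' where k': "k' \<in> v" "l k' \<le> l h" "(orbit_of s h, orbit_of s k') \<in> oedges M ^^ (l h - l k')"
    using to_sink[OF assms(1)] by blast
  have "l k' = l k" using k'(1) unfolding vk by (rule lab_orbit)
  moreover have "orbit_of s k' = v" using k'(1) unfolding vk by (rule orbit_eq[OF s fin])
  ultimately have path: "(orbit_of s h, v) \<in> oedges M ^^ (l h - l k)" and le: "l k \<le> l h" using k' by auto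
  have "vtype M v (vert M h) = l h - l k"
    unfolding vtype_def M_vert
  proof (rule Least_equality)
    show "(orbit_of s h, v) \<in> oedges M ^^ (l h - l k)" by (rule path)
    fix n assume "(orbit_of s h, v) \<in> oedges M ^^ n"
    then show "l h - l k \<le> n" using relpow_le[of h k n] unfolding vk by simp
  qed
  then show ?thesis using le by simp
qed

lemma rooted: "rooted_constellation p M"
  unfolding rooted_constellation_def is_planar_map_def
proof (intro conjI, simp_all add: perm_on_permutes s e)
  show "\<forall>h<N. e h \<noteq> h \<and> e (e h) = h" using fpf inv by simp
  show "\<forall>x<N. \<forall>y<N. (x, y) \<in> ({(a, s a) |a. a < N} \<union> {(a, e a) |a. a < N})\<^sup>*"
  proof (intro allI impI)
    fix x y assume xy: "x < N" "y < N"
    let ?T = "{(a, s a) |a. a < N} \<union> {(a, e a) |a. a < N}"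
    have T: "\<forall>a<N. (a, s a) \<in> ?T" "\<forall>a<N. (a, e a) \<in> ?T" by auto
    obtain k where k: "k \<in> v" "(x, k) \<in> ?T\<^sup>*" "(k, x) \<in> ?T\<^sup>*" using to_sink_conn[OF xy(1) T] .
    obtain k' where k': "k' \<in> v" "(y, k') \<in> ?T\<^sup>*" "(k', y) \<in> ?T\<^sup>*" using to_sink_conn[OF xy(2) T] .
    obtain k0 where k0: "v = orbit_of s k0" using v_props by metis
    have face_weight: "k' \<in> orbit_of s k" using k(1) k'(1) orbit_eq[OF s fin] unfolding k0 by metis
    have "k' \<in> {..<N} \<and> (k, k') \<in> ?T\<^sup>*"
      using face_weight
    proof (rule orbit_induct[OF s fin])
      show "k \<in> {..<N} \<and> (k, k) \<in> ?T\<^sup>*" using k(1) by (simp add: sinks_def)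
      fix z assume z: "z \<in> {..<N} \<and> (k, z) \<in> ?T\<^sup>*"
      then have "s z \<in> {..<N}" by (simp only: permutes_in_image[OF s])
      moreover have "(z, s z) \<in> ?T" using z by auto
      ultimately show "s z \<in> {..<N} \<and> (k, s z) \<in> ?T\<^sup>*" using z by (meson rtrancl.rtrancl_into_rtrancl)
    qed
    then show "(x, y) \<in> ?T\<^sup>*" using k(2) k'(3) by (meson rtrancl_trans)
  qed
  have "2 * (norb s {..<N} + norb (e \<circ> s) {..<N}) = N + 4" using euler by simp
  then show "card (vertices M) + card (faces M) = Suc (Suc (N div 2))"
    unfolding vertices_def faces_def M_vert M_face by (simp add: norb_def)
  show "\<forall>x\<ge>N. \<not> c x" using dflt by simp
  show "\<forall>h<N. c (e (s h)) = c h" using col_phi by blast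
  show "\<forall>h<N. c (e h) = (\<not> c h)" using col_e by simp
  show "\<forall>h<N. \<not> c h \<longrightarrow> card (face M h) = p" unfolding M_face using blk rootwhite by auto
  show "r < N" "c r" using root rootwhite orbit_refl[OF phi fin] by auto
  show "\<forall>h<N. c h \<longrightarrow> p dvd card (face M h)"
  proof (intro allI impI)
    fix h assume h: "h < N" "c h"
    obtain q where q: "cycl (e \<circ> s) (h # q)" using cycl_exists[OF phi fin] by blast
    have o: "orbit_of (e \<circ> s) h = set (h # q)" using cycl_orbit[OF q] by simp
    have white: "c g" if "g \<in> set (h # q)" for g
    proof -
      have "g \<in> {..<N} \<and> c g"
        using that unfolding o[symmetric]
      proof (rule orbit_induct[OF phi fin])
        fix z assume z: "z \<in> {..<N} \<and> c z"
        then have "(e \<circ> s) z \<in> {..<N}" by (simp only: permutes_in_image[OF phi])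
        then show "(e \<circ> s) z \<in> {..<N} \<and> c ((e \<circ> s) z)" using z col_phi[of z] by simp
      qed (use h in simp)
      then show ?thesis by blast
    qed
    let ?B = "map (\<lambda>h. (c h, l h)) (h # q)"
    \<comment> \<open>Around the face the labels return to their start, so \<open>white_len\<close>
      makes the degree a multiple of \<open>p\<close>.\<close>
    have "walk p (l (e h)) ?B" "endl (l (e h)) ?B = l (e h)" using cycle_walk[OF q] h white by simp_all
    moreover have "\<forall>z\<in>set ?B. fst z" using white by auto
    ultimately obtain k where "l (e h) + length ?B = l (e h) + k * p" using white_len[of p "l (e h)" ?B] p2 by auto
    moreover have "card (set (h # q)) = length (h # q)" using q by (intro distinct_card) (simp add: cycl_def)
    ultimately have "card (face M h) = k * p" unfolding M_face o by simp
    then show "p dvd card (face M h)" by simp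
  qed
qed

end

section \<open>Distances in a pointed constellation\<close>

locale pointed_constellation =
  fixes p :: nat and M :: rcons and v :: "nat set"
  assumes rc: "rooted_constellation p M" and vin: "v \<in> vertices M" and p2: "p \<ge> 2"
begin

abbreviation "D \<equiv> {..<nd M}"
abbreviation "d h \<equiv> vtype M v (vert M h)"

lemma sgp: "sg M permutes D" and alp: "al M permutes D"
  using rc unfolding rooted_constellation_def is_planar_map_def perm_on_permutes by auto

lemma al_al: "al M (al M h) = h"
proof (cases "h < nd M")
  case True
  then show ?thesis using rc unfolding rooted_constellation_def is_planar_map_def by auto
next
  case False
  then have "al M h = h" using alp by (simp add: permutes_def)
  then show ?thesis by simp
qed

sublocale rotsys D "sg M" "al M"
  by unfold_locales (use sgp alp al_al in auto)

lemma al_neq: "h < nd M \<Longrightarrow> al M h \<noteq> h"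
  and connected: "x < nd M \<Longrightarrow> y < nd M \<Longrightarrow> (x, y) \<in> ({(a, sg M a) | a. a < nd M} \<union> {(a, al M a) | a. a < nd M})\<^sup>*"
  and planar: "card (vertices M) + card (faces M) = nd M div 2 + 2"
  using rc unfolding rooted_constellation_def is_planar_map_def by auto

lemma wh_out: "\<not> h < nd M \<Longrightarrow> \<not> wh M h" and wh_phi: "h < nd M \<Longrightarrow> wh M (al M (sg M h)) = wh M h"
  and wh_al: "h < nd M \<Longrightarrow> wh M (al M h) \<longleftrightarrow> \<not> wh M h"
  and black_p: "h < nd M \<Longrightarrow> \<not> wh M h \<Longrightarrow> card (face M h) = p"
  and white_p: "h < nd M \<Longrightarrow> wh M h \<Longrightarrow> p dvd card (face M h)"
  and rt_lt: "rt M < nd M" and rt_wh: "wh M (rt M)"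
  using rc unfolding rooted_constellation_def by auto

lemma sg_lt: "sg M h < nd M \<longleftrightarrow> h < nd M" and al_lt: "al M h < nd M \<longleftrightarrow> h < nd M"
  using permutes_in_image[OF sgp, of h] permutes_in_image[OF alp, of h] by auto

lemma vert_sg: "vert M (sg M h) = vert M h"
  unfolding vert_def using orbit_eq_iff[OF sgp fin] orbit_step[OF sgp fin] orbit_refl[OF sgp fin] by metis

lemma vert_eq: "g \<in> vert M h \<Longrightarrow> vert M g = vert M h"
  unfolding vert_def by (rule orbit_eq[OF sgp fin])

lemma vert_lt: "g \<in> vert M h \<Longrightarrow> h < nd M \<Longrightarrow> g < nd M"
  unfolding vert_def using orbit_subset[OF sgp fin, of h] by auto

lemma edge: "h < nd M \<Longrightarrow> wh M h \<Longrightarrow> (vert M (al M h), vert M h) \<in> oedges M"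
  unfolding oedges_def by blast

lemma face_D: "h < nd M \<Longrightarrow> g \<in> face M h \<Longrightarrow> g < nd M \<and> wh M g = wh M h"
proof -
  assume h: "h < nd M" and g: "g \<in> face M h"
  show ?thesis
    using g unfolding face_def
  proof (rule orbit_induct[OF phi fin])
    fix z assume "z < nd M \<and> wh M z = wh M h"
    then show "(al M \<circ> sg M) z < nd M \<and> wh M ((al M \<circ> sg M) z) = wh M h" using wh_phi sg_lt al_lt by simp
  qed (use h in simp)
qed

text \<open>Around a black face the oriented edges all run against the face permutation and form a
  directed cycle.\<close>

lemma black_back: 
  assumes "y < nd M" "\<not> wh M y" "g \<in> face M y" shows "(vert M y, vert M g) \<in> (oedges M)\<^sup>*"
proof -
  let ?f = "al M \<circ> sg M"
  have st: "(vert M (?f z), vert M z) \<in> oedges M" if "z < nd M" "\<not> wh M z" for z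
  proof -
    have z: "sg M z < nd M" using that sg_lt by simp
    have "wh M (sg M z)" using wh_phi[OF that(1)] wh_al[OF z] that(2) by simp
    from edge[OF z this] show ?thesis by (simp add: vert_sg)
  qed
  have "y \<in> face M g" using assms(3) unfolding face_def using orbit_sym[OF phi fin] by blast
  then have "(vert M y, vert M g) \<in> (oedges M)\<^sup>* \<and> y < nd M \<and> \<not> wh M y"
    unfolding face_def
  proof (rule orbit_induct[OF phi fin])
    show "(vert M g, vert M g) \<in> (oedges M)\<^sup>* \<and> g < nd M \<and> \<not> wh M g" using face_D[OF assms(1,3)] assms(2) by simp
    fix z assume z: "(vert M z, vert M g) \<in> (oedges M)\<^sup>* \<and> z < nd M \<and> \<not> wh M z"
    then show "(vert M (?f z), vert M g) \<in> (oedges M)\<^sup>* \<and> ?f z < nd M \<and> \<not> wh M (?f z)"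
      using st[of z] wh_phi[of z] sg_lt al_lt by (auto intro: converse_rtrancl_into_rtrancl)
  qed
  then show ?thesis by blast
qed

text \<open>An oriented edge can be undone by going around its black face, so connectedness gives
  strong connectedness, and all distances are finite.\<close>

lemma reach:
  assumes "x < nd M" "y < nd M" shows "(vert M x, vert M y) \<in> (oedges M)\<^sup>*"
proof -
  have st: "(vert M a, vert M (al M a)) \<in> (oedges M)\<^sup>*" if a: "a < nd M" for a
  proof (cases "wh M a")
    case False
    have "al M a < nd M" "wh M (al M a)" using a False al_lt wh_al by simp_all
    from edge[OF this] show ?thesis by (simp add: al_al)
  next
    case True
    let ?z = "al M a"
    have z: "?z < nd M" "\<not> wh M ?z" using a True al_lt wh_al by simp_all
    have "?z \<in> face M ?z" unfolding face_def by (rule orbit_refl[OF phi fin])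
    \<comment> \<open>\<open>y\<close> precedes \<open>?z\<close> on the black face and sits at the
      vertex of \<open>a\<close>.\<close>
    obtain y where y: "(al M \<circ> sg M) y = ?z" using permutes_surj[OF phi] by (metis surjD)
    then have "sg M y = a" using al_al by (metis comp_apply)
    then have vy: "vert M y = vert M a" using vert_sg by metis
    have "y \<in> face M ?z" unfolding face_def using y orbit_step[OF phi fin, of y] orbit_refl[OF phi fin, of ?z] by metis
    then have "y < nd M" "\<not> wh M y" using face_D[OF z(1)] z(2) by auto
    moreover have "?z \<in> face M y" using \<open>y \<in> face M ?z\<close> unfolding face_def using orbit_sym[OF phi fin] by blast
    ultimately have "(vert M y, vert M ?z) \<in> (oedges M)\<^sup>*" by (rule black_back)
    then show ?thesis unfolding vy .
  qed
  show ?thesis using connected[OF assms]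
  proof (induction rule: rtrancl_induct)
    case (step b c)
    then have "(vert M b, vert M c) \<in> (oedges M)\<^sup>*" using st vert_sg by auto
    then show ?case using step.IH by (meson rtrancl_trans)
  qed simp
qed

lemma v_vert: obtains k where "k < nd M" "v = vert M k"
  using vin unfolding vertices_def by auto

lemma dist_path: assumes "h < nd M" shows "(vert M h, v) \<in> oedges M ^^ d h"
proof -
  obtain k where k: "k < nd M" "v = vert M k" by (rule v_vert)
  have "(vert M h, v) \<in> (oedges M)\<^sup>*" using reach[OF assms k(1)] k(2) by simp
  then obtain n where "(vert M h, v) \<in> oedges M ^^ n" by (meson rtrancl_imp_relpow)
  then show ?thesis unfolding vtype_def by (rule LeastI)
qed

lemma dist_le: "(vert M h, v) \<in> oedges M ^^ n \<Longrightarrow> d h \<le> n"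
  unfolding vtype_def by (rule Least_le)

lemma dist_edge: assumes "h < nd M" "wh M h" shows "d (al M h) \<le> d h + 1"
  using dist_le[of "al M h" "Suc (d h)"] relpow_Suc_I2[OF edge[OF assms] dist_path[OF assms(1)]] by simp

lemma dist_zero: assumes "vert M h = v" shows "d h = 0"
  using dist_le[of h 0] assms by simp

lemma dist_descend:
  assumes "h < nd M" "vert M h \<noteq> v"
  obtains g where "g \<in> vert M h" "g < nd M" "\<not> wh M g" "d (al M g) + 1 = d g"
proof -
  have "d h \<noteq> 0"
  proof
    assume "d h = 0"
    then show False using dist_path[OF assms(1)] assms(2) by simp
  qed
  then obtain n where n: "d h = Suc n" by (metis not0_implies_Suc)
  have "(vert M h, v) \<in> oedges M ^^ Suc n" using dist_path[OF assms(1)] unfolding n .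
  then obtain u where u: "(vert M h, u) \<in> oedges M" "(u, v) \<in> oedges M ^^ n" by (meson relpow_Suc_D2)
  then obtain g where g: "vert M h = vert M (al M g)" "u = vert M g" "g < nd M" "wh M g"
    unfolding oedges_def by auto
  have "al M g \<in> vert M h" unfolding g(1) unfolding vert_def by (rule orbit_refl[OF sgp fin])
  moreover have "d g \<le> n" using u g by (intro dist_le) simp
  then have "d (al M (al M g)) + 1 = d (al M g)" using dist_edge[OF g(3,4)] n g(1) al_al by simp
  moreover have "al M g < nd M" "\<not> wh M (al M g)" using g al_lt wh_al by simp_all
  ultimately show ?thesis using that by blast
qed

text \<open>The shift \<open>c0\<close> brings the root edge to a prescribed height; the value 0 off
  the darts is what \<open>dflt\<close> in \<open>lmap\<close> asks for.\<close>

abbreviation lab :: "nat \<Rightarrow> nat \<Rightarrow> nat" where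
  "lab c0 h \<equiv> (if h < nd M then d h + c0 else 0)"

lemma lab_sg: "lab c0 \<circ> sg M = lab c0"
  by (auto simp: fun_eq_iff sg_lt vert_sg)

text \<open>The deviation of an edge from a fall, signed by colour: 0 on falls and \<open>p\<close>
  on the white darts of rises. It is antisymmetric under \<open>al M\<close>.\<close>

definition kap :: "nat \<Rightarrow> int" where
  "kap h = int (lab 0 h) - int (lab 0 (al M h)) + (if wh M h then 1 else - 1)"

text \<open>Each dart has the same label as the dart opposite to its successor on the face, so the
  label differences cancel and only the colour signs remain.\<close>

lemma face_sum:
  assumes h: "h < nd M"
  shows "(\<Sum>g\<in>face M h. kap g) = (if wh M h then 1 else - 1) * int (card (face M h))"
proof -
  let ?f = "al M \<circ> sg M" and ?O = "face M h"
  have fO: "finite ?O" unfolding face_def using orbit_finite[OF phi fin] h by simp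
  have "?f ` ?O = ?O"
  proof (rule card_subset_eq[OF fO])
    show "?f ` ?O \<subseteq> ?O" unfolding face_def using orbit_step[OF phi fin] by blast
    show "card (?f ` ?O) = card ?O" using permutes_inj[OF phi] by (intro card_image) (rule inj_on_subset, auto)
  qed
  then have bij: "bij_betw ?f ?O ?O" unfolding bij_betw_def using permutes_inj[OF phi] by (metis inj_on_subset subset_UNIV)
  have "(\<Sum>g\<in>?O. int (lab 0 (al M g))) = (\<Sum>g\<in>?O. int (lab 0 (al M (?f g))))"
    using sum.reindex_bij_betw[OF bij, of "\<lambda>g. int (lab 0 (al M g))"] by simp
  also have "\<dots> = (\<Sum>g\<in>?O. int (lab 0 g))"
  proof (rule sum.cong[OF refl])
    fix g
    have "al M (?f g) = sg M g" using al_al by simp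
    then show "int (lab 0 (al M (?f g))) = int (lab 0 g)" by (simp add: sg_lt vert_sg)
  qed
  finally have "(\<Sum>g\<in>?O. kap g) = (\<Sum>g\<in>?O. if wh M g then 1 else - 1)"
    unfolding kap_def sum.distrib sum_subtractf by simp
  also have "\<dots> = (\<Sum>g\<in>?O. if wh M h then 1 else - 1)" using face_D[OF h] by (intro sum.cong) auto
  finally show ?thesis by simp
qed

lemma norb_vf: "norb (sg M) D = card (vertices M)" "norb (al M \<circ> sg M) D = card (faces M)"
  unfolding norb_def vertices_def faces_def vert_def face_def by simp_all

lemma norb_al: "norb (al M) D + nd M div 2 = nd M" "even (nd M)"
proof -
  have "{h \<in> D. al M h \<noteq> h} = D" using al_neq by auto
  then show "norb (al M) D + nd M div 2 = nd M" "even (nd M)" using norb_invol[OF fin alp al_al] by simp_all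
qed

lemma kap_dvd: assumes x: "x < nd M" shows "int p dvd kap x"
proof (rule cocycle_trivial[OF rotsys_axioms, of "lab 0" kap "int p" x])
  show "lab 0 \<circ> sg M = lab 0" by (rule lab_sg)
  show "norb (sg M) D + norb (al M) D + norb (al M \<circ> sg M) D = card D + 2"
    using planar norb_al norb_vf by simp
  show "kap (al M h) = - kap h" if "h \<in> D" for h
    using that wh_al[of h] by (simp add: kap_def al_al)
  \<comment> \<open>Off the pointed vertex a geodesic starts with a fall, on which
    \<open>kap\<close> vanishes; so the condition singles out the pointed vertex.\<close>
  have v: "vert M h = v" if "h \<in> D" "\<forall>g\<in>orbit_of (sg M) h. \<not> (int p dvd kap g \<and> lab 0 (al M g) < lab 0 g)" for h
  proof (rule ccontr)
    assume ne: "vert M h \<noteq> v"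
    have "h < nd M" using that(1) by simp
    then obtain g where g: "g \<in> vert M h" "g < nd M" "\<not> wh M g" "d (al M g) + 1 = d g"
      using dist_descend[OF _ ne] by blast
    then have "kap g = 0" "lab 0 (al M g) < lab 0 g" by (auto simp: kap_def al_lt)
    then show False using that(2) g(1) unfolding vert_def by auto
  qed
  show "h' \<in> orbit_of (sg M) h" if "h \<in> D" "h' \<in> D"
    "\<forall>g\<in>orbit_of (sg M) h. \<not> (int p dvd kap g \<and> lab 0 (al M g) < lab 0 g)"
    "\<forall>g\<in>orbit_of (sg M) h'. \<not> (int p dvd kap g \<and> lab 0 (al M g) < lab 0 g)" for h h'
    using v[OF that(1,3)] v[OF that(2,4)] unfolding vert_def using orbit_eq_iff[OF sgp fin] by metis
  show "int p dvd (\<Sum>g\<in>orbit_of (al M \<circ> sg M) h. kap g)" if "h \<in> D" for h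
  proof -
    have h: "h < nd M" using that by simp
    have "p dvd card (face M h)" using black_p[OF h] white_p[OF h] by (cases "wh M h") simp_all
    then have "int p dvd int (card (face M h))" by simp
    then show ?thesis using face_sum[OF h] unfolding face_def by simp
  qed
  show "kap h = 0" if "h \<in> D" "al M h = h" for h using that al_neq by auto
  show "x \<in> D" using x by simp
qed

text \<open>On black darts \<open>kap\<close> is at most 0, since distances drop by at most 1 along
  an edge. Over a black face the values add up to \<open>- p\<close>, so none is below
  \<open>- p\<close>; by divisibility each is 0 or \<open>- p\<close>, that is, a fall or a
  rise.\<close>

lemma step: assumes h: "h < nd M" "wh M h" shows "d (al M h) = d h + 1 \<or> d h = d (al M h) + (p - 1)"
proof -
  let ?y = "al M h"
  have y: "?y < nd M" "\<not> wh M ?y" using h al_lt wh_al by simp_all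
  have neg: "kap g \<le> 0" if "g < nd M" "\<not> wh M g" for g
  proof -
    have "al M g < nd M" "wh M (al M g)" using that al_lt wh_al by simp_all
    from dist_edge[OF this] show ?thesis using that by (simp add: kap_def al_al al_lt)
  qed
  have fO: "finite (face M ?y)" unfolding face_def using orbit_finite[OF phi fin] y by simp
  have yO: "?y \<in> face M ?y" unfolding face_def by (rule orbit_refl[OF phi fin])
  have "(\<Sum>g\<in>face M ?y. kap g) = - int p" using face_sum[OF y(1)] black_p[OF y] y by simp
  moreover have "(\<Sum>g\<in>face M ?y. kap g) = kap ?y + (\<Sum>g\<in>face M ?y - {?y}. kap g)" by (rule sum.remove[OF fO yO])
  moreover have "(\<Sum>g\<in>face M ?y - {?y}. kap g) \<le> 0" using neg face_D[OF y(1)] y(2) by (intro sum_nonpos) auto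
  ultimately have ge: "kap ?y \<ge> - int p" by linarith
  have dv: "int p dvd kap ?y" by (rule kap_dvd[OF y(1)])
  have le: "kap ?y \<le> 0" by (rule neg[OF y])
  have "kap ?y = 0 \<or> kap ?y = - int p"
  proof -
    obtain k where k: "kap ?y = int p * k" using dv by (rule dvdE)
    have "k \<le> 0" using le k p2 by (simp add: mult_le_0_iff)
    moreover have "k \<ge> - 1"
    proof (rule ccontr)
      assume "\<not> k \<ge> - 1"
      then have "int p * k \<le> int p * (- 2)" by (intro mult_left_mono) auto
      then show False using ge k p2 by simp
    qed
    ultimately have "k = 0 \<or> k = - 1" by linarith
    then show ?thesis using k by auto
  qed
  moreover have "kap ?y = int (d ?y) - int (d h) - 1" using h y by (simp add: kap_def al_al)
  ultimately show ?thesis using p2 by auto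
qed

lemma white_lmap: "white_lmap (nd M) (sg M) (al M) p (wh M) (lab c0) (rt M)"
proof
  show "al M h \<noteq> h" if "h \<in> D" for h using that al_neq by simp
  show "wh M (al M h) = (\<not> wh M h)" if "h \<in> D" for h using that wh_al by simp
  show "\<not> wh M h \<and> lab c0 h = 0" if "h \<notin> D" for h using that wh_out by simp
  show "lab c0 \<circ> sg M = lab c0" by (rule lab_sg)
  show "lab c0 (al M h) = lab c0 h + 1 \<or> lab c0 h = lab c0 (al M h) + (p - 1)" if "h \<in> D" "wh M h" for h
    using step[of h] that al_lt by auto
  show "rt M \<in> D" using rt_lt by simp
  have v: "vert M h = v" if h: "h \<in> D" "sink (sg M) (al M) (wh M) (lab c0) h" for h
  proof (rule ccontr)
    assume ne: "vert M h \<noteq> v"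
    have "h < nd M" using h(1) by simp
    then obtain g where g: "g \<in> vert M h" "g < nd M" "\<not> wh M g" "d (al M g) + 1 = d g"
      using dist_descend[OF _ ne] by blast
    then have "lab c0 (al M g) + 1 = lab c0 g" by (simp add: al_lt)
    then show False using h(2) g unfolding sink_def vert_def by blast
  qed
  show "h' \<in> orbit_of (sg M) h" if "h \<in> D" "h' \<in> D" "sink (sg M) (al M) (wh M) (lab c0) h" "sink (sg M) (al M) (wh M) (lab c0) h'" for h h'
    using v[OF that(1,3)] v[OF that(2,4)] unfolding vert_def using orbit_eq_iff[OF sgp fin] by metis
  show "wh M (al M (sg M h)) = wh M h" if "h \<in> D" for h using that wh_phi by simp
  show "card (orbit_of (al M \<circ> sg M) h) = p" if "h \<in> D" "\<not> wh M h" for h using black_p[of h] that unfolding face_def by simp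
  show rw: "wh M h" if "h \<in> orbit_of (al M \<circ> sg M) (rt M)" for h
    using face_D[OF rt_lt, of h] that rt_wh unfolding face_def by simp
  then show "lab c0 h = lab c0 (al M h) + 1" if "h \<in> orbit_of (al M \<circ> sg M) (rt M)" "\<not> wh M h" for h using that by blast
  have "2 * (nd M div 2) = nd M" using norb_al(2) by simp
  then show "2 * (norb (sg M) D + norb (al M \<circ> sg M) D) = card D + 4" using planar norb_vf by simp
  show "2 \<le> p" by (rule p2)
qed

lemma rcons_of_eq: "rcons_of (nd M) (sg M, al M, wh M, lab c0, rt M) = M"
  by (simp add: rcons_of_def)

lemma sinks_eq: "sinks (nd M) (sg M, al M, wh M, lab c0, rt M) = v"
proof -
  interpret W: white_lmap "nd M" "sg M" "al M" p "wh M" "lab c0" "rt M" by (rule white_lmap)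
  obtain k where k: "k < nd M" "v = vert M k" by (rule v_vert)
  have "sink (sg M) (al M) (wh M) (lab c0) k"
    unfolding sink_def
  proof
    fix g assume "g \<in> orbit_of (sg M) k"
    then have g: "g < nd M" "vert M g = v" using vert_lt[of g k] vert_eq[of g k] k unfolding vert_def by auto
    show "wh M g \<or> lab c0 (al M g) + 1 \<noteq> lab c0 g" using dist_zero[OF g(2)] g(1) al_lt by simp
  qed
  then have kin: "k \<in> W.v" using k(1) by (simp add: sinks_def)
  obtain k' where k': "k' < nd M" "sink (sg M) (al M) (wh M) (lab c0) k'" "W.v = orbit_of (sg M) k'"
    using W.v_props .
  have "vert M k = orbit_of (sg M) k'" unfolding vert_def by (rule orbit_eq[OF sgp fin kin[unfolded k'(3)]])
  then have "orbit_of (sg M) k' = v" unfolding k(2) by (rule sym)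
  then show ?thesis by (rule trans[OF k'(3)])
qed

end

section \<open>Isomorphism classes\<close>

definition relO :: "(nat \<Rightarrow> nat) \<Rightarrow> lm \<Rightarrow> lm" where
  "relO \<pi> = (\<lambda>(s, e, c, l, r). (\<pi> \<circ> s \<circ> inv \<pi>, \<pi> \<circ> e \<circ> inv \<pi>, c \<circ> inv \<pi>, l \<circ> inv \<pi>, \<pi> r))"

lemma orbit_conj:
  assumes "bij \<pi>" shows "orbit_of (\<pi> \<circ> f \<circ> inv \<pi>) (\<pi> x) = \<pi> ` orbit_of f x"
proof -
  have "((\<pi> \<circ> f \<circ> inv \<pi>) ^^ k) (\<pi> x) = \<pi> ((f ^^ k) x)" for k
    by (induction k) (use assms in \<open>simp_all add: bij_is_inj\<close>)
  then show ?thesis unfolding orbit_of_def by auto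
qed

locale relabel = lmap "{..<N}" s e p c l r for N s e p c l r +
  fixes \<pi> :: "nat \<Rightarrow> nat"
  assumes pi: "\<pi> permutes {..<N}"
begin

abbreviation "s' \<equiv> \<pi> \<circ> s \<circ> inv \<pi>"
abbreviation "e' \<equiv> \<pi> \<circ> e \<circ> inv \<pi>"
abbreviation "c' \<equiv> c \<circ> inv \<pi>"
abbreviation "l' \<equiv> l \<circ> inv \<pi>"

lemma bij: "bij \<pi>" using pi by (rule permutes_bij)

lemma inv_pi: "inv \<pi> (\<pi> x) = x" using bij by (simp add: bij_is_inj)

lemma pi_lt: "\<pi> h < N \<longleftrightarrow> h < N" using permutes_in_image[OF pi, of h] by simp

lemma pi_ex: "\<exists>h0. h = \<pi> h0" using bij by (metis bij_pointE)

lemma pi_ball: "(\<And>h. P (\<pi> h)) \<Longrightarrow> P h"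
  using pi_ex by metis

lemma phi'_eq: "e' \<circ> s' = \<pi> \<circ> (e \<circ> s) \<circ> inv \<pi>"
  by (simp add: fun_eq_iff inv_pi)

lemma orb_s': "orbit_of s' (\<pi> h) = \<pi> ` orbit_of s h"
  and orb_phi': "orbit_of (e' \<circ> s') (\<pi> h) = \<pi> ` orbit_of (e \<circ> s) h"
  unfolding phi'_eq by (rule orbit_conj[OF bij])+

lemma mem_pi: "\<pi> h \<in> \<pi> ` A \<longleftrightarrow> h \<in> A"
  using bij by (simp add: bij_is_inj inj_image_mem_iff)

lemma card_pi: "card (\<pi> ` A) = card A"
  using bij by (intro card_image) (meson bij_is_inj inj_on_subset subset_UNIV)

lemma inj_img: "inj ((`) \<pi>)"
  by (rule injI) (simp add: inj_image_eq_iff[OF bij_is_inj[OF bij]])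

lemma norb_conj: "norb (\<pi> \<circ> f \<circ> inv \<pi>) {..<N} = norb f {..<N}"
proof -
  have "orbit_of (\<pi> \<circ> f \<circ> inv \<pi>) ` {..<N} = orbit_of (\<pi> \<circ> f \<circ> inv \<pi>) ` \<pi> ` {..<N}"
    by (simp only: permutes_image[OF pi])
  also have "\<dots> = (`) \<pi> ` orbit_of f ` {..<N}" by (simp only: image_image orbit_conj[OF bij])
  finally have *: "orbit_of (\<pi> \<circ> f \<circ> inv \<pi>) ` {..<N} = (`) \<pi> ` orbit_of f ` {..<N}" .
  show ?thesis unfolding norb_def * by (rule card_image) (rule inj_on_subset[OF inj_img], simp)
qed

lemma sink': "sink s' e' c' l' (\<pi> h) \<longleftrightarrow> sink s e c l h"
  unfolding sink_def orb_s' by (simp add: inv_pi)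

lemma lmap': "lmap {..<N} s' e' p c' l' (\<pi> r)"
proof
  show "s' permutes {..<N}" "e' permutes {..<N}"
    using permutes_compose[OF permutes_inv[OF pi] permutes_compose[OF s pi]]
      permutes_compose[OF permutes_inv[OF pi] permutes_compose[OF e pi]] by (simp_all add: o_assoc)
  show "e' (e' h) = h" for h by (rule pi_ball[of _ h]) (simp add: inv_pi inv)
  show "e' h \<noteq> h" if "h \<in> {..<N}" for h
  proof -
    obtain h0 where h: "h = \<pi> h0" using pi_ex by blast
    then have "e h0 \<noteq> h0" using that fpf[of h0] by (simp add: pi_lt)
    then show ?thesis unfolding h by (simp add: inv_pi bij_is_inj[OF bij, THEN inj_eq])
  qed
  show "c' (e' h) = (\<not> c' h)" if "h \<in> {..<N}" for h
  proof -
    obtain h0 where h: "h = \<pi> h0" using pi_ex by blast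
    then show ?thesis using that col_e[of h0] by (simp add: inv_pi pi_lt)
  qed
  show "\<not> c' h \<and> l' h = 0" if "h \<notin> {..<N}" for h
  proof -
    obtain h0 where h: "h = \<pi> h0" using pi_ex by blast
    then show ?thesis using that dflt[of h0] by (simp add: inv_pi pi_lt)
  qed
  show "l' \<circ> s' = l'"
  proof
    fix h show "(l' \<circ> s') h = l' h" by (rule pi_ball[of _ h]) (simp add: inv_pi lab)
  qed
  show "l' (e' h) = l' h + 1 \<or> l' h = l' (e' h) + (p - 1)" if "h \<in> {..<N}" "c' h" for h
  proof -
    obtain h0 where h: "h = \<pi> h0" using pi_ex by blast
    then show ?thesis using that step[of h0] by (simp add: inv_pi pi_lt)
  qed
  show "\<pi> r \<in> {..<N}" using root by (simp add: pi_lt)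
  show "h' \<in> orbit_of s' h" if "h \<in> {..<N}" "h' \<in> {..<N}" "sink s' e' c' l' h" "sink s' e' c' l' h'" for h h'
  proof -
    obtain h0 h0' where h: "h = \<pi> h0" "h' = \<pi> h0'" using pi_ex by metis
    have "h0' \<in> orbit_of s h0" using that uniq[of h0 h0'] unfolding h sink' by (simp add: pi_lt)
    then show ?thesis unfolding h orb_s' by (rule imageI)
  qed
  show "c' (e' (s' h)) = c' h" if "h \<in> {..<N}" "h \<notin> orbit_of (e' \<circ> s') (\<pi> r)" for h
  proof -
    obtain h0 where h: "h = \<pi> h0" using pi_ex by blast
    have "h0 \<notin> orbit_of (e \<circ> s) r" using that(2) unfolding h orb_phi' mem_pi .
    then show ?thesis using that mono[of h0] unfolding h by (simp add: inv_pi pi_lt)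
  qed
  show "card (orbit_of (e' \<circ> s') h) = p" if "h \<in> {..<N}" "h \<notin> orbit_of (e' \<circ> s') (\<pi> r)" "\<not> c' h" for h
  proof -
    obtain h0 where h: "h = \<pi> h0" using pi_ex by blast
    have "h0 \<notin> orbit_of (e \<circ> s) r" using that(2) unfolding h orb_phi' mem_pi .
    then show ?thesis using that blk[of h0] unfolding h orb_phi' card_pi by (simp add: inv_pi pi_lt)
  qed
  show "l' h = l' (e' h) + 1" if "h \<in> orbit_of (e' \<circ> s') (\<pi> r)" "\<not> c' h" for h
  proof -
    obtain h0 where h: "h = \<pi> h0" using pi_ex by blast
    have "h0 \<in> orbit_of (e \<circ> s) r" using that(1) unfolding h orb_phi' mem_pi .
    from rootstep[OF this] show ?thesis using that(2) unfolding h by (simp add: inv_pi)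
  qed
  show "2 * (norb s' {..<N} + norb (e' \<circ> s') {..<N}) = card {..<N} + 4"
    unfolding phi'_eq norb_conj by (rule euler)
qed simp

lemma bword': "bword s e c l r B \<Longrightarrow> bword s' e' c' l' (\<pi> r) B"
proof -
  assume "bword s e c l r B"
  then obtain w where w: "cycl (e \<circ> s) (r # w)" "map (\<lambda>h. (c h, l h)) (r # w) = B" unfolding bword_def by auto
  have "cycl (e' \<circ> s') (map \<pi> (r # w))"
    unfolding cycl_def
  proof (intro conjI)
    show "distinct (map \<pi> (r # w))" using w(1) bij unfolding cycl_def distinct_map
      by (meson bij_is_inj inj_on_subset subset_UNIV)
    have "map (e' \<circ> s') (map \<pi> (r # w)) = map \<pi> (map (e \<circ> s) (r # w))" by (simp add: inv_pi)
    also have "\<dots> = rotate1 (map \<pi> (r # w))" using w(1) by (simp add: cycl_def rotate1_map)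
    finally show "map (e' \<circ> s') (map \<pi> (r # w)) = rotate1 (map \<pi> (r # w))" .
  qed simp
  moreover have "map (\<lambda>h. (c' h, l' h)) (map \<pi> (r # w)) = B" unfolding w(2)[symmetric] by (simp add: inv_pi)
  ultimately show ?thesis unfolding bword_def by auto
qed

lemma inner': "inner p {..<N} s' e' c' (\<pi> r) = inner p {..<N} s e c r"
proof -
  have "wfaces {..<N} s' e' c' = (`) \<pi> ` wfaces {..<N} s e c"
  proof (intro equalityI subsetI)
    fix F assume "F \<in> wfaces {..<N} s' e' c'"
    then obtain h where h: "F = orbit_of (e' \<circ> s') h" "h < N" "c' h" unfolding wfaces_def by auto
    obtain h0 where h0: "h = \<pi> h0" using pi_ex by blast
    have "F = \<pi> ` orbit_of (e \<circ> s) h0" using h(1) unfolding h0 orb_phi' .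
    moreover have "h0 < N" "c h0" using h h0 by (simp_all add: pi_lt inv_pi)
    ultimately show "F \<in> (`) \<pi> ` wfaces {..<N} s e c" unfolding wfaces_def by blast
  next
    fix F assume "F \<in> (`) \<pi> ` wfaces {..<N} s e c"
    then obtain h where h: "F = \<pi> ` orbit_of (e \<circ> s) h" "h < N" "c h" unfolding wfaces_def by auto
    then have "F = orbit_of (e' \<circ> s') (\<pi> h)" unfolding orb_phi' by simp
    moreover have "\<pi> h < N" "c' (\<pi> h)" using h by (simp_all add: pi_lt inv_pi)
    ultimately show "F \<in> wfaces {..<N} s' e' c'" unfolding wfaces_def by blast
  qed
  then have *: "wfaces {..<N} s' e' c' - {orbit_of (e' \<circ> s') (\<pi> r)} = (`) \<pi> ` (wfaces {..<N} s e c - {orbit_of (e \<circ> s) r})"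
    unfolding orb_phi' using image_set_diff[OF inj_img, of "wfaces {..<N} s e c" "{orbit_of (e \<circ> s) r}"] by simp
  have "inj_on ((`) \<pi>) X" for X using inj_img by (rule inj_on_subset) simp
  then show ?thesis unfolding inner_def * 
    by (simp add: image_mset_mset_set[symmetric] multiset.map_comp comp_def card_pi)
qed

end

lemma relO_lmaps:
  assumes "\<pi> permutes {..<N}" "M \<in> lmaps p {..<N} B m" shows "relO \<pi> M \<in> lmaps p {..<N} B m"
proof -
  obtain s e c l r where M: "M = (s, e, c, l, r)" by (cases M)
  have L: "lmap {..<N} s e p c l r" "bword s e c l r B" "inner p {..<N} s e c r = m" using assms(2) unfolding M lmaps_def by auto
  interpret relabel N s e p c l r \<pi>
    using L(1) assms(1) by (simp add: relabel_def relabel_axioms_def)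
  show ?thesis unfolding M relO_def lmaps_def using lmap' bword'[OF L(2)] inner' L(3) by simp
qed

lemma sinks_relO:
  assumes "\<pi> permutes {..<N}" "M \<in> lmaps p {..<N} B m" shows "sinks N (relO \<pi> M) = \<pi> ` sinks N M"
proof -
  obtain s e c l r where M: "M = (s, e, c, l, r)" by (cases M)
  have L: "lmap {..<N} s e p c l r" using assms(2) unfolding M lmaps_def by auto
  interpret relabel N s e p c l r \<pi>
    using L(1) assms(1) by (simp add: relabel_def relabel_axioms_def)
  show ?thesis
  proof (intro equalityI subsetI)
    fix h assume h: "h \<in> sinks N (relO \<pi> M)"
    obtain h0 where h0: "h = \<pi> h0" using pi_ex by blast
    have "h0 < N" "sink s e c l h0" using h unfolding h0 M relO_def sinks_def by (simp_all add: pi_lt sink')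
    then show "h \<in> \<pi> ` sinks N M" unfolding M sinks_def h0 by simp
  next
    fix h assume "h \<in> \<pi> ` sinks N M"
    then obtain h0 where "h = \<pi> h0" "h0 < N" "sink s e c l h0" unfolding M sinks_def by auto
    then show "h \<in> sinks N (relO \<pi> M)" unfolding M relO_def sinks_def by (simp add: pi_lt sink')
  qed
qed

lemma iso_relO:
  assumes "\<pi> permutes {..<N}" shows "iso_r (rcons_of N M) (rcons_of N (relO \<pi> M)) \<pi>"
proof -
  obtain s e c l r where M: "M = (s, e, c, l, r)" by (cases M)
  have "inv \<pi> (\<pi> x) = x" for x using assms by (simp add: permutes_inj)
  then show ?thesis unfolding iso_r_def M relO_def using permutes_imp_bij[OF assms] by simp
qed

text \<open>An isomorphism is prescribed on darts only; extended by the identity it is a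
  permutation. The conclusion compares records, since isomorphisms do not see labels.\<close>

lemma iso_is_relO:
  assumes "M1 \<in> lmaps p {..<N} B1 m1" "M2 \<in> lmaps p {..<N} B2 m2" "iso_r (rcons_of N M1) (rcons_of N M2) \<rho>"
  shows "\<exists>\<pi>. \<pi> permutes {..<N} \<and> rcons_of N M2 = rcons_of N (relO \<pi> M1) \<and> (\<forall>h<N. \<pi> h = \<rho> h)"
proof -
  obtain s1 e1 c1 l1 r1 where M1: "M1 = (s1, e1, c1, l1, r1)" by (cases M1)
  obtain s2 e2 c2 l2 r2 where M2: "M2 = (s2, e2, c2, l2, r2)" by (cases M2)
  have "lmap {..<N} s1 e1 p c1 l1 r1" "lmap {..<N} s2 e2 p c2 l2 r2" using assms(1,2) unfolding M1 M2 lmaps_def by auto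
  then interpret L1: lmap "{..<N}" s1 e1 p c1 l1 r1 + L2: lmap "{..<N}" s2 e2 p c2 l2 r2 .
  have iso: "bij_betw \<rho> {..<N} {..<N}" "\<And>h. h < N \<Longrightarrow> \<rho> (s1 h) = s2 (\<rho> h) \<and> \<rho> (e1 h) = e2 (\<rho> h) \<and> c2 (\<rho> h) = c1 h" "\<rho> r1 = r2"
    using assms(3) unfolding iso_r_def M1 M2 by auto
  define \<pi> where "\<pi> = (\<lambda>h. if h < N then \<rho> h else h)"
  have "bij_betw \<pi> {..<N} {..<N}" using iso(1) by (rule bij_betw_cong[THEN iffD1, rotated]) (simp add: \<pi>_def)
  then have pi: "\<pi> permutes {..<N}" by (rule bij_imp_permutes) (simp add: \<pi>_def)
  have ip: "inv \<pi> (\<pi> x) = x" for x using pi by (simp add: permutes_inj)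
  have pl: "\<pi> x < N \<longleftrightarrow> x < N" for x using permutes_in_image[OF pi, of x] by simp
  have ext: "f = g" if "\<And>h. f (\<pi> h) = g (\<pi> h)" for f g :: "nat \<Rightarrow> 'z"
  proof
    fix x
    obtain h where "x = \<pi> h" using permutes_surj[OF pi] by (metis surjD)
    then show "f x = g x" using that by simp
  qed
  have lt: "s1 h < N \<longleftrightarrow> h < N" "e1 h < N \<longleftrightarrow> h < N" for h
    using permutes_in_image[OF L1.s, of h] permutes_in_image[OF L1.e, of h] by simp_all
  have out: "s1 h = h" "e1 h = h" "s2 h = h" "e2 h = h" if "\<not> h < N" for h
    using that L1.s L1.e L2.s L2.e by (simp_all add: permutes_def)
  have "s2 = \<pi> \<circ> s1 \<circ> inv \<pi>"
    by (rule ext) (use iso(2) out in \<open>simp add: ip, simp add: \<pi>_def lt\<close>)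
  moreover have "e2 = \<pi> \<circ> e1 \<circ> inv \<pi>"
    by (rule ext) (use iso(2) out in \<open>simp add: ip, simp add: \<pi>_def lt\<close>)
  moreover have "c2 = c1 \<circ> inv \<pi>"
    by (rule ext) (use iso(2) L1.dflt L2.dflt in \<open>simp add: ip, simp add: \<pi>_def\<close>)
  moreover have "r2 = \<pi> r1" using iso(3) L1.root by (simp add: \<pi>_def)
  ultimately have "rcons_of N M2 = rcons_of N (relO \<pi> M1)" unfolding M1 M2 relO_def rcons_of_def by simp
  then show ?thesis using pi by (auto simp: \<pi>_def)
qed

text \<open>Two renamings with the same effect agree at the root dart, then along \<open>s\<close>
  and \<open>e\<close>, then everywhere by connectedness.\<close>

lemma relO_rigid:
  assumes M: "rooted_constellation p (rcons_of N M)" "\<pi> permutes {..<N}" "\<pi>' permutes {..<N}" "rcons_of N (relO \<pi> M) = rcons_of N (relO \<pi>' M)"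
  shows "\<pi> = \<pi>'"
proof -
  obtain s e c l r where Mr: "M = (s, e, c, l, r)" by (cases M)
  have ip: "inv \<pi> (\<pi> x) = x" "inv \<pi>' (\<pi>' x) = x" for x using assms(2,3) by (simp_all add: permutes_inj)
  have eq: "\<pi> \<circ> s \<circ> inv \<pi> = \<pi>' \<circ> s \<circ> inv \<pi>'" "\<pi> \<circ> e \<circ> inv \<pi> = \<pi>' \<circ> e \<circ> inv \<pi>'" "\<pi> r = \<pi>' r"
    using assms(4) unfolding Mr relO_def rcons_of_def by auto
  have st: "\<pi> (s x) = \<pi>' (s x)" "\<pi> (e x) = \<pi>' (e x)" if "\<pi> x = \<pi>' x" for x
  proof -
    have "inv \<pi> (\<pi>' x) = x" using ip(1)[of x] unfolding that .
    then show "\<pi> (s x) = \<pi>' (s x)" "\<pi> (e x) = \<pi>' (e x)"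
      using fun_cong[OF eq(1), of "\<pi>' x"] fun_cong[OF eq(2), of "\<pi>' x"] ip(2)[of x] by simp_all
  qed
  have rc: "r < N" "\<And>x y. x < N \<Longrightarrow> y < N \<Longrightarrow> (x, y) \<in> ({(a, s a) | a. a < N} \<union> {(a, e a) | a. a < N})\<^sup>*"
    using M(1) unfolding Mr rooted_constellation_def is_planar_map_def by auto
  have "\<pi> y = \<pi>' y" if y: "y < N" for y
    using rc(2)[OF rc(1) y]
  proof (induction rule: rtrancl_induct)
    case base then show ?case by (rule eq(3))
  next
    case (step b c) then show ?case using st by auto
  qed
  moreover have "\<pi> y = \<pi>' y" if "\<not> y < N" for y using that assms(2,3) by (simp add: permutes_def)
  ultimately show ?thesis by blast
qed

text \<open>A class may contain elements outside \<open>A\<close>, as an isomorphism does not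
  restrict a record beyond its darts; classes are therefore intersected with \<open>A\<close> before
  they are counted.\<close>

lemma quotient_card:
  assumes fin: "finite A" and rfl: "\<And>x. x \<in> A \<Longrightarrow> (x, x) \<in> r"
    and eq: "\<And>x y. x \<in> A \<Longrightarrow> y \<in> A \<Longrightarrow> (x, y) \<in> r \<Longrightarrow> r `` {x} = r `` {y}"
    and n: "\<And>x. x \<in> A \<Longrightarrow> card {y \<in> A. (x, y) \<in> r} = n"
  shows "card A = card (A // r) * n"
proof -
  have q: "A // r = (\<lambda>x. r `` {x}) ` A" unfolding quotient_def by auto
  have A: "A = (\<Union>X\<in>A // r. X \<inter> A)" unfolding q using rfl by auto
  have cl: "X \<inter> A = {y \<in> A. (x, y) \<in> r}" if "X = r `` {x}" for X x using that by auto
  have "card A = card (\<Union>X\<in>A // r. X \<inter> A)" by (rule arg_cong[OF A])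
  also have "\<dots> = (\<Sum>X\<in>A // r. card (X \<inter> A))"
  proof (rule card_UN_disjoint)
    show "finite (A // r)" unfolding q using fin by simp
    show "\<forall>X\<in>A // r. finite (X \<inter> A)" using fin by simp
    show "\<forall>X\<in>A // r. \<forall>Y\<in>A // r. X \<noteq> Y \<longrightarrow> (X \<inter> A) \<inter> (Y \<inter> A) = {}"
    proof (intro ballI impI)
      fix X Y assume XY: "X \<in> A // r" "Y \<in> A // r" "X \<noteq> Y"
      obtain x y where xy: "x \<in> A" "X = r `` {x}" "y \<in> A" "Y = r `` {y}" using XY unfolding q by auto
      have False if "z \<in> X" "z \<in> Y" "z \<in> A" for z
        using eq[OF xy(1) that(3)] eq[OF xy(3) that(3)] that(1,2) XY(3) unfolding xy by simp
      then show "(X \<inter> A) \<inter> (Y \<inter> A) = {}" by blast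
    qed
  qed
  also have "\<dots> = (\<Sum>X\<in>A // r. n)"
  proof (rule sum.cong)
    fix X assume "X \<in> A // r"
    then obtain x where x: "x \<in> A" "X = r `` {x}" unfolding q by auto
    show "card (X \<inter> A) = n" unfolding cl[OF x(2)] by (rule n[OF x(1)])
  qed simp
  finally show ?thesis by simp
qed

text \<open>By rigidity every class has \<open>fact N\<close> elements in the image of
  \<open>\<Psi>\<close>. The map \<open>\<Psi>\<close> forgets the labels; it is used once with and
  once without the pointed vertex.\<close>

lemma class_count:
  assumes fin: "finite O'" and obj: "\<And>M. M \<in> O' \<Longrightarrow> rooted_constellation p (rcons_of N M)"
    and closed: "\<And>M \<pi>. M \<in> O' \<Longrightarrow> \<pi> permutes {..<N} \<Longrightarrow> relO \<pi> M \<in> O'"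
    and inj: "inj_on \<Psi> O'" and rcons_of: "\<And>M M'. \<Psi> M = \<Psi> M' \<Longrightarrow> rcons_of N M = rcons_of N M'"
    and iso: "\<And>M1 M2. M1 \<in> O' \<Longrightarrow> M2 \<in> O' \<Longrightarrow> (\<Psi> M1, \<Psi> M2) \<in> r \<longleftrightarrow> (\<exists>\<pi>. \<pi> permutes {..<N} \<and> \<Psi> M2 = \<Psi> (relO \<pi> M1))"
    and eq: "\<And>M1 M2. M1 \<in> O' \<Longrightarrow> M2 \<in> O' \<Longrightarrow> (\<Psi> M1, \<Psi> M2) \<in> r \<Longrightarrow> r `` {\<Psi> M1} = r `` {\<Psi> M2}"
  shows "card ((\<Psi> ` O') // r) * fact N = card O'"
proof -
  have "card (\<Psi> ` O') = card ((\<Psi> ` O') // r) * fact N"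
  proof (rule quotient_card)
    fix x assume "x \<in> \<Psi> ` O'"
    then obtain M where M: "M \<in> O'" "x = \<Psi> M" by auto
    have id: "relO id M = M" unfolding relO_def by (cases M) simp
    show "(x, x) \<in> r" unfolding M(2) iso[OF M(1) M(1)] using id permutes_id by metis
    have "{y \<in> \<Psi> ` O'. (x, y) \<in> r} = (\<lambda>\<pi>. \<Psi> (relO \<pi> M)) ` {\<pi>. \<pi> permutes {..<N}}"
    proof (intro equalityI subsetI)
      fix y assume "y \<in> {y \<in> \<Psi> ` O'. (x, y) \<in> r}"
      then obtain M2 where M2: "M2 \<in> O'" "y = \<Psi> M2" "(\<Psi> M, \<Psi> M2) \<in> r" unfolding M(2) by auto
      then show "y \<in> (\<lambda>\<pi>. \<Psi> (relO \<pi> M)) ` {\<pi>. \<pi> permutes {..<N}}" using iso[OF M(1) M2(1)] by blast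
    next
      fix y assume "y \<in> (\<lambda>\<pi>. \<Psi> (relO \<pi> M)) ` {\<pi>. \<pi> permutes {..<N}}"
      then obtain \<pi> where pi: "\<pi> permutes {..<N}" "y = \<Psi> (relO \<pi> M)" by auto
      have "(\<Psi> M, \<Psi> (relO \<pi> M)) \<in> r" using iso[OF M(1) closed[OF M(1) pi(1)]] pi(1) by blast
      then show "y \<in> {y \<in> \<Psi> ` O'. (x, y) \<in> r}" unfolding M(2) pi(2) using closed[OF M(1) pi(1)] by blast
    qed
    moreover have "inj_on (\<lambda>\<pi>. \<Psi> (relO \<pi> M)) {\<pi>. \<pi> permutes {..<N}}"
    proof (rule inj_onI)
      fix \<pi> \<pi>' assume "\<pi> \<in> {\<pi>. \<pi> permutes {..<N}}" "\<pi>' \<in> {\<pi>. \<pi> permutes {..<N}}" "\<Psi> (relO \<pi> M) = \<Psi> (relO \<pi>' M)"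
      then show "\<pi> = \<pi>'" by (intro relO_rigid[OF obj[OF M(1)] _ _ rcons_of]) simp_all
    qed
    ultimately show "card {y \<in> \<Psi> ` O'. (x, y) \<in> r} = fact N"
      by (simp add: card_image card_permutations)
  next
    fix x y assume "x \<in> \<Psi> ` O'" "y \<in> \<Psi> ` O'" and xy: "(x, y) \<in> r"
    then obtain M1 M2 where M: "M1 \<in> O'" "x = \<Psi> M1" "M2 \<in> O'" "y = \<Psi> M2" by blast
    show "r `` {x} = r `` {y}" using eq[OF M(1,3)] xy unfolding M(2,4) by blast
  qed (use fin in simp)
  then show ?thesis using card_image[OF inj] by simp
qed

lemma iso_r_trans: "iso_r M M' \<pi> \<Longrightarrow> iso_r M' M'' \<pi>' \<Longrightarrow> iso_r M M'' (\<pi>' \<circ> \<pi>)"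
proof -
  assume a: "iso_r M M' \<pi>" "iso_r M' M'' \<pi>'"
  have "\<pi> h < nd M'" if "h < nd M" for h using a(1) that unfolding iso_r_def bij_betw_def by auto
  then show ?thesis using a unfolding iso_r_def by (auto intro: bij_betw_trans)
qed

text \<open>\<open>the_inv_into\<close> is an inverse on the darts only; for a constellation
  \<open>M\<close> the permutations stay among them.\<close>

lemma iso_r_sym:
  assumes "iso_r M M' \<pi>" "rooted_constellation p M"
  shows "iso_r M' M (the_inv_into {..<nd M} \<pi>)"
proof -
  let ?i = "the_inv_into {..<nd M} \<pi>"
  have b: "bij_betw \<pi> {..<nd M} {..<nd M'}" and n: "nd M = nd M'"
    and st: "\<And>h. h < nd M \<Longrightarrow> \<pi> (sg M h) = sg M' (\<pi> h) \<and> \<pi> (al M h) = al M' (\<pi> h) \<and> wh M' (\<pi> h) = wh M h" "\<pi> (rt M) = rt M'"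
    using assms(1) unfolding iso_r_def by auto
  have i: "?i (\<pi> h) = h" if "h < nd M" for h using b that unfolding bij_betw_def by (intro the_inv_into_f_f) auto
  have p: "sg M permutes {..<nd M}" "al M permutes {..<nd M}" "rt M < nd M"
    using assms(2) unfolding rooted_constellation_def is_planar_map_def perm_on_permutes by auto
  have lt: "sg M h < nd M" "al M h < nd M" if "h < nd M" for h
    using permutes_in_image[OF p(1), of h] permutes_in_image[OF p(2), of h] that by simp_all
  have ex: "\<exists>h0<nd M. h = \<pi> h0" if "h < nd M'" for h
    using b that unfolding bij_betw_def by (metis imageE lessThan_iff)
  show ?thesis
    unfolding iso_r_def
  proof (intro conjI allI impI)
    show "nd M' = nd M" using n by simp
    show "bij_betw ?i {..<nd M'} {..<nd M}" using b by (rule bij_betw_the_inv_into)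
    show "?i (rt M') = rt M" using st(2) i[OF p(3)] by simp
    fix h assume "h < nd M'"
    then obtain h0 where h: "h0 < nd M" "h = \<pi> h0" using ex by blast
    show "?i (sg M' h) = sg M (?i h)" using st(1)[OF h(1)] i h lt[OF h(1)] by metis
    show "?i (al M' h) = al M (?i h)" using st(1)[OF h(1)] i h lt[OF h(1)] by metis
    show "wh M (?i h) = wh M' h" using st(1)[OF h(1)] i h by simp
  qed
qed

lemma iso_rooted_eq:
  assumes "(M, M') \<in> iso_rooted" "rooted_constellation p M"
  shows "iso_rooted `` {M} = iso_rooted `` {M'}"
proof -
  obtain \<pi> where pi: "iso_r M M' \<pi>" using assms unfolding iso_rooted_def by auto
  have "(\<exists>\<rho>. iso_r M X \<rho>) \<longleftrightarrow> (\<exists>\<rho>. iso_r M' X \<rho>)" for X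
    using iso_r_trans[OF pi, of X] iso_r_trans[OF iso_r_sym[OF pi assms(2)], of X] by meson
  then show ?thesis unfolding iso_rooted_def by auto
qed

lemma iso_pointed_eq:
  assumes "((M, v), (M', v')) \<in> iso_pointed" "rooted_constellation p M" "v \<subseteq> {..<nd M}"
  shows "iso_pointed `` {(M, v)} = iso_pointed `` {(M', v')}"
proof -
  obtain \<pi> where pi: "iso_r M M' \<pi>" "\<pi> ` v = v'" using assms unfolding iso_pointed_def by auto
  let ?i = "the_inv_into {..<nd M} \<pi>"
  have "inj_on \<pi> {..<nd M}" using pi unfolding iso_r_def bij_betw_def by auto
  then have "?i ` v' = v" using assms(3) unfolding pi(2)[symmetric] image_image
    by (subst image_cong[OF refl, where g = "\<lambda>x. x"]) (auto intro: the_inv_into_f_f)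
  then have im: "\<rho> ` v = (\<rho> \<circ> ?i) ` v'" "\<rho> ` v' = (\<rho> \<circ> \<pi>) ` v" for \<rho> :: "nat \<Rightarrow> nat"
    using pi(2) by (simp_all only: image_comp[symmetric])
  have "(\<exists>\<rho>. iso_r M X \<rho> \<and> \<rho> ` v = u) \<longleftrightarrow> (\<exists>\<rho>. iso_r M' X \<rho> \<and> \<rho> ` v' = u)" for X u
    using iso_r_trans[OF pi(1), of X] iso_r_trans[OF iso_r_sym[OF pi(1) assms(2)], of X] im by metis
  then show ?thesis unfolding iso_pointed_def by auto
qed

text \<open>Every edge has exactly one white dart, and the white faces partition the white
  darts.\<close>

lemma nd_weight:
  assumes "rooted_constellation p M" "p \<ge> 2"
  shows "nd M = 2 * (p * sum_mset (weight_all p M))"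
    and "weight_all p M = add_mset (root_degree M div p) (weight_nonroot p M)"
    and "root_degree M = p * (root_degree M div p)"
proof -
  interpret pointed_constellation p M "vert M (rt M)"
  proof
    have "rt M < nd M" using assms(1) unfolding rooted_constellation_def by simp
    then show "vert M (rt M) \<in> vertices M" unfolding vertices_def by blast
  qed (use assms in simp_all)
  let ?W = "{h. h < nd M \<and> wh M h}" and ?B = "{h. h < nd M \<and> \<not> wh M h}"
  have fWF: "finite (white_faces M)" unfolding white_faces_def by (rule finite_subset[of _ "face M ` D"]) auto
  have "bij_betw (al M) ?W ?B"
    by (rule bij_betwI[where g = "al M"]) (use wh_al al_lt al_al in auto)
  then have "card ?W = card ?B" by (rule bij_betw_same_card)
  moreover have "nd M = card ?W + card ?B"
  proof -
    have "D = ?W \<union> ?B" by auto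
    then have "card D = card (?W \<union> ?B)" by (rule arg_cong)
    also have "\<dots> = card ?W + card ?B" by (intro card_Un_disjoint) auto
    finally show ?thesis by simp
  qed
  ultimately have 1: "nd M = 2 * card ?W" by simp
  have W: "?W = \<Union>(white_faces M)"
  proof (intro equalityI subsetI)
    fix h assume "h \<in> ?W"
    then show "h \<in> \<Union>(white_faces M)" unfolding white_faces_def using orbit_refl[OF phi fin, of h] unfolding face_def by auto
  next
    fix h assume "h \<in> \<Union>(white_faces M)"
    then show "h \<in> ?W" unfolding white_faces_def using face_D by auto
  qed
  have disj: "F \<inter> F' = {}" if FF: "F \<in> white_faces M" "F' \<in> white_faces M" "F \<noteq> F'" for F F'
  proof -
    obtain h h' where h: "F = orbit_of (al M \<circ> sg M) h" "F' = orbit_of (al M \<circ> sg M) h'" using FF unfolding white_faces_def face_def by auto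
    then have "F = F'" if "g \<in> F" "g \<in> F'" for g using that orbit_eq[OF phi fin, of g h] orbit_eq[OF phi fin, of g h'] by simp
    then show ?thesis using FF(3) by blast
  qed
  have cF: "card F = p * (card F div p)" if "F \<in> white_faces M" for F
    using that white_p unfolding white_faces_def by auto
  have fF: "finite F" if "F \<in> white_faces M" for F using that finite_subset[of F D] W by auto
  have "card ?W = (\<Sum>F\<in>white_faces M. card F)" unfolding W
    using card_UN_disjoint[OF fWF, of "\<lambda>F. F"] fF disj by simp
  also have "\<dots> = (\<Sum>F\<in>white_faces M. p * (card F div p))" using cF by (intro sum.cong) auto
  also have "\<dots> = p * sum_mset (weight_all p M)" unfolding weight_all_def sum_distrib_left[symmetric]
    by (simp add: sum_unfold_sum_mset)
  finally show "nd M = 2 * (p * sum_mset (weight_all p M))" using 1 by simp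
  have root: "face M (rt M) \<in> white_faces M" unfolding white_faces_def using rt_lt rt_wh by blast
  then show "root_degree M = p * (root_degree M div p)" unfolding root_degree_def by (rule cF)
  have "mset_set (white_faces M) = add_mset (face M (rt M)) (mset_set (white_faces M - {face M (rt M)}))"
    using mset_set.remove[OF fWF root] .
  then show "weight_all p M = add_mset (root_degree M div p) (weight_nonroot p M)"
    unfolding weight_all_def weight_nonroot_def root_degree_def by simp
qed

lemma white_lmaps:
  assumes "(s, e, c, l, r) \<in> lmaps p {..<N} B m" "\<forall>z\<in>set B. fst z" "p \<ge> 2"
  shows "white_lmap N s e p c l r" "root_degree (rcons_of N (s, e, c, l, r)) = length B"
    "weight_nonroot p (rcons_of N (s, e, c, l, r)) = m" "l (e r) = snd (last B)"
proof -
  have L: "lmap {..<N} s e p c l r" and bw: "bword s e c l r B" and inn: "inner p {..<N} s e c r = m"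
    using assms(1) unfolding lmaps_def by auto
  interpret lmap "{..<N}" s e p c l r by (rule L)
  obtain w where w: "cycl (e \<circ> s) (r # w)" "map (\<lambda>h. (c h, l h)) (r # w) = B" using bw unfolding bword_def by auto
  have o: "orbit_of (e \<circ> s) r = set (r # w)" using cycl_orbit[OF w(1)] by simp
  have wh: "c h" if "h \<in> set (r # w)" for h
  proof -
    have "(c h, l h) \<in> set B" unfolding w(2)[symmetric] using that by (auto simp: image_iff)
    then show ?thesis using assms(2) by auto
  qed
  show "white_lmap N s e p c l r"
    by unfold_locales (use wh o assms(3) in auto)
  have "card (set (r # w)) = length (r # w)" using w(1) by (intro distinct_card) (simp add: cycl_def)
  then show "root_degree (rcons_of N (s, e, c, l, r)) = length B"
    unfolding root_degree_def face_def w(2)[symmetric] using o by simp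
  show "weight_nonroot p (rcons_of N (s, e, c, l, r)) = m"
    unfolding inn[symmetric] inner_def weight_nonroot_def white_faces_def wfaces_def face_def by simp
  show "l (e r) = snd (last B)" by (rule root_label[OF bw])
qed

lemma lmaps_word_unique:
  assumes "M \<in> lmaps p D B m" "M \<in> lmaps p D B' m'" shows "B = B'"
proof -
  obtain s e c l r where M: "M = (s, e, c, l, r)" by (cases M)
  obtain w w' where "cycl (e \<circ> s) (r # w)" "map (\<lambda>h. (c h, l h)) (r # w) = B"
    "cycl (e \<circ> s) (r # w')" "map (\<lambda>h. (c h, l h)) (r # w') = B'"
    using assms unfolding M lmaps_def bword_def by auto
  then show ?thesis using cycl_unique by metis
qed

text \<open>Labels are distances to the sink plus a constant, and the label of one dart fixes the
  constant.\<close>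

lemma rcons_of_inj_lab:
  assumes "white_lmap N s e p c l1 r" "white_lmap N s e p c l2 r"
    and "sinks N (s, e, c, l1, r) = sinks N (s, e, c, l2, r)" and "l1 (e r) = l2 (e r)"
  shows "l1 = l2"
proof
  interpret L1: white_lmap N s e p c l1 r by fact
  interpret L2: white_lmap N s e p c l2 r by fact
  have rcons_of: "L1.M = L2.M" by (simp add: rcons_of_def)
  obtain k where k: "k < N" "L1.v = orbit_of s k" using L1.v_props by metis
  have kv: "k \<in> L1.v" unfolding k(2) by (rule orbit_refl[OF L1.s L1.fin])
  then have kv2: "k \<in> L2.v" using assms(3) by simp
  have d: "l1 h = vtype L1.M L1.v (vert L1.M h) + l1 k" "l2 h = vtype L1.M L1.v (vert L1.M h) + l2 k" if "h < N" for h
    using L1.dist_eq[OF that kv] L2.dist_eq[OF that kv2] unfolding assms(3)[symmetric] rcons_of[symmetric] by blast+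
  have "e r < N" using L1.root permutes_in_image[OF L1.e, of r] by simp
  then have "l1 k = l2 k" using d[of "e r"] assms(4) by simp
  then show "l1 h = l2 h" for h using d[of h] L1.dflt[of h] L2.dflt[of h] by (cases "h < N") auto
qed

section \<open>Labelled maps that represent constellations\<close>

definition pconst :: "nat \<Rightarrow> nat \<Rightarrow> nat multiset \<Rightarrow> (rcons \<times> nat set) set" where
  "pconst p i a = {(M, v). rooted_constellation p M \<and> v \<in> vertices M \<and>
     vtype M v (vert M (rt M)) + 1 = vtype M v (vert M (al M (rt M))) \<and>
     vtype M v (vert M (al M (rt M))) \<le> i \<and> weight_all p M = a}"

definition rconst :: "nat \<Rightarrow> nat \<Rightarrow> nat multiset \<Rightarrow> rcons set" where
  "rconst p n m = {M. rooted_constellation p M \<and> root_degree M = n * p \<and> weight_nonroot p M = m}"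

text \<open>The root edge always carries the labels \<open>i\<close> and \<open>i - 1\<close>, even
  if its type is a smaller \<open>j\<close> to \<open>j - 1\<close>: the labels are the distances
  plus \<open>i - j\<close>. This matches the condition \<open>j \<le> i\<close> in
  \<open>Vgf\<close>.\<close>

definition Opointed :: "nat \<Rightarrow> nat \<Rightarrow> nat multiset \<Rightarrow> lm set" where
  "Opointed p i a = (\<Union>Q\<in>inner_face_words p (i - 1) a. lmaps p {..<2 * (p * sum_mset a)} ((True, i - 1) # Q) (a - {#face_weight p Q#}))"

definition exwords :: "nat \<Rightarrow> nat \<Rightarrow> (bool \<times> nat) list set" where
  "exwords p n = {B. length B = n * p \<and> (\<forall>z\<in>set B. fst z) \<and> walk p 0 B \<and> endl 0 B = 0}"

text \<open>The root edge starts at label 0, from where no fall is possible; so its origin is the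
  sink, and the root determines the pointed vertex.\<close>

definition Orooted :: "nat \<Rightarrow> nat \<Rightarrow> nat multiset \<Rightarrow> lm set" where
  "Orooted p n m = (\<Union>B\<in>exwords p n. lmaps p {..<2 * (n * p + p * sum_mset m)} B m)"

context pointed_constellation
begin

lemma root_word:
  obtains w where "bword (sg M) (al M) (wh M) (lab c0) (rt M) ((True, lab c0 (rt M)) # w)"
    "\<forall>z\<in>set w. fst z" "walk p (lab c0 (al M (rt M))) ((True, lab c0 (rt M)) # w)"
    "endl (lab c0 (al M (rt M))) ((True, lab c0 (rt M)) # w) = lab c0 (al M (rt M))"
    "length w + 1 = root_degree M"
proof -
  interpret W: white_lmap "nd M" "sg M" "al M" p "wh M" "lab c0" "rt M" by (rule white_lmap)
  obtain q where q: "cycl (al M \<circ> sg M) (rt M # q)" using cycl_exists[OF phi fin] by blast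
  have o: "orbit_of (al M \<circ> sg M) (rt M) = set (rt M # q)" using cycl_orbit[OF q] by simp
  have white: "wh M h" if "h \<in> set (rt M # q)" for h using W.rootwhite that unfolding o by blast
  let ?B = "map (\<lambda>h. (wh M h, lab c0 h)) (rt M # q)"
  have B: "?B = (True, lab c0 (rt M)) # map (\<lambda>h. (wh M h, lab c0 h)) q" using rt_wh by simp
  have cw: "walk p (lab c0 (al M (rt M))) ?B" "endl (lab c0 (al M (rt M))) ?B = lab c0 (al M (rt M))"
    by (rule W.cycle_walk[OF q]; use W.root white in blast)+
  have "card (set (rt M # q)) = length (rt M # q)" using q by (intro distinct_card) (simp add: cycl_def)
  then have "length (map (\<lambda>h. (wh M h, lab c0 h)) q) + 1 = root_degree M" unfolding root_degree_def face_def o by simp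
  moreover have "bword (sg M) (al M) (wh M) (lab c0) (rt M) ?B" unfolding bword_def using q by blast
  moreover have "\<forall>z\<in>set (map (\<lambda>h. (wh M h, lab c0 h)) q). fst z" using white by auto
  ultimately show ?thesis using that cw unfolding B by blast
qed

lemma inner_eq: "inner p D (sg M) (al M) (wh M) (rt M) = weight_nonroot p M"
  unfolding inner_def weight_nonroot_def white_faces_def wfaces_def face_def by simp

lemma lab_lmap: "lmap D (sg M) (al M) p (wh M) (lab c0) (rt M)"
  using white_lmap unfolding white_lmap_def by blast

end

lemma Opointed_image:
  assumes p: "p \<ge> 2" and i: "i \<ge> 1"
  shows "(\<lambda>M. (rcons_of (2 * (p * sum_mset a)) M, sinks (2 * (p * sum_mset a)) M)) ` Opointed p i a = pconst p i a"
    and "inj_on (\<lambda>M. (rcons_of (2 * (p * sum_mset a)) M, sinks (2 * (p * sum_mset a)) M)) (Opointed p i a)"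
    and "M \<in> Opointed p i a \<Longrightarrow> rooted_constellation p (rcons_of (2 * (p * sum_mset a)) M)"
proof -
  let ?N = "2 * (p * sum_mset a)"
  let ?f = "\<lambda>M. (rcons_of ?N M, sinks ?N M)"
  have slice: "\<exists>Q. Q \<in> face_words p (i - 1) \<and> face_weight p Q \<in># a \<and> (s, e, c, l, r) \<in> lmaps p {..<?N} ((True, i - 1) # Q) (a - {#face_weight p Q#}) \<and>
      white_lmap ?N s e p c l r \<and> l (e r) = i \<and> l r = i - 1" if mem: "(s, e, c, l, r) \<in> Opointed p i a" for s e c l r
  proof -
    obtain Q where Q: "Q \<in> face_words p (i - 1)" "face_weight p Q \<in># a" and M: "(s, e, c, l, r) \<in> lmaps p {..<?N} ((True, i - 1) # Q) (a - {#face_weight p Q#})"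
      using mem unfolding Opointed_def inner_face_words_def by auto
    have white: "\<forall>z\<in>set ((True, i - 1) # Q). fst z" using Q unfolding face_words_def by simp
    note wo = white_lmaps[OF M white p]
    have "snd (last ((True, i - 1) # Q)) = i" using Q(1) i endl_eq[of "i - 1" Q] unfolding face_words_def by (auto split: if_splits)
    moreover have "l r = i - 1"
    proof -
      have "bword s e c l r ((True, i - 1) # Q)" using M unfolding lmaps_def by auto
      then show ?thesis by (rule bwordE) simp
    qed
    ultimately show ?thesis using Q M wo by auto
  qed
  show "rooted_constellation p (rcons_of ?N M)" if "M \<in> Opointed p i a" for M
  proof -
    obtain s e c l r where M: "M = (s, e, c, l, r)" by (cases M)
    show ?thesis using slice[of s e c l r] that white_lmap.rooted unfolding M by blast
  qed
  show "inj_on ?f (Opointed p i a)"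
  proof (rule inj_onI)
    fix M1 M2 assume a: "M1 \<in> Opointed p i a" "M2 \<in> Opointed p i a" "?f M1 = ?f M2"
    obtain s e c l1 r where M1: "M1 = (s, e, c, l1, r)" by (cases M1)
    obtain s2 e2 c2 l2 r2 where M2: "M2 = (s2, e2, c2, l2, r2)" by (cases M2)
    have eq: "s2 = s" "e2 = e" "c2 = c" "r2 = r" using a(3) unfolding M1 M2 rcons_of_def by auto
    have sk: "sinks ?N (s, e, c, l1, r) = sinks ?N (s, e, c, l2, r)" using a(3) unfolding M1 M2 eq by simp
    have "white_lmap ?N s e p c l1 r" "l1 (e r) = i" using slice a(1) unfolding M1 by blast+
    moreover have "white_lmap ?N s e p c l2 r" "l2 (e r) = i" using slice a(2) unfolding M2 eq by blast+
    ultimately have "l1 = l2" using rcons_of_inj_lab[OF _ _ sk] by simp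
    then show "M1 = M2" unfolding M1 M2 eq by simp
  qed
  show "?f ` Opointed p i a = pconst p i a"
  proof (intro equalityI subsetI)
    fix X assume "X \<in> ?f ` Opointed p i a"
    then obtain s e c l r where M: "(s, e, c, l, r) \<in> Opointed p i a" and X: "X = ?f (s, e, c, l, r)" by auto
    obtain Q where Q: "Q \<in> face_words p (i - 1)" "face_weight p Q \<in># a" "(s, e, c, l, r) \<in> lmaps p {..<?N} ((True, i - 1) # Q) (a - {#face_weight p Q#})"
      "white_lmap ?N s e p c l r" "l (e r) = i" "l r = i - 1" using slice[OF M] by blast
    have white: "\<forall>z\<in>set ((True, i - 1) # Q). fst z" using Q unfolding face_words_def by simp
    note wo = white_lmaps[OF Q(3) white p]
    interpret W: white_lmap ?N s e p c l r by (rule Q(4))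
    obtain k where k: "k < ?N" "W.v = orbit_of s k" using W.v_props by metis
    have kv: "k \<in> W.v" unfolding k(2) by (rule orbit_refl[OF W.s W.fin])
    have lt: "r < ?N" "e r < ?N" using W.root permutes_in_image[OF W.e, of r] by simp_all
    have d: "i - 1 = vtype W.M W.v (vert W.M r) + l k" "i = vtype W.M W.v (vert W.M (e r)) + l k"
      using W.dist_eq[OF lt(1) kv] W.dist_eq[OF lt(2) kv] Q(5,6) by simp_all
    have "weight_all p W.M = a"
      unfolding nd_weight(2)[OF W.rooted p] wo(2,3) using Q(2) by (simp add: face_weight_def)
    moreover have "vtype W.M W.v (vert W.M (rt W.M)) + 1 = vtype W.M W.v (vert W.M (al W.M (rt W.M)))"
      "vtype W.M W.v (vert W.M (al W.M (rt W.M))) \<le> i"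
    proof -
      have "vtype W.M W.v (vert W.M r) + 1 = vtype W.M W.v (vert W.M (e r))" "vtype W.M W.v (vert W.M (e r)) \<le> i"
        using d i by linarith+
      then show "vtype W.M W.v (vert W.M (rt W.M)) + 1 = vtype W.M W.v (vert W.M (al W.M (rt W.M)))"
        "vtype W.M W.v (vert W.M (al W.M (rt W.M))) \<le> i" unfolding rcons_of_simps .
    qed
    ultimately show "X \<in> pconst p i a" unfolding X pconst_def using W.rooted W.v_vertex by simp
  next
    fix X assume "X \<in> pconst p i a"
    then obtain M v where X: "X = (M, v)" and rc: "rooted_constellation p M" and v: "v \<in> vertices M"
      and fall: "vtype M v (vert M (rt M)) + 1 = vtype M v (vert M (al M (rt M)))" and le: "vtype M v (vert M (al M (rt M))) \<le> i"
      and wa: "weight_all p M = a" unfolding pconst_def by auto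
    interpret pointed_constellation p M v by unfold_locales (use rc v p in simp_all)
    \<comment> \<open>Lifts the origin of the root edge from its distance to the label
      \<open>i\<close>; the subtraction does not truncate because the distance is at most
      \<open>i\<close>.\<close>
    define c0 where "c0 = i - d (al M (rt M))"
    have N: "nd M = ?N" using nd_weight(1)[OF rc p] wa by simp
    have art: "al M (rt M) < nd M" using rt_lt al_lt by simp
    have la: "lab c0 (al M (rt M)) = i" "lab c0 (rt M) = i - 1" using le fall art rt_lt unfolding c0_def by auto
    obtain w where w: "bword (sg M) (al M) (wh M) (lab c0) (rt M) ((True, lab c0 (rt M)) # w)"
      "\<forall>z\<in>set w. fst z" "walk p (lab c0 (al M (rt M))) ((True, lab c0 (rt M)) # w)"
      "endl (lab c0 (al M (rt M))) ((True, lab c0 (rt M)) # w) = lab c0 (al M (rt M))"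
      "length w + 1 = root_degree M" using root_word .
    have face_words: "w \<in> face_words p (i - 1)" unfolding face_words_def using w(2-4) i unfolding la by simp
    have face_weight: "face_weight p w = root_degree M div p" unfolding face_weight_def w(5) ..
    have a: "a = add_mset (face_weight p w) (weight_nonroot p M)" using nd_weight(2)[OF rc p] wa face_weight by simp
    have "w \<in> inner_face_words p (i - 1) a" unfolding inner_face_words_def using face_words a by simp
    moreover have "(sg M, al M, wh M, lab c0, rt M) \<in> lmaps p {..<?N} ((True, i - 1) # w) (a - {#face_weight p w#})"
      unfolding N[symmetric] lmaps_def mem_Collect_eq prod.case
    proof (intro conjI)
      show "lmap D (sg M) (al M) p (wh M) (lab c0) (rt M)" by (rule lab_lmap)
      show "bword (sg M) (al M) (wh M) (lab c0) (rt M) ((True, i - 1) # w)" using w(1) unfolding la(2) .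
      show "inner p D (sg M) (al M) (wh M) (rt M) = a - {#face_weight p w#}" unfolding inner_eq using a by simp
    qed
    ultimately have "(sg M, al M, wh M, lab c0, rt M) \<in> Opointed p i a" unfolding Opointed_def by blast
    moreover have "X = ?f (sg M, al M, wh M, lab c0, rt M)"
      unfolding N[symmetric] X rcons_of_eq[of c0] sinks_eq[of c0] ..
    ultimately show "X \<in> ?f ` Opointed p i a" by blast
  qed
qed

lemma Orooted_image:
  assumes p: "p \<ge> 2" and n: "n \<ge> 1"
  shows "rcons_of (2 * (n * p + p * sum_mset m)) ` Orooted p n m = rconst p n m"
    and "inj_on (rcons_of (2 * (n * p + p * sum_mset m))) (Orooted p n m)"
    and "M \<in> Orooted p n m \<Longrightarrow> rooted_constellation p (rcons_of (2 * (n * p + p * sum_mset m)) M)"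
proof -
  let ?N = "2 * (n * p + p * sum_mset m)"
  have OFE: "\<exists>B. B \<in> exwords p n \<and> (s, e, c, l, r) \<in> lmaps p {..<?N} B m \<and> white_lmap ?N s e p c l r \<and> l (e r) = 0 \<and>
      sinks ?N (s, e, c, l, r) = orbit_of s (e r)" if mem: "(s, e, c, l, r) \<in> Orooted p n m" for s e c l r
  proof -
    obtain B where B: "B \<in> exwords p n" and M: "(s, e, c, l, r) \<in> lmaps p {..<?N} B m"
      using mem unfolding Orooted_def by auto
    have white: "\<forall>z\<in>set B. fst z" using B unfolding exwords_def by simp
    note wo = white_lmaps[OF M white p]
    interpret W: white_lmap ?N s e p c l r by (rule wo(1))
    have "B \<noteq> []" using B n p unfolding exwords_def by auto
    then have "snd (last B) = 0" using B endl_eq[of 0 B] unfolding exwords_def by simp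
    then have z: "l (e r) = 0" using wo(4) by simp
    have "e r < ?N" using W.root permutes_in_image[OF W.e, of r] by simp
    moreover have "sink s e c l (e r)" unfolding sink_def using W.lab_orbit[of _ "e r"] z by simp
    ultimately have "e r \<in> W.v" unfolding sinks_def by simp
    moreover obtain k where k: "W.v = orbit_of s k" using W.v_props by metis
    ultimately have "W.v = orbit_of s (e r)" using orbit_eq[OF W.s W.fin] by simp
    then show ?thesis using B M wo(1) z by blast
  qed
  show "rooted_constellation p (rcons_of ?N M)" if "M \<in> Orooted p n m" for M
  proof -
    obtain s e c l r where M: "M = (s, e, c, l, r)" by (cases M)
    show ?thesis using OFE[of s e c l r] that white_lmap.rooted unfolding M by blast
  qed
  show "inj_on (rcons_of ?N) (Orooted p n m)"
  proof (rule inj_onI)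
    fix M1 M2 assume a: "M1 \<in> Orooted p n m" "M2 \<in> Orooted p n m" "rcons_of ?N M1 = rcons_of ?N M2"
    obtain s e c l1 r where M1: "M1 = (s, e, c, l1, r)" by (cases M1)
    obtain s2 e2 c2 l2 r2 where M2: "M2 = (s2, e2, c2, l2, r2)" by (cases M2)
    have eq: "s2 = s" "e2 = e" "c2 = c" "r2 = r" using a(3) unfolding M1 M2 rcons_of_def by auto
    have 1: "white_lmap ?N s e p c l1 r" "l1 (e r) = 0" "sinks ?N (s, e, c, l1, r) = orbit_of s (e r)"
      using OFE a(1) unfolding M1 by blast+
    have 2: "white_lmap ?N s e p c l2 r" "l2 (e r) = 0" "sinks ?N (s, e, c, l2, r) = orbit_of s (e r)"
      using OFE a(2) unfolding M2 eq by blast+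
    have "l1 = l2" using rcons_of_inj_lab[OF 1(1) 2(1)] 1(2,3) 2(2,3) by simp
    then show "M1 = M2" unfolding M1 M2 eq by simp
  qed
  show "rcons_of ?N ` Orooted p n m = rconst p n m"
  proof (intro equalityI subsetI)
    fix X assume "X \<in> rcons_of ?N ` Orooted p n m"
    then obtain s e c l r where M: "(s, e, c, l, r) \<in> Orooted p n m" and X: "X = rcons_of ?N (s, e, c, l, r)" by auto
    obtain B where B: "B \<in> exwords p n" "(s, e, c, l, r) \<in> lmaps p {..<?N} B m" "white_lmap ?N s e p c l r" using OFE[OF M] by blast
    have white: "\<forall>z\<in>set B. fst z" using B unfolding exwords_def by simp
    note wo = white_lmaps[OF B(2) white p]
    interpret W: white_lmap ?N s e p c l r by (rule B(3))
    have "length B = n * p" using B(1) unfolding exwords_def by simp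
    then show "X \<in> rconst p n m" unfolding X rconst_def using W.rooted wo(2,3) by simp
  next
    fix M assume "M \<in> rconst p n m"
    then have rc: "rooted_constellation p M" and rd: "root_degree M = n * p" and wn: "weight_nonroot p M = m"
      unfolding rconst_def by auto
    \<comment> \<open>Pointing at the origin of the root edge gives it label 0, so the boundary word
      starts and ends at 0.\<close>
    let ?v = "vert M (al M (rt M))"
    have "rt M < nd M" "al M permutes {..<nd M}"
      using rc unfolding rooted_constellation_def is_planar_map_def perm_on_permutes by auto
    then have "?v \<in> vertices M" unfolding vertices_def using permutes_in_image[of "al M" "{..<nd M}" "rt M"] by auto
    then interpret pointed_constellation p M ?v by unfold_locales (use rc p in simp_all)
    have N: "nd M = ?N"
      using nd_weight(1)[OF rc p] unfolding nd_weight(2)[OF rc p] wn rd using p by (simp add: distrib_left mult.commute)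
    have art: "al M (rt M) < nd M" using rt_lt al_lt by simp
    have la: "lab 0 (al M (rt M)) = 0" using dist_zero[of "al M (rt M)"] by simp
    obtain w where w: "bword (sg M) (al M) (wh M) (lab 0) (rt M) ((True, lab 0 (rt M)) # w)"
      "\<forall>z\<in>set w. fst z" "walk p (lab 0 (al M (rt M))) ((True, lab 0 (rt M)) # w)"
      "endl (lab 0 (al M (rt M))) ((True, lab 0 (rt M)) # w) = lab 0 (al M (rt M))"
      "length w + 1 = root_degree M" using root_word .
    have "(True, lab 0 (rt M)) # w \<in> exwords p n"
      unfolding exwords_def mem_Collect_eq
    proof (intro conjI)
      show "length ((True, lab 0 (rt M)) # w) = n * p" using w(5) rd by simp
      show "\<forall>z\<in>set ((True, lab 0 (rt M)) # w). fst z" using w(2) by simp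
      show "walk p 0 ((True, lab 0 (rt M)) # w)" "endl 0 ((True, lab 0 (rt M)) # w) = 0"
        using w(3,4) unfolding la .
    qed
    moreover have "(sg M, al M, wh M, lab 0, rt M) \<in> lmaps p {..<?N} ((True, lab 0 (rt M)) # w) m"
      unfolding N[symmetric] lmaps_def mem_Collect_eq prod.case
      using lab_lmap[of 0] w(1) inner_eq[unfolded wn] by (intro conjI)
    ultimately have "(sg M, al M, wh M, lab 0, rt M) \<in> Orooted p n m" unfolding Orooted_def by blast
    moreover have "M = rcons_of ?N (sg M, al M, wh M, lab 0, rt M)" unfolding N[symmetric] rcons_of_eq[of 0] ..
    ultimately show "M \<in> rcons_of ?N ` Orooted p n m" by blast
  qed
qed

section \<open>Excursions\<close>

lemma class_count_pointed:
  assumes p: "p \<ge> 2" and i: "i \<ge> 1" and fin: "finite (Opointed p i a)"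
  shows "card (pconst p i a // iso_pointed) * fact (2 * (p * sum_mset a)) = card (Opointed p i a)"
proof -
  let ?N = "2 * (p * sum_mset a)"
  let ?f = "\<lambda>M. (rcons_of ?N M, sinks ?N M)"
  have obj: "\<exists>B m. M \<in> lmaps p {..<?N} B m" if "M \<in> Opointed p i a" for M using that unfolding Opointed_def by blast
  have sub: "sinks ?N M \<subseteq> {..<?N}" for M unfolding sinks_def by (cases M) auto
  have ndN: "nd (rcons_of ?N M) = ?N" for M by (cases M) simp
  have "card ((?f ` Opointed p i a) // iso_pointed) * fact ?N = card (Opointed p i a)"
  proof (rule class_count[OF fin Opointed_image(3)[OF p i] _ Opointed_image(2)[OF p i]])
    show "relO \<pi> M \<in> Opointed p i a" if "M \<in> Opointed p i a" "\<pi> permutes {..<?N}" for M \<pi>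
      using that relO_lmaps[OF that(2)] unfolding Opointed_def by blast
    show "rcons_of ?N M = rcons_of ?N M'" if "?f M = ?f M'" for M M' using that by simp
    show "(?f M1, ?f M2) \<in> iso_pointed \<longleftrightarrow> (\<exists>\<pi>. \<pi> permutes {..<?N} \<and> ?f M2 = ?f (relO \<pi> M1))"
      if M: "M1 \<in> Opointed p i a" "M2 \<in> Opointed p i a" for M1 M2
    proof
      obtain B1 m1 where M1: "M1 \<in> lmaps p {..<?N} B1 m1" using obj[OF M(1)] by blast
      obtain B2 m2 where M2: "M2 \<in> lmaps p {..<?N} B2 m2" using obj[OF M(2)] by blast
      {
        assume "(?f M1, ?f M2) \<in> iso_pointed"
        then obtain \<rho> where r: "iso_r (rcons_of ?N M1) (rcons_of ?N M2) \<rho>" "\<rho> ` sinks ?N M1 = sinks ?N M2"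
          unfolding iso_pointed_def by auto
        obtain \<pi> where pi: "\<pi> permutes {..<?N}" "rcons_of ?N M2 = rcons_of ?N (relO \<pi> M1)" "\<forall>h<?N. \<pi> h = \<rho> h"
          using iso_is_relO[OF M1 M2 r(1)] by blast
        have "\<pi> ` sinks ?N M1 = \<rho> ` sinks ?N M1" using pi(3) sub[of M1] by (intro image_cong) auto
        then have "sinks ?N M2 = sinks ?N (relO \<pi> M1)" using sinks_relO[OF pi(1) M1] r(2) by simp
        then show "\<exists>\<pi>. \<pi> permutes {..<?N} \<and> ?f M2 = ?f (relO \<pi> M1)" using pi(1,2) by auto
      next
        assume "\<exists>\<pi>. \<pi> permutes {..<?N} \<and> ?f M2 = ?f (relO \<pi> M1)"
        then obtain \<pi> where pi: "\<pi> permutes {..<?N}" "rcons_of ?N M2 = rcons_of ?N (relO \<pi> M1)" "sinks ?N M2 = sinks ?N (relO \<pi> M1)" by auto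
        have "iso_r (rcons_of ?N M1) (rcons_of ?N M2) \<pi>" using iso_relO[OF pi(1), of M1] pi(2) by simp
        moreover have "\<pi> ` sinks ?N M1 = sinks ?N M2" using sinks_relO[OF pi(1) M1] pi(3) by simp
        ultimately show "(?f M1, ?f M2) \<in> iso_pointed" unfolding iso_pointed_def by auto
      }
    qed
    show "iso_pointed `` {?f M1} = iso_pointed `` {?f M2}"
      if "M1 \<in> Opointed p i a" "M2 \<in> Opointed p i a" "(?f M1, ?f M2) \<in> iso_pointed" for M1 M2
      using iso_pointed_eq[OF that(3) Opointed_image(3)[OF p i that(1)]] sub[of M1] unfolding ndN by blast
  qed simp_all
  then show ?thesis unfolding Opointed_image(1)[OF p i] .
qed

lemma class_count_rooted:
  assumes p: "p \<ge> 2" and n: "n \<ge> 1" and fin: "finite (Orooted p n m)"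
  shows "card (rconst p n m // iso_rooted) * fact (2 * (n * p + p * sum_mset m)) = card (Orooted p n m)"
proof -
  let ?N = "2 * (n * p + p * sum_mset m)"
  have obj: "\<exists>B m. M \<in> lmaps p {..<?N} B m" if "M \<in> Orooted p n m" for M using that unfolding Orooted_def by blast
  have "card ((rcons_of ?N ` Orooted p n m) // iso_rooted) * fact ?N = card (Orooted p n m)"
  proof (rule class_count[OF fin Orooted_image(3)[OF p n] _ Orooted_image(2)[OF p n]])
    show "relO \<pi> M \<in> Orooted p n m" if "M \<in> Orooted p n m" "\<pi> permutes {..<?N}" for M \<pi>
      using that relO_lmaps[OF that(2)] unfolding Orooted_def by blast
    show "(rcons_of ?N M1, rcons_of ?N M2) \<in> iso_rooted \<longleftrightarrow> (\<exists>\<pi>. \<pi> permutes {..<?N} \<and> rcons_of ?N M2 = rcons_of ?N (relO \<pi> M1))"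
      if M: "M1 \<in> Orooted p n m" "M2 \<in> Orooted p n m" for M1 M2
    proof
      obtain B1 m1 where M1: "M1 \<in> lmaps p {..<?N} B1 m1" using obj[OF M(1)] by blast
      obtain B2 m2 where M2: "M2 \<in> lmaps p {..<?N} B2 m2" using obj[OF M(2)] by blast
      {
        assume "(rcons_of ?N M1, rcons_of ?N M2) \<in> iso_rooted"
        then obtain \<rho> where "iso_r (rcons_of ?N M1) (rcons_of ?N M2) \<rho>" unfolding iso_rooted_def by auto
        from iso_is_relO[OF M1 M2 this] show "\<exists>\<pi>. \<pi> permutes {..<?N} \<and> rcons_of ?N M2 = rcons_of ?N (relO \<pi> M1)" by blast
      next
        assume "\<exists>\<pi>. \<pi> permutes {..<?N} \<and> rcons_of ?N M2 = rcons_of ?N (relO \<pi> M1)"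
        then obtain \<pi> where pi: "\<pi> permutes {..<?N}" "rcons_of ?N M2 = rcons_of ?N (relO \<pi> M1)" by auto
        have "iso_r (rcons_of ?N M1) (rcons_of ?N M2) \<pi>" using iso_relO[OF pi(1), of M1] pi(2) by simp
        then show "(rcons_of ?N M1, rcons_of ?N M2) \<in> iso_rooted" unfolding iso_rooted_def by auto
      }
    qed
    show "iso_rooted `` {rcons_of ?N M1} = iso_rooted `` {rcons_of ?N M2}"
      if "M1 \<in> Orooted p n m" "M2 \<in> Orooted p n m" "(rcons_of ?N M1, rcons_of ?N M2) \<in> iso_rooted" for M1 M2
      using iso_rooted_eq[OF that(3) Orooted_image(3)[OF p n that(1)]] .
  qed simp_all
  then show ?thesis unfolding Orooted_image(1)[OF p n] .
qed

text \<open>A labelled map has only one boundary word, so the sets belonging to different words are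
  disjoint.\<close>

lemma card_Obj_UN:
  assumes "finite I" "inj_on w I" "\<And>Q. Q \<in> I \<Longrightarrow> finite (lmaps p D (w Q) (g Q)) \<and> card (lmaps p D (w Q) (g Q)) = F * f Q"
  shows "finite (\<Union>Q\<in>I. lmaps p D (w Q) (g Q))" "card (\<Union>Q\<in>I. lmaps p D (w Q) (g Q)) = F * (\<Sum>Q\<in>I. f Q)"
proof -
  show "finite (\<Union>Q\<in>I. lmaps p D (w Q) (g Q))" using assms(1,3) by blast
  have "card (\<Union>Q\<in>I. lmaps p D (w Q) (g Q)) = (\<Sum>Q\<in>I. card (lmaps p D (w Q) (g Q)))"
  proof (rule card_UN_disjoint[OF assms(1)])
    show "\<forall>Q\<in>I. finite (lmaps p D (w Q) (g Q))" using assms(3) by blast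
    show "\<forall>Q\<in>I. \<forall>Q'\<in>I. Q \<noteq> Q' \<longrightarrow> lmaps p D (w Q) (g Q) \<inter> lmaps p D (w Q') (g Q') = {}"
    proof (intro ballI impI)
      fix Q Q' assume Q: "Q \<in> I" "Q' \<in> I" "Q \<noteq> Q'"
      then have "w Q \<noteq> w Q'" using assms(2) by (meson inj_onD)
      then show "lmaps p D (w Q) (g Q) \<inter> lmaps p D (w Q') (g Q') = {}" using lmaps_word_unique by blast
    qed
  qed
  also have "\<dots> = F * (\<Sum>Q\<in>I. f Q)" using assms(3) by (simp add: sum_distrib_left)
  finally show "card (\<Union>Q\<in>I. lmaps p D (w Q) (g Q)) = F * (\<Sum>Q\<in>I. f Q)" .
qed

text \<open>This is the hypothesis \<open>VH\<close> of \<open>all_counted\<close> for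
  \<open>Vgf\<close>.\<close>

lemma Vgf_coeff:
  assumes p: "p \<ge> 2" and i: "i \<ge> 1"
    and Q: "\<And>Q. Q \<in> inner_face_words p (i - 1) a \<Longrightarrow>
        finite (lmaps p {..<2 * (p * sum_mset a)} ((True, i - 1) # Q) (a - {#face_weight p Q#})) \<and>
        card (lmaps p {..<2 * (p * sum_mset a)} ((True, i - 1) # Q) (a - {#face_weight p Q#})) = fact (2 * (p * sum_mset a)) * f Q"
  shows "Vgf p i a = ser_one a + (\<Sum>Q\<in>inner_face_words p (i - 1) a. f Q)"
proof -
  have c: "finite (Opointed p i a)" "card (Opointed p i a) = fact (2 * (p * sum_mset a)) * (\<Sum>Q\<in>inner_face_words p (i - 1) a. f Q)"
    unfolding Opointed_def
    by (rule card_Obj_UN[where w = "\<lambda>Q. (True, i - 1) # Q", OF finite_inner_face_words[OF p] _ Q]; simp add: inj_on_def)+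
  have "card (pconst p i a // iso_pointed) = (\<Sum>Q\<in>inner_face_words p (i - 1) a. f Q)"
    using class_count_pointed[OF p i c(1)] unfolding c(2) by (simp add: mult.commute)
  then show ?thesis unfolding Vgf_def ser_add_def pconst_def by simp
qed

lemma finite_exwords: "finite (exwords p n)"
  unfolding exwords_def by (rule finite_subset[OF _ finite_walks[of "n * p" p 0]]) auto

lemma Fgf_coeff:
  assumes p: "p \<ge> 2"
  shows "Fgf p n m = (\<Sum>B\<in>exwords p n. walkw (Vgf p) 0 B m)"
proof (cases "n = 0")
  case True
  then have "exwords p n = {[]}" unfolding exwords_def by auto
  then show ?thesis using True by (simp add: Fgf_def)
next
  case False
  then have n: "n \<ge> 1" by simp
  let ?N = "2 * (n * p + p * sum_mset m)"
  have B: "finite (lmaps p {..<?N} B m) \<and> card (lmaps p {..<?N} B m) = fact ?N * walkw (Vgf p) 0 B m" if "B \<in> exwords p n" for B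
  proof -
    have B: "length B = n * p" "\<forall>z\<in>set B. fst z" "walk p 0 B" "endl 0 B = 0" using that unfolding exwords_def by simp_all
    have "filter fst B = B" using B(2) by (simp add: filter_id_conv)
    then have "card {..<?N} = 2 * (nwhite B + p * sum_mset m)" using B(1) by simp
    moreover have "B \<noteq> []" using B(1) n p by auto
    ultimately have "counted p (Vgf p) {..<?N} 0 B m"
      by (intro all_counted[OF p Vgf_coeff[OF p]] B(3,4)) simp_all
    then show ?thesis unfolding counted_def by simp
  qed
  have c: "finite (Orooted p n m)" "card (Orooted p n m) = fact ?N * (\<Sum>B\<in>exwords p n. walkw (Vgf p) 0 B m)"
    unfolding Orooted_def
    by (rule card_Obj_UN[where w = "\<lambda>B. B", OF finite_exwords _ B]; simp)+
  have "card (rconst p n m // iso_rooted) = (\<Sum>B\<in>exwords p n. walkw (Vgf p) 0 B m)"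
    using class_count_rooted[OF p n c(1)] unfolding c(2) by (simp add: mult.commute)
  then show ?thesis using False unfolding Fgf_def rconst_def by simp
qed

section \<open>Excursions as closed white walks\<close>

definition nonneg :: "nat \<Rightarrow> bool list \<Rightarrow> bool" where
  "nonneg p s \<longleftrightarrow> (\<forall>j\<le>length s. height p (take j s) \<ge> 0)"

text \<open>A letter records the height after its step, as in boundary words; hence
  \<open>Suc j\<close>.\<close>

definition path_word :: "nat \<Rightarrow> bool list \<Rightarrow> (bool \<times> nat) list" where
  "path_word p s = map (\<lambda>j. (True, nat (height p (take (Suc j) s)))) [0..<length s]"

lemma height_snoc: "height p (s @ [b]) = height p s + (if b then int (p - 1) else - 1)"
  unfolding height_def by (simp add: algebra_simps)

lemma nonneg_snoc: "nonneg p (s @ [b]) \<longleftrightarrow> nonneg p s \<and> height p (s @ [b]) \<ge> 0"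
proof -
  have "(\<forall>j\<le>Suc (length s). P j) \<longleftrightarrow> (\<forall>j\<le>length s. P j) \<and> P (Suc (length s))" for P
    by (auto simp: le_Suc_eq)
  then show ?thesis unfolding nonneg_def by simp
qed

lemma path_word_snoc: "path_word p (s @ [b]) = path_word p s @ [(True, nat (height p (s @ [b])))]"
  unfolding path_word_def by (auto simp: Suc_le_eq)

lemma path_weight_snoc:
  "path_weight p V (s @ [b]) = ser_mult (path_weight p V s) (if b then ser_one else V (nat (height p s)))"
proof -
  have pl: "ser_prod_list (xs @ ys) = ser_mult (ser_prod_list xs) (ser_prod_list ys)" for xs ys
    unfolding ser_prod_list_def by (induction xs) (simp_all add: ser.assoc ser.left_neutral)
  have f: "filter (\<lambda>j. \<not> (s @ [b]) ! j) [0..<length s] = filter (\<lambda>j. \<not> s ! j) [0..<length s]"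
    by (rule filter_cong) (auto simp: nth_append)
  have m: "map (\<lambda>j. V (nat (height p (take j (s @ [b]))))) (filter (\<lambda>j. \<not> s ! j) [0..<length s]) =
    map (\<lambda>j. V (nat (height p (take j s)))) (filter (\<lambda>j. \<not> s ! j) [0..<length s])"
    by (rule map_cong) auto
  have one: "ser_prod_list [] = ser_one" "ser_prod_list [x] = x" for x
    unfolding ser_prod_list_def by (simp_all add: ser.right_neutral)
  have l: "take (length s) (s @ [a]) = s" for a by simp
  show ?thesis unfolding path_weight_def
    by (simp add: pl f m one l del: take_append)
qed

text \<open>Induction from the right, because heights and weights are read off prefixes.\<close>

lemma path_word_props:
  assumes "p \<ge> 2" "nonneg p s"
  shows "walk p 0 (path_word p s) \<and> endl 0 (path_word p s) = nat (height p s) \<and> (\<forall>z\<in>set (path_word p s). fst z) \<and>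
    path_weight p V s = walkw V 0 (path_word p s)"
  using assms(2)
proof (induction s rule: rev_induct)
  case Nil
  show ?case by (simp add: path_word_def height_def path_weight_def ser_prod_list_def)
next
  case (snoc b s)
  have ns: "nonneg p s" and h: "height p (s @ [b]) \<ge> 0" using snoc.prems unfolding nonneg_snoc by simp_all
  have h0: "height p s \<ge> 0" using ns unfolding nonneg_def by (metis order_refl take_all)
  let ?x = "nat (height p s)" and ?y = "nat (height p (s @ [b]))"
  have xy: "if b then ?y = ?x + (p - 1) else ?x = ?y + 1"
    using h h0 unfolding height_snoc by auto
  have ok: "okw p ?x (True, ?y)" using xy by (auto split: if_splits)
  have "stepw V ?x (True, ?y) = (if b then ser_one else V ?x)" using xy assms(1) by (auto split: if_splits)
  then show ?case using snoc.IH[OF ns] ok unfolding path_word_snoc path_weight_snoc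
    by (simp add: walkw_append ser.right_neutral del: okw.simps stepw.simps)
qed

text \<open>A rise and a fall from the same height end at different heights, so the heights
  determine every step.\<close>

lemma path_word_inj:
  assumes p: "p \<ge> 2"
  shows "nonneg p s \<Longrightarrow> nonneg p t \<Longrightarrow> path_word p s = path_word p t \<Longrightarrow> s = t"
proof (induction s arbitrary: t rule: rev_induct)
  case Nil
  then have "length (path_word p t) = 0" by (simp add: path_word_def)
  then show ?case by (simp add: path_word_def)
next
  case (snoc b s)
  have "length (path_word p (s @ [b])) = length (path_word p t)" using snoc.prems(3) by simp
  then have "t \<noteq> []" unfolding path_word_def by auto
  then obtain t' b' where t: "t = t' @ [b']" by (metis rev_exhaust)
  have e: "path_word p s = path_word p t'" "nat (height p (s @ [b])) = nat (height p (t' @ [b']))"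
    using snoc.prems(3) unfolding t path_word_snoc by simp_all
  have st: "s = t'" using snoc.IH[of t'] snoc.prems e(1) unfolding t nonneg_snoc by blast
  have "height p (s @ [b]) = height p (s @ [b'])" using e(2) snoc.prems(1,2) unfolding t st nonneg_snoc by (simp add: eq_nat_nat_iff)
  then have "b = b'" using p unfolding height_snoc by (auto split: if_splits)
  then show ?case unfolding t st by simp
qed

lemma path_word_surj:
  assumes p: "p \<ge> 2"
  shows "walk p 0 B \<Longrightarrow> \<forall>z\<in>set B. fst z \<Longrightarrow> \<exists>s. nonneg p s \<and> path_word p s = B"
proof (induction B rule: rev_induct)
  case Nil
  show ?case by (rule exI[of _ "[]"]) (simp add: nonneg_def path_word_def height_def)
next
  case (snoc z B)
  obtain y where z: "z = (True, y)" using snoc.prems(2) by (cases z) auto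
  obtain s where s: "nonneg p s" "path_word p s = B" using snoc by auto
  let ?x = "endl 0 B"
  have x: "?x = nat (height p s)" using path_word_props[OF p s(1)] s(2) by simp
  have h0: "height p s \<ge> 0" using s(1) unfolding nonneg_def by (metis order_refl take_all)
  have "?x = y + 1 \<or> y = ?x + (p - 1)" using snoc.prems(1) z by simp
  then obtain b where b: "height p (s @ [b]) = int y"
  proof
    assume "?x = y + 1"
    then have "height p (s @ [False]) = int y" using x h0 by (simp add: height_snoc)
    then show ?thesis by (rule that)
  next
    assume "y = ?x + (p - 1)"
    then have "height p (s @ [True]) = int y" using x h0 by (simp add: height_snoc)
    then show ?thesis by (rule that)
  qed
  have "nonneg p (s @ [b])" unfolding nonneg_snoc using s b by simp
  moreover have "path_word p (s @ [b]) = B @ [z]" unfolding path_word_snoc s(2) b z by simp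
  ultimately show ?case by blast
qed

lemma excursion_bij:
  assumes p: "p \<ge> 2"
  shows "bij_betw (path_word p) {s. p_excursion p n s} (exwords p n)"
  unfolding bij_betw_def
proof (intro conjI equalityI subsetI)
  have len: "length (path_word p s) = length s" for s unfolding path_word_def by simp
  have ex: "p_excursion p n s \<longleftrightarrow> length s = n * p \<and> nonneg p s \<and> height p s = 0" for s
    unfolding p_excursion_def nonneg_def by simp
  show "inj_on (path_word p) {s. p_excursion p n s}"
    using path_word_inj[OF p] unfolding inj_on_def ex by blast
  fix B
  {
    assume "B \<in> path_word p ` {s. p_excursion p n s}"
    then obtain s where s: "B = path_word p s" "length s = n * p" "nonneg p s" "height p s = 0" unfolding ex by auto
    then show "B \<in> exwords p n" using path_word_props[OF p s(3)] unfolding exwords_def by (simp add: len)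
  next
    assume B: "B \<in> exwords p n"
    then obtain s where s: "nonneg p s" "path_word p s = B" using path_word_surj[OF p, of B] unfolding exwords_def by auto
    have h0: "height p s \<ge> 0" using s(1) unfolding nonneg_def by (metis order_refl take_all)
    have "nat (height p s) = 0" using path_word_props[OF p s(1)] s(2) B unfolding exwords_def by simp
    then have "height p s = 0" using h0 by simp
    moreover have "length s = n * p" using len[of s] s(2) B unfolding exwords_def by simp
    ultimately show "B \<in> path_word p ` {s. p_excursion p n s}" using s unfolding ex by auto
  }
qed

theorem theorem2:
  fixes p n :: nat
  assumes "p \<ge> 2"
  shows "Fgf p n = ser_sum (path_weight p (Vgf p)) {s. p_excursion p n s}"
proof
  fix m
  have "Fgf p n m = (\<Sum>B\<in>exwords p n. walkw (Vgf p) 0 B m)" by (rule Fgf_coeff[OF assms])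
  also have "\<dots> = (\<Sum>s\<in>{s. p_excursion p n s}. walkw (Vgf p) 0 (path_word p s) m)"
    by (rule sum.reindex_bij_betw[OF excursion_bij[OF assms], symmetric])
  also have "\<dots> = (\<Sum>s\<in>{s. p_excursion p n s}. path_weight p (Vgf p) s m)"
    using path_word_props[OF assms] unfolding p_excursion_def nonneg_def by (intro sum.cong) auto
  finally show "Fgf p n m = ser_sum (path_weight p (Vgf p)) {s. p_excursion p n s} m"
    unfolding ser_sum_def .
qed

end
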